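(* Let $q\in\mathbf C^*$ and let $\kappa_1,\kappa_2,\theta_1,\theta_2,c_1,c_2,c_3,c_4$ be generic nonzero complex parameters with $\kappa_1\kappa_2c_1c_2c_3c_4=\theta_1\theta_2$. Let $Y_{\kappa_1,\kappa_2,\theta_1,\theta_2}$ denote $\mathbf P^1\times\mathbf P^1$ (with coordinates $(y,\xi)$) blown up at the eight points $$(c_1,0),\ (c_2,0),\ (c_3,\infty),\ (c_4,\infty),\ (0,c_1c_2/\theta_1),\ (0,c_1c_2/\theta_2),\ (\infty,1/\kappa_1),\ (\infty,q/\kappa_2),$$ minus the strict transforms of the four lines $y=0$, $y=\infty$, $\xi=0$, $\xi=\infty$. Let $Y_{q\kappa_1,\kappa_2,q\theta_1,\theta_2}$ be the surface defined in the same way with $(\kappa_1,\theta_1)$ replaced by $(q\kappa_1,q\theta_1)$. Then the birational map $\phi$, expressed in the coordinates $(y,\xi)$, extends to a regular isomorphism between $Y_{\kappa_1,\kappa_2,\theta_1,\theta_2}$ and $Y_{q\kappa_1,\kappa_2,q\theta_1,\theta_2}$.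
   Context: The spaces. Let $H$ be a two-dimensional complex vector space. $\bar X_{\kappa_1,\kappa_2,\theta_1,\theta_2}$ (the $c_i$ being fixed and omitted from the notation) is the space of $A(z)=A_0+A_1z+A_2z^2$ with $A_i\in\mathrm{End}(H)$, such that $A_2$ has spectrum $\{\kappa_1,\kappa_2\}$, $A_0$ has spectrum $\{\theta_1,\theta_2\}$, and $\det A(z)=\kappa_1\kappa_2(z-c_1)(z-c_2)(z-c_3)(z-c_4)$. $X_{\kappa_1,\kappa_2,\theta_1,\theta_2}$ is the quotient of $\bar X_{\kappa_1,\kappa_2,\theta_1,\theta_2}$ by conjugation by $GL(H)$. Parameters are generic; in particular $\kappa_1\ne\kappa_2$, $\theta_1\ne\theta_2$, $q\kappa_1\neq\kappa_2$, $q\theta_1\neq\theta_2$. $E_1,E_2$ denote the eigenspaces of $A_2$ (for $\kappa_1,\kappa_2$) and $F_1,F_2$ those of $A_0$ (for $\theta_1,\theta_2$). The map $\phi$. On the dense open set where $E_2\neq F_1$, choose a basis $(u,v)$ of $H$ with $u\in F_1$, $v\in E_2$; in this basis $A_2=\begin{pmatrix}\kappa_1&0\\ *&\kappa_2\end{pmatrix}$, $A_0=\begin{pmatrix}\theta_1&*\\0&\theta_2\end{pmatrix}$. Then $$\hat A(z)=\begin{pmatrix}qz&0\\0&1\end{pmatrix}A(z)\begin{pmatrix}z^{-1}&0\\0&1\end{pmatrix}$$ is a polynomial matrix belonging to $\bar X_{q\kappa_1,\kappa_2,q\theta_1,\theta_2}$ (with the same $c_i$), and $\phi:X_{\kappa_1,\kappa_2,\theta_1,\theta_2}\to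 X_{q\kappa_1,\kappa_2,q\theta_1,\theta_2}$ is the birational map sending the class of $A$ to the class of $\hat A$. Coordinates. In a basis $(u,v)$ of $H$ with $u\in F_1$, $v\in E_2$, suitably scaled, a generic $A$ has the form $$A(z)=\begin{pmatrix}\kappa_1z^2+az+\theta_1& z-y\\ z(\gamma z+\beta)&\kappa_2z^2+bz+\theta_2\end{pmatrix}.$$ So $y$ is the root of the $12$ entry. The coordinate $\xi$ is defined by $$\xi=\frac{(y-c_1)(y-c_2)}{\kappa_1y^2+ay+\theta_1}.$$ The pair $(y,\xi)$ parametrizes a dense open subset of $X_{\kappa_1,\kappa_2,\theta_1,\theta_2}$. The coordinates on $X_{q\kappa_1,\kappa_2,q\theta_1,\theta_2}$ are defined in the same way, with $\kappa_1,\theta_1$ replaced by $q\kappa_1,q\theta_1$. In these coordinates $\phi$ is a birational self-map of $\mathbf P^1\times\mathbf P^1$. *)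

theory Defs
  imports "HOL-Analysis.Analysis"
begin

text \<open>The algebra of complex-valued functions generated by a set \<open>X\<close> of coordinate functions.
  For the coordinates of an affine space these are exactly the polynomial functions.\<close>

inductive_set poly_funs :: "('a \<Rightarrow> complex) set \<Rightarrow> ('a \<Rightarrow> complex) set"
  for X :: "('a \<Rightarrow> complex) set" where
  coord: "x \<in> X \<Longrightarrow> x \<in> poly_funs X"
| const: "(\<lambda>_. k) \<in> poly_funs X"
| add: "f \<in> poly_funs X \<Longrightarrow> g \<in> poly_funs X \<Longrightarrow> (\<lambda>w. f w + g w) \<in> poly_funs X"
| mult: "f \<in> poly_funs X \<Longrightarrow> g \<in> poly_funs X \<Longrightarrow> (\<lambda>w. f w * g w) \<in> poly_funs X"

abbreviation poly2 :: "(complex \<times> complex \<Rightarrow> complex) set" where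
  "poly2 \<equiv> poly_funs {fst, snd}"


section \<open>Parameters\<close>

record params =
  kap1 :: complex
  kap2 :: complex
  th1 :: complex
  th2 :: complex
  c1 :: complex
  c2 :: complex
  c3 :: complex
  c4 :: complex

definition param_space :: "complex \<Rightarrow> params set" where
  "param_space q = {P.
     kap1 P \<noteq> 0 \<and> kap2 P \<noteq> 0 \<and> th1 P \<noteq> 0 \<and> th2 P \<noteq> 0 \<and>
     c1 P \<noteq> 0 \<and> c2 P \<noteq> 0 \<and> c3 P \<noteq> 0 \<and> c4 P \<noteq> 0 \<and>
     kap1 P * kap2 P * c1 P * c2 P * c3 P * c4 P = th1 P * th2 P \<and>
     kap1 P \<noteq> kap2 P \<and> th1 P \<noteq> th2 P \<and> q * kap1 P \<noteq> kap2 P \<and> q * th1 P \<noteq> th2 P}"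

text \<open>A property holds for generic parameters if it holds on a nonempty Zariski-open subset of
  the parameter space. That space is a nonempty open subset of the irreducible hypersurface
  \<open>\<kappa>\<^sub>1\<kappa>\<^sub>2c\<^sub>1c\<^sub>2c\<^sub>3c\<^sub>4 = \<theta>\<^sub>1\<theta>\<^sub>2\<close> in the torus, so such a subset is dense, and it suffices to
  consider the nonvanishing locus of one polynomial.\<close>

definition for_generic_params :: "complex \<Rightarrow> (params \<Rightarrow> bool) \<Rightarrow> bool" where
  "for_generic_params q Q \<longleftrightarrow>
     (\<exists>G \<in> poly_funs {kap1, kap2, th1, th2, c1, c2, c3, c4}.
        (\<exists>P \<in> param_space q. G P \<noteq> 0) \<and>
        (\<forall>P \<in> param_space q. G P \<noteq> 0 \<longrightarrow> Q P))"

definition shift :: "complex \<Rightarrow> params \<Rightarrow> params" where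
  "shift q P = P\<lparr>kap1 := q * kap1 P, th1 := q * th1 P\<rparr>"


section \<open>The spaces of polynomial matrices\<close>

text \<open>We take \<open>H = \<complex>\<^sup>2\<close>; the triple \<open>(A\<^sub>0, A\<^sub>1, A\<^sub>2)\<close> stands for \<open>A\<^sub>0 + A\<^sub>1 z + A\<^sub>2 z\<^sup>2\<close>.\<close>

type_synonym mat2 = "complex^2^2"
type_synonym quad_mat = "mat2 \<times> mat2 \<times> mat2"

definition mat22 :: "complex \<Rightarrow> complex \<Rightarrow> complex \<Rightarrow> complex \<Rightarrow> mat2" where
  "mat22 a b c d = vector [vector [a, b], vector [c, d]]"

fun qeval :: "quad_mat \<Rightarrow> complex \<Rightarrow> mat2" where
  "qeval (A0, A1, A2) z = (\<chi> i j. A0 $ i $ j + A1 $ i $ j * z + A2 $ i $ j * z\<^sup>2)"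

definition mat_spectrum :: "mat2 \<Rightarrow> complex set" where
  "mat_spectrum M = {l. \<exists>v. v \<noteq> 0 \<and> M *v v = l *s v}"

definition Xbar :: "params \<Rightarrow> quad_mat set" where
  "Xbar P = {(A0, A1, A2).
     mat_spectrum A2 = {kap1 P, kap2 P} \<and> mat_spectrum A0 = {th1 P, th2 P} \<and>
     (\<forall>z. det (qeval (A0, A1, A2) z) =
        kap1 P * kap2 P * (z - c1 P) * (z - c2 P) * (z - c3 P) * (z - c4 P))}"

definition conj_rel :: "params \<Rightarrow> (quad_mat \<times> quad_mat) set" where
  "conj_rel P = {(A, B). A \<in> Xbar P \<and> B \<in> Xbar P \<and>
     (\<exists>g :: mat2. invertible g \<and> (\<forall>z. qeval B z = g ** qeval A z ** matrix_inv g))}"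

definition Xquot :: "params \<Rightarrow> quad_mat set set" where
  "Xquot P = Xbar P // conj_rel P"


section \<open>The map \<open>\<phi>\<close> in coordinates\<close>

text \<open>The standard basis \<open>(u, v)\<close> satisfies \<open>u \<in> F\<^sub>1\<close> and \<open>v \<in> E\<^sub>2\<close>. Choosing a basis \<open>(u, v)\<close> of
  this kind for \<open>A\<close> means choosing an adapted member of the conjugacy class of \<open>A\<close>; such
  a member exists iff \<open>E\<^sub>2 \<noteq> F\<^sub>1\<close>.\<close>

fun adapted :: "params \<Rightarrow> quad_mat \<Rightarrow> bool" where
  "adapted P (A0, A1, A2) \<longleftrightarrow>
     A0 *v axis 1 1 = th1 P *s axis 1 1 \<and> A2 *v axis 2 1 = kap2 P *s axis 2 1"

definition phi_rel :: "complex \<Rightarrow> params \<Rightarrow> quad_mat set \<Rightarrow> quad_mat set \<Rightarrow> bool" where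
  "phi_rel q P C C' \<longleftrightarrow> C \<in> Xquot P \<and> C' \<in> Xquot (shift q P) \<and>
     (\<exists>A \<in> C. \<exists>B \<in> C'. adapted P A \<and>
        (\<forall>z. z \<noteq> 0 \<longrightarrow> qeval B z = mat22 (q * z) 0 0 1 ** qeval A z ** mat22 (inverse z) 0 0 1))"

definition has_coords :: "params \<Rightarrow> quad_mat set \<Rightarrow> complex \<Rightarrow> complex \<Rightarrow> bool" where
  "has_coords P C y \<xi> \<longleftrightarrow> C \<in> Xquot P \<and>
     (\<exists>A \<in> C. \<exists>a b \<gamma> \<beta>.
        (\<forall>z. qeval A z = mat22 (kap1 P * z\<^sup>2 + a * z + th1 P) (z - y)
                               (z * (\<gamma> * z + \<beta>)) (kap2 P * z\<^sup>2 + b * z + th2 P)) \<and>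
        kap1 P * y\<^sup>2 + a * y + th1 P \<noteq> 0 \<and>
        \<xi> = (y - c1 P) * (y - c2 P) / (kap1 P * y\<^sup>2 + a * y + th1 P))"

definition phi_coords :: "complex \<Rightarrow> params \<Rightarrow> ((complex \<times> complex) \<times> (complex \<times> complex)) set" where
  "phi_coords q P = {((y, \<xi>), (y', \<xi>')).
     \<exists>C C'. phi_rel q P C C' \<and> has_coords P C y \<xi> \<and> has_coords (shift q P) C' y' \<xi>'}"


section \<open>Blow-ups of \<open>P\<^sup>1 \<times> P\<^sup>1\<close>\<close>

datatype P1 = Aff complex | Infty

text \<open>Parametrization of an affine neighbourhood of a point of \<open>P\<^sup>1\<close> by the local coordinate
  \<open>y - a\<close> at \<open>a\<close>, respectively \<open>1/y\<close> at \<open>\<infinity>\<close>.\<close>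

fun loc :: "P1 \<Rightarrow> complex \<Rightarrow> P1" where
  "loc (Aff a) s = Aff (a + s)"
| "loc Infty s = (if s = 0 then Infty else Aff (1 / s))"

text \<open>Points of a blow-up: points away from the centres, and, for a centre \<open>p\<close> with local
  coordinates \<open>(s, t)\<close>, the points of the exceptional curve over \<open>p\<close>, that is, tangent
  directions \<open>[s : t]\<close> at \<open>p\<close>, recorded by the ratio \<open>s/t\<close> in \<open>P\<^sup>1\<close>.\<close>

datatype bl_point = Off "P1 \<times> P1" | Exc "P1 \<times> P1" P1

definition blowup :: "(P1 \<times> P1) set \<Rightarrow> bl_point set" where
  "blowup S = Off ` (- S) \<union> {Exc p d | p d. p \<in> S}"

fun chart0 :: "P1 \<times> P1 \<Rightarrow> complex \<times> complex \<Rightarrow> bl_point" where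
  "chart0 (a, b) (s, t) = Off (loc a s, loc b t)"

text \<open>The two standard charts of the blow-up at \<open>(a, b)\<close>: \<open>(s, t) = (m t, t)\<close> and
  \<open>(s, t) = (s, s n)\<close>.\<close>

fun chart1 :: "P1 \<times> P1 \<Rightarrow> complex \<times> complex \<Rightarrow> bl_point" where
  "chart1 (a, b) (m, t) = (if t = 0 then Exc (a, b) (Aff m) else Off (loc a (m * t), loc b t))"

fun chart2 :: "P1 \<times> P1 \<Rightarrow> complex \<times> complex \<Rightarrow> bl_point" where
  "chart2 (a, b) (s, n) = (if s = 0 then Exc (a, b) (loc Infty n) else Off (loc a s, loc b (s * n)))"

text \<open>Each chart is used where its values lie in \<open>blowup S\<close>, a Zariski-open subset of
  \<open>\<complex>\<^sup>2\<close> for finite \<open>S\<close>.\<close>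

definition charts :: "(P1 \<times> P1) set \<Rightarrow> (complex \<times> complex \<Rightarrow> bl_point) set" where
  "charts S = range chart0 \<union> chart1 ` S \<union> chart2 ` S"

definition zclosed :: "(P1 \<times> P1) set \<Rightarrow> bl_point set \<Rightarrow> bool" where
  "zclosed S Z \<longleftrightarrow> Z \<subseteq> blowup S \<and>
     (\<forall>ch \<in> charts S. \<exists>F \<subseteq> poly2. \<forall>w. ch w \<in> blowup S \<longrightarrow> (ch w \<in> Z \<longleftrightarrow> (\<forall>f \<in> F. f w = 0)))"

definition zclosure :: "(P1 \<times> P1) set \<Rightarrow> bl_point set \<Rightarrow> bl_point set" where
  "zclosure S A = \<Inter> {Z. zclosed S Z \<and> A \<subseteq> Z}"

definition strict_transform :: "(P1 \<times> P1) set \<Rightarrow> (P1 \<times> P1) set \<Rightarrow> bl_point set" where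
  "strict_transform S L = zclosure S (Off ` (L - S))"

text \<open>Regular maps between Zariski-open subsets \<open>U\<close>, \<open>U'\<close> of the blow-ups at \<open>S\<close>, \<open>S'\<close>:
  near every point, in suitable charts, given by rational functions without poles.\<close>

definition regular_map ::
  "(P1 \<times> P1) set \<Rightarrow> bl_point set \<Rightarrow> (P1 \<times> P1) set \<Rightarrow> bl_point set \<Rightarrow> (bl_point \<Rightarrow> bl_point) \<Rightarrow> bool"
where
  "regular_map S U S' U' f \<longleftrightarrow> f ` U \<subseteq> U' \<and>
     (\<forall>x \<in> U. \<exists>ch \<in> charts S. \<exists>ch' \<in> charts S'. \<exists>w\<^sub>0. \<exists>n\<^sub>1 \<in> poly2. \<exists>n\<^sub>2 \<in> poly2. \<exists>d \<in> poly2.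
        ch w\<^sub>0 = x \<and> d w\<^sub>0 \<noteq> 0 \<and>
        (\<forall>w. ch w \<in> U \<and> d w \<noteq> 0 \<longrightarrow> f (ch w) = ch' (n\<^sub>1 w / d w, n\<^sub>2 w / d w)))"

definition regular_iso ::
  "(P1 \<times> P1) set \<Rightarrow> bl_point set \<Rightarrow> (P1 \<times> P1) set \<Rightarrow> bl_point set \<Rightarrow> (bl_point \<Rightarrow> bl_point) \<Rightarrow> bool"
where
  "regular_iso S U S' U' f \<longleftrightarrow> bij_betw f U U' \<and>
     regular_map S U S' U' f \<and> regular_map S' U' S U (inv_into U f)"


section \<open>The surfaces \<open>Y\<close>\<close>

definition centres :: "complex \<Rightarrow> params \<Rightarrow> (P1 \<times> P1) set" where
  "centres q P =
     {(Aff (c1 P), Aff 0), (Aff (c2 P), Aff 0), (Aff (c3 P), Infty), (Aff (c4 P), Infty),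
      (Aff 0, Aff (c1 P * c2 P / th1 P)), (Aff 0, Aff (c1 P * c2 P / th2 P)),
      (Infty, Aff (1 / kap1 P)), (Infty, Aff (q / kap2 P))}"

definition Ysurf :: "complex \<Rightarrow> params \<Rightarrow> bl_point set" where
  "Ysurf q P = blowup (centres q P) -
     (strict_transform (centres q P) ({Aff 0} \<times> UNIV) \<union>
      strict_transform (centres q P) ({Infty} \<times> UNIV) \<union>
      strict_transform (centres q P) (UNIV \<times> {Aff 0}) \<union>
      strict_transform (centres q P) (UNIV \<times> {Infty}))"

text \<open>\<open>\<phi>\<close> in coordinates, as a partial map from \<open>Y\<close> to \<open>Y'\<close>, and extensions of this partial map;
  the second clause of \<open>extends_phi\<close> says that the domain is dense in \<open>Y\<close>.\<close>

definition phi_graph :: "complex \<Rightarrow> params \<Rightarrow> (bl_point \<times> bl_point) set" where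
  "phi_graph q P = {(x, x'). x \<in> Ysurf q P \<and> x' \<in> Ysurf q (shift q P) \<and>
     (\<exists>y \<xi> y' \<xi>'. x = Off (Aff y, Aff \<xi>) \<and> x' = Off (Aff y', Aff \<xi>') \<and>
        ((y, \<xi>), (y', \<xi>')) \<in> phi_coords q P)}"

definition extends_phi :: "complex \<Rightarrow> params \<Rightarrow> (bl_point \<Rightarrow> bl_point) \<Rightarrow> bool" where
  "extends_phi q P f \<longleftrightarrow>
     (\<forall>(x, x') \<in> phi_graph q P. f x = x') \<and>
     Ysurf q P \<subseteq> zclosure (centres q P) (Domain (phi_graph q P))"

end

theory Submission
  imports Defs
begin

text \<open>On the torus \<open>y \<noteq> 0\<close>, \<open>\<xi> \<noteq> 0\<close> the map \<open>\<phi>\<close> factors as follows. Write \<open>\<xi>\<^sub>5 = c\<^sub>1c\<^sub>2/\<theta>\<^sub>1\<close>,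
  \<open>\<xi>\<^sub>6 = c\<^sub>1c\<^sub>2/\<theta>\<^sub>2\<close>, \<open>\<xi>\<^sub>7 = 1/\<kappa>\<^sub>1\<close>, \<open>\<xi>\<^sub>8 = q/\<kappa>\<^sub>2\<close>. Then
  \<open>Y = (\<xi> - \<xi>\<^sub>5)/(y (\<xi> - \<xi>\<^sub>8))\<close>,
  \<open>\<xi>' = \<xi>\<^sub>6\<xi>\<^sub>8 (Y - A\<^sub>1)(Y - A\<^sub>2)/((Y - 1/c\<^sub>3)(Y - 1/c\<^sub>4) \<xi>)\<close> with \<open>A\<^sub>i = \<xi>\<^sub>5/(c\<^sub>i\<xi>\<^sub>8)\<close>, and
  \<open>y' = c\<^sub>3c\<^sub>4 Y (\<xi>' - \<xi>\<^sub>6)/(\<xi>' - \<xi>\<^sub>7/q)\<close>.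
  Up to swapping and inverting coordinates, each step is a product of elementary maps
  \<open>(y, \<xi>) \<mapsto> (l (\<xi> - p)/(y (\<xi> - r)), \<xi>)\<close>, where \<open>(0, p)\<close> and \<open>(\<infinity>, r)\<close> are centres. Such a map extends to
  an isomorphism of blown-up surfaces minus the four lines: it exchanges the exceptional curves over
  these two centres with the fibres through them and permutes the others. That the composite agrees
  with \<open>\<phi>\<close> on the domain of \<open>\<phi>\<close> has to be checked only generically, because both maps are regular.\<close>

section \<open>Rational functions on the plane\<close>

text \<open>Local computations with the full formulas of \<open>\<phi>\<close> at eight exceptional
  curves are avoided: an elementary map concerns two centres on opposite lines and is given by the
  same formula as its inverse, so regularity of the inverse costs nothing extra. The price is to
  follow all eight centres through the factors; the relation
  \<open>\<kappa>\<^sub>1\<kappa>\<^sub>2c\<^sub>1c\<^sub>2c\<^sub>3c\<^sub>4 =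
  \<theta>\<^sub>1\<theta>\<^sub>2\<close> is what brings them to the centres of the target surface.
  On the matrix side \<open>\<phi>\<close> is only a relation between conjugacy classes, so two
  implications are proved. Related points satisfy equations that force \<open>(y', \<xi>')\<close>,
  which gives the values of \<open>\<phi>\<close> wherever it is defined; conversely, explicit
  conjugations show that generic points are related, which gives density of the domain. The variable
  \<open>Y\<close> does not occur in the matrices. It is tied to \<open>(y, \<xi>)\<close> and
  \<open>(y', \<xi>')\<close> by three relations, and eliminating it makes the two descriptions
  meet.\<close>

lemma poly_funs_uminus: "f \<in> poly_funs X \<Longrightarrow> (\<lambda>w. - f w) \<in> poly_funs X"
  using poly_funs.mult[OF poly_funs.const[of "-1"], of f X] by simp

lemma poly_funs_diff:
  "f \<in> poly_funs X \<Longrightarrow> g \<in> poly_funs X \<Longrightarrow> (\<lambda>w. f w - g w) \<in> poly_funs X"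
  using poly_funs.add[OF _ poly_funs_uminus, of f X g] by simp

lemmas poly_funs_intros =
  poly_funs.const poly_funs.add poly_funs.mult poly_funs_uminus poly_funs_diff

lemma poly2_fst: "(\<lambda>w. fst w) \<in> poly2" and poly2_snd: "(\<lambda>w. snd w) \<in> poly2"
  by (auto intro: poly_funs.coord)

text \<open>Bridge from \<open>poly2\<close>, which is given only by closure rules, to univariate
  polynomials, where roots can be counted.\<close>

lemma poly2_on_line:
  assumes "f \<in> poly2"
  shows "\<exists>p :: complex poly. \<forall>t. f (a + t * u, b + t * v) = poly p t"
  using assms
proof induction
  case (coord x)
  then show ?case
    by (auto intro: exI[of _ "[:a, u:]"] exI[of _ "[:b, v:]"])
next
  case (const k)
  then show ?case by (auto intro: exI[of _ "[:k:]"])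
next
  case (add f g)
  then obtain p r where "\<forall>t. f (a + t * u, b + t * v) = poly p t" "\<forall>t. g (a + t * u, b + t * v) = poly r t"
    by blast
  then show ?case by (auto intro: exI[of _ "p + r"])
next
  case (mult f g)
  then obtain p r where "\<forall>t. f (a + t * u, b + t * v) = poly p t" "\<forall>t. g (a + t * u, b + t * v) = poly r t"
    by blast
  then show ?case by (auto intro: exI[of _ "p * r"])
qed

text \<open>Irreducibility of the plane: on the line through \<open>w0\<close> and \<open>w1\<close>
  the two functions become univariate polynomials with product zero, and the second one is not the
  zero polynomial.\<close>

lemma poly2_mult_zero:
  assumes f: "f \<in> poly2" and g: "g \<in> poly2" and z: "\<And>w. f w = 0 \<or> g w = 0" and g1: "g w1 \<noteq> 0"
  shows "f w0 = 0"
proof -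
  obtain a b where w0: "w0 = (a, b)" by fastforce
  obtain c d where w1: "w1 = (c, d)" by fastforce
  obtain p where p: "\<And>t. f (a + t * (c - a), b + t * (d - b)) = poly p t"
    using poly2_on_line[OF f] by blast
  obtain r where r: "\<And>t. g (a + t * (c - a), b + t * (d - b)) = poly r t"
    using poly2_on_line[OF g] by blast
  have "poly r 1 \<noteq> 0" using r[of 1] g1 w1 by simp
  then have "r \<noteq> 0" by auto
  moreover have "poly (p * r) t = 0" for t using z p r by (metis mult_eq_0_iff poly_mult)
  then have "p * r = 0" using poly_all_0_iff_0 by blast
  ultimately have "p = 0" by simp
  then show ?thesis using p[of 0] w0 by simp
qed

text \<open>Plays the role of a dense open set: by irreducibility two such conditions always hold
  together somewhere.\<close>

definition generic :: "(complex \<times> complex \<Rightarrow> bool) \<Rightarrow> bool" where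
  "generic Q \<longleftrightarrow> (\<exists>g \<in> poly2. (\<exists>w. g w \<noteq> 0) \<and> (\<forall>w. g w \<noteq> 0 \<longrightarrow> Q w))"

lemma generic_conj:
  assumes "generic P" "generic Q"
  shows "generic (\<lambda>w. P w \<and> Q w)"
proof -
  obtain f u where f: "f \<in> poly2" "f u \<noteq> 0" "\<And>w. f w \<noteq> 0 \<Longrightarrow> P w" using assms(1) unfolding generic_def by blast
  obtain g v where g: "g \<in> poly2" "g v \<noteq> 0" "\<And>w. g w \<noteq> 0 \<Longrightarrow> Q w" using assms(2) unfolding generic_def by blast
  have "\<exists>w. f w * g w \<noteq> 0"
    using poly2_mult_zero[OF f(1) g(1) _ g(2), of u] f(2) by auto
  with f g show ?thesis
    unfolding generic_def by (intro bexI[of _ "\<lambda>w. f w * g w"]) (auto intro: poly_funs.mult)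
qed

lemma generic_mono: "generic P \<Longrightarrow> (\<And>w. P w \<Longrightarrow> Q w) \<Longrightarrow> generic Q"
  unfolding generic_def by blast

lemma generic_ex: "generic P \<Longrightarrow> \<exists>w. P w"
  unfolding generic_def by blast

lemma poly2_generic_zero:
  assumes "f \<in> poly2" "generic (\<lambda>w. f w = 0)"
  shows "f w = 0"
  using assms poly2_mult_zero[of f] unfolding generic_def by metis

section \<open>Functions regular at a point of the plane\<close>

definition regular_at :: "complex \<times> complex \<Rightarrow> (complex \<times> complex \<Rightarrow> complex) \<Rightarrow> bool" where
  "regular_at w0 h \<longleftrightarrow> (\<exists>n \<in> poly2. \<exists>d \<in> poly2. d w0 \<noteq> 0 \<and> (\<forall>w. d w \<noteq> 0 \<longrightarrow> h w = n w / d w))"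

lemma regular_atI:
  "n \<in> poly2 \<Longrightarrow> d \<in> poly2 \<Longrightarrow> d w0 \<noteq> 0 \<Longrightarrow> (\<And>w. d w \<noteq> 0 \<Longrightarrow> h w = n w / d w) \<Longrightarrow> regular_at w0 h"
  unfolding regular_at_def by blast

lemma regular_atE:
  assumes "regular_at w0 h"
  obtains n d where "n \<in> poly2" "d \<in> poly2" "d w0 \<noteq> 0" "\<And>w. d w \<noteq> 0 \<Longrightarrow> h w = n w / d w"
  using assms unfolding regular_at_def by blast

lemma regular_at_poly: "p \<in> poly2 \<Longrightarrow> regular_at w0 p"
  by (rule regular_atI[of p "\<lambda>_. 1"]) (auto intro: poly_funs.const)

lemma regular_at_const: "regular_at w0 (\<lambda>_. k)"
  by (intro regular_at_poly poly_funs.const)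

lemma regular_at_fst: "regular_at w0 (\<lambda>w. fst w)" and regular_at_snd: "regular_at w0 (\<lambda>w. snd w)"
  by (intro regular_at_poly poly2_fst poly2_snd)+

lemma regular_at_add:
  assumes "regular_at w0 f" "regular_at w0 g"
  shows "regular_at w0 (\<lambda>w. f w + g w)"
proof -
  obtain n d where f: "n \<in> poly2" "d \<in> poly2" "d w0 \<noteq> 0" "\<And>w. d w \<noteq> 0 \<Longrightarrow> f w = n w / d w"
    using regular_atE[OF assms(1)] by blast
  obtain m e where g: "m \<in> poly2" "e \<in> poly2" "e w0 \<noteq> 0" "\<And>w. e w \<noteq> 0 \<Longrightarrow> g w = m w / e w"
    using regular_atE[OF assms(2)] by blast
  show ?thesis
    by (rule regular_atI[of "\<lambda>w. n w * e w + m w * d w" "\<lambda>w. d w * e w"])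
      (use f g in \<open>auto intro!: poly_funs_intros simp: add_frac_eq\<close>)
qed

lemma regular_at_mult:
  assumes "regular_at w0 f" "regular_at w0 g"
  shows "regular_at w0 (\<lambda>w. f w * g w)"
proof -
  obtain n d where f: "n \<in> poly2" "d \<in> poly2" "d w0 \<noteq> 0" "\<And>w. d w \<noteq> 0 \<Longrightarrow> f w = n w / d w"
    using regular_atE[OF assms(1)] by blast
  obtain m e where g: "m \<in> poly2" "e \<in> poly2" "e w0 \<noteq> 0" "\<And>w. e w \<noteq> 0 \<Longrightarrow> g w = m w / e w"
    using regular_atE[OF assms(2)] by blast
  show ?thesis
    by (rule regular_atI[of "\<lambda>w. n w * m w" "\<lambda>w. d w * e w"])
      (use f g in \<open>auto intro!: poly_funs_intros\<close>)
qed

lemma regular_at_inverse: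
  assumes "regular_at w0 g" "g w0 \<noteq> 0"
  shows "regular_at w0 (\<lambda>w. inverse (g w))"
proof -
  obtain m e where g: "m \<in> poly2" "e \<in> poly2" "e w0 \<noteq> 0" "\<And>w. e w \<noteq> 0 \<Longrightarrow> g w = m w / e w"
    using regular_atE[OF assms(1)] by blast
  \<comment> \<open>The uncancelled factor \<open>e\<close> makes the new denominator nonzero only
    where \<open>e\<close> is, which is where \<open>g\<close> is known to equal
    \<open>m / e\<close>.\<close>
  show ?thesis
    by (rule regular_atI[of "\<lambda>w. e w * e w" "\<lambda>w. e w * m w"])
      (use g assms(2) in \<open>auto intro!: poly_funs_intros\<close>)
qed

lemma regular_at_uminus: "regular_at w0 f \<Longrightarrow> regular_at w0 (\<lambda>w. - f w)"
  using regular_at_mult[OF regular_at_const[of w0 "-1"], of f] by simp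

lemma regular_at_diff: "regular_at w0 f \<Longrightarrow> regular_at w0 g \<Longrightarrow> regular_at w0 (\<lambda>w. f w - g w)"
  using regular_at_add[OF _ regular_at_uminus, of w0 f g] by simp

lemma regular_at_divide: "regular_at w0 f \<Longrightarrow> regular_at w0 g \<Longrightarrow> g w0 \<noteq> 0 \<Longrightarrow> regular_at w0 (\<lambda>w. f w / g w)"
  using regular_at_mult[OF _ regular_at_inverse, of w0 f g] by (simp add: divide_inverse)

lemma regular_at_power: "regular_at w0 f \<Longrightarrow> regular_at w0 (\<lambda>w. f w ^ k)"
  by (induction k) (auto intro: regular_at_const regular_at_mult)

lemmas regular_at_intros =
  regular_at_const regular_at_fst regular_at_snd regular_at_add regular_at_mult regular_at_uminus regular_at_diff regular_at_divide regular_at_power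

text \<open>Regularity is local: the factor \<open>m w * k w\<close> in numerator and denominator
  shrinks the domain to points with \<open>e w \<noteq> 0\<close>, where the two functions
  agree.\<close>

lemma regular_at_cong:
  assumes f: "regular_at w0 f" and e: "regular_at w0 e" "e w0 \<noteq> 0" and eq: "\<And>w. e w \<noteq> 0 \<Longrightarrow> g w = f w"
  shows "regular_at w0 g"
proof -
  obtain n d where f: "n \<in> poly2" "d \<in> poly2" "d w0 \<noteq> 0" "\<And>w. d w \<noteq> 0 \<Longrightarrow> f w = n w / d w"
    using regular_atE[OF f] by blast
  obtain m k where k: "m \<in> poly2" "k \<in> poly2" "k w0 \<noteq> 0" "\<And>w. k w \<noteq> 0 \<Longrightarrow> e w = m w / k w"
    using regular_atE[OF e(1)] by blast
  show ?thesis
    by (rule regular_atI[of "\<lambda>w. n w * (m w * k w)" "\<lambda>w. d w * (m w * k w)"])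
      (use f k e eq in \<open>auto intro!: poly_funs_intros\<close>)
qed

lemma regular_at_compose:
  assumes h: "regular_at (h1 w0, h2 w0) h" and h1: "regular_at w0 h1" and h2: "regular_at w0 h2"
  shows "regular_at w0 (\<lambda>w. h (h1 w, h2 w))"
proof -
  have *: "regular_at w0 (\<lambda>w. p (h1 w, h2 w))" if "p \<in> poly2" for p
    using that by induction (auto intro: h1 h2 regular_at_intros)
  obtain n d where d: "n \<in> poly2" "d \<in> poly2" "d (h1 w0, h2 w0) \<noteq> 0" "\<And>w. d w \<noteq> 0 \<Longrightarrow> h w = n w / d w"
    using regular_atE[OF h] by blast
  show ?thesis
  proof (rule regular_at_cong)
    show "regular_at w0 (\<lambda>w. n (h1 w, h2 w) / d (h1 w, h2 w))" using d by (intro regular_at_divide *) auto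
    show "regular_at w0 (\<lambda>w. d (h1 w, h2 w))" using d by (intro *)
  qed (use d in auto)
qed

lemma regular_at_generic:
  assumes "regular_at w0 h" "h w0 \<noteq> 0"
  shows "generic (\<lambda>w. h w \<noteq> 0)"
proof -
  obtain n d where h: "n \<in> poly2" "d \<in> poly2" "d w0 \<noteq> 0" "\<And>w. d w \<noteq> 0 \<Longrightarrow> h w = n w / d w"
    using regular_atE[OF assms(1)] by blast
  with assms(2) have "n w0 * d w0 \<noteq> 0" "\<And>w. n w * d w \<noteq> 0 \<Longrightarrow> h w \<noteq> 0" by auto
  with h show ?thesis
    unfolding generic_def by (intro bexI[of _ "\<lambda>w. n w * d w"]) (blast intro: poly_funs.mult)+
qed

text \<open>Identity principle: a difference that is nonzero at \<open>w0\<close> would be nonzero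
  generically, and two generic conditions have a common point.\<close>

lemma generic_regular_at_eq:
  assumes f: "regular_at w0 f" and g: "regular_at w0 g" and eq: "generic (\<lambda>w. f w = g w)"
  shows "f w0 = g w0"
proof (rule ccontr)
  assume "f w0 \<noteq> g w0"
  then have "generic (\<lambda>w. f w - g w \<noteq> 0)" by (intro regular_at_generic[of w0] regular_at_diff f g) auto
  from generic_ex[OF generic_conj[OF this eq]] show False by simp
qed

text \<open>Pullback along a dominant map: one regular point whose image avoids the zeros of
  \<open>g\<close> shows that the pulled back function is not identically zero.\<close>

lemma generic_compose:
  assumes P: "generic P"
    and onto: "generic (\<lambda>w. \<exists>v. regular_at v h1 \<and> regular_at v h2 \<and> (h1 v, h2 v) = w)"
  shows "generic (\<lambda>v. P (h1 v, h2 v))"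
proof -
  obtain g u where g: "g \<in> poly2" "g u \<noteq> 0" "\<And>w. g w \<noteq> 0 \<Longrightarrow> P w" using P unfolding generic_def by blast
  have "generic (\<lambda>w. g w \<noteq> 0)" using g unfolding generic_def by blast
  from generic_ex[OF generic_conj[OF this onto]]
  obtain v where v: "g (h1 v, h2 v) \<noteq> 0" "regular_at v h1" "regular_at v h2" by auto
  have "generic (\<lambda>v. g (h1 v, h2 v) \<noteq> 0)"
    by (rule regular_at_generic[of v]) (use v g in \<open>auto intro: regular_at_compose regular_at_poly\<close>)
  then show ?thesis by (rule generic_mono) (use g in auto)
qed

section \<open>Surfaces glued from a torus and exceptional curves\<close>

datatype side = Y0 | YI | X0 | XI

text \<open>\<open>Dir k c n\<close> is the point with coordinate \<open>n\<close> on the exceptional curve over the point \<open>c\<close> of the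
  line \<open>k\<close>, and \<open>tor k s t\<close> is the torus point at which the local equation of \<open>k\<close> has the value \<open>s\<close> and
  the coordinate along \<open>k\<close> the value \<open>t\<close>. The curve is attached to the torus by the chart
  \<open>(s, n) \<mapsto> tor k s (c + s n)\<close>.\<close>

datatype pt = Tor complex complex | Dir side complex complex

fun tor :: "side \<Rightarrow> complex \<Rightarrow> complex \<Rightarrow> pt" where
  "tor Y0 s t = Tor s t"
| "tor YI s t = Tor (1 / s) t"
| "tor X0 s t = Tor t s"
| "tor XI s t = Tor t (1 / s)"

fun pchart :: "pt \<Rightarrow> complex \<times> complex \<Rightarrow> pt" where
  "pchart (Tor _ _) w = Tor (fst w) (snd w)"
| "pchart (Dir k c _) w = (if fst w = 0 then Dir k c (snd w) else tor k (fst w) (c + fst w * snd w))"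

fun pcoord :: "pt \<Rightarrow> complex \<times> complex" where
  "pcoord (Tor y x) = (y, x)"
| "pcoord (Dir _ _ n) = (0, n)"

lemma pchart_pcoord [simp]: "pchart x (pcoord x) = x"
  by (cases x) auto

lemma pchart_eq: "pchart x w = x \<Longrightarrow> w = pcoord x"
proof (cases x)
  case (Dir k c n)
  then show "pchart x w = x \<Longrightarrow> w = pcoord x" by (cases k) (auto split: if_splits simp: prod_eq_iff)
qed (auto simp: prod_eq_iff)

text \<open>Each exceptional curve appears only as an affine line. The value missing from
  \<open>n\<close> is the direction of the line \<open>k\<close> itself, the point removed together
  with the strict transform of \<open>k\<close>.\<close>

definition Surf :: "(side \<Rightarrow> complex set) \<Rightarrow> pt set" where
  "Surf C = {Tor y x | y x. y \<noteq> 0 \<and> x \<noteq> 0} \<union> {Dir k c n | k c n. c \<in> C k}"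

lemma Surf_simps [simp]:
  "Tor y x \<in> Surf C \<longleftrightarrow> y \<noteq> 0 \<and> x \<noteq> 0" "Dir k c n \<in> Surf C \<longleftrightarrow> c \<in> C k"
  by (auto simp: Surf_def)

text \<open>Each point has one preferred chart, and regularity is tested in the preferred charts at \<open>x\<close> and
  \<open>f x\<close>; then regular maps compose without changes of charts.\<close>

definition map_regular_at :: "pt set \<Rightarrow> (pt \<Rightarrow> pt) \<Rightarrow> pt \<Rightarrow> bool" where
  "map_regular_at U f x \<longleftrightarrow> (\<exists>h1 h2 e. regular_at (pcoord x) h1 \<and> regular_at (pcoord x) h2 \<and> regular_at (pcoord x) e \<and> e (pcoord x) \<noteq> 0 \<and>
     (\<forall>w. e w \<noteq> 0 \<and> pchart x w \<in> U \<longrightarrow> f (pchart x w) = pchart (f x) (h1 w, h2 w)))"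

lemma map_regular_atI:
  assumes "regular_at (pcoord x) h1" "regular_at (pcoord x) h2" "regular_at (pcoord x) e" "e (pcoord x) \<noteq> 0"
    "\<And>w. e w \<noteq> 0 \<Longrightarrow> pchart x w \<in> U \<Longrightarrow> f (pchart x w) = pchart (f x) (h1 w, h2 w)"
  shows "map_regular_at U f x"
  using assms unfolding map_regular_at_def by blast

definition morphism :: "pt set \<Rightarrow> pt set \<Rightarrow> (pt \<Rightarrow> pt) \<Rightarrow> bool" where
  "morphism U V f \<longleftrightarrow> f ` U \<subseteq> V \<and> (\<forall>x \<in> U. map_regular_at U f x)"

lemma morphism_comp:
  assumes f: "morphism U V f" and g: "morphism V W g"
  shows "morphism U W (g \<circ> f)"
proof -
  have "map_regular_at U (g \<circ> f) x" if x: "x \<in> U" for x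
  proof -
    obtain h1 h2 e where h: "regular_at (pcoord x) h1" "regular_at (pcoord x) h2" "regular_at (pcoord x) e" "e (pcoord x) \<noteq> 0"
      and hf: "\<And>w. e w \<noteq> 0 \<Longrightarrow> pchart x w \<in> U \<Longrightarrow> f (pchart x w) = pchart (f x) (h1 w, h2 w)"
      using f x unfolding morphism_def map_regular_at_def by metis
    have fx: "f x \<in> V" using f x unfolding morphism_def by blast
    obtain k1 k2 d where k: "regular_at (pcoord (f x)) k1" "regular_at (pcoord (f x)) k2" "regular_at (pcoord (f x)) d" "d (pcoord (f x)) \<noteq> 0"
      and kg: "\<And>w. d w \<noteq> 0 \<Longrightarrow> pchart (f x) w \<in> V \<Longrightarrow> g (pchart (f x) w) = pchart (g (f x)) (k1 w, k2 w)"
      using g fx unfolding morphism_def map_regular_at_def by metis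
    \<comment> \<open>The chart at \<open>f x\<close> reaches \<open>f x\<close> only at
      \<open>pcoord (f x)\<close>, so the outer functions are regular at the point where they are
      evaluated.\<close>
    have w0: "(h1 (pcoord x), h2 (pcoord x)) = pcoord (f x)"
      using hf[of "pcoord x"] h x by (intro pchart_eq) auto
    show ?thesis
    proof (rule map_regular_atI[of x "\<lambda>w. k1 (h1 w, h2 w)" "\<lambda>w. k2 (h1 w, h2 w)" "\<lambda>w. e w * d (h1 w, h2 w)"])
      fix w assume "e w * d (h1 w, h2 w) \<noteq> 0" "pchart x w \<in> U"
      moreover from this hf have "f (pchart x w) = pchart (f x) (h1 w, h2 w)" by simp
      moreover have "f (pchart x w) \<in> V" using f \<open>pchart x w \<in> U\<close> unfolding morphism_def by blast
      ultimately show "(g \<circ> f) (pchart x w) = pchart ((g \<circ> f) x) (k1 (h1 w, h2 w), k2 (h1 w, h2 w))"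
        using kg[of "(h1 w, h2 w)"] by simp
    qed (use h k w0 in \<open>auto intro!: regular_at_compose regular_at_mult\<close>)
  qed
  with f g show ?thesis unfolding morphism_def by (simp add: image_subset_iff)
qed

definition surf_iso :: "pt set \<Rightarrow> pt set \<Rightarrow> (pt \<Rightarrow> pt) \<Rightarrow> bool" where
  "surf_iso U V f \<longleftrightarrow> morphism U V f \<and> (\<exists>g. morphism V U g \<and> (\<forall>x \<in> U. g (f x) = x) \<and> (\<forall>y \<in> V. f (g y) = y))"

lemma surf_iso_comp:
  assumes "surf_iso U V f" "surf_iso V W g"
  shows "surf_iso U W (g \<circ> f)"
proof -
  obtain f' where f: "morphism U V f" "morphism V U f'" "\<forall>x \<in> U. f' (f x) = x" "\<forall>y \<in> V. f (f' y) = y"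
    using assms(1) unfolding surf_iso_def by blast
  obtain g' where g: "morphism V W g" "morphism W V g'" "\<forall>x \<in> V. g' (g x) = x" "\<forall>y \<in> W. g (g' y) = y"
    using assms(2) unfolding surf_iso_def by blast
  have "morphism U W (g \<circ> f)" "morphism W U (f' \<circ> g')" using f g morphism_comp by blast+
  moreover have "\<forall>x\<in>U. (f' \<circ> g') ((g \<circ> f) x) = x" "\<forall>y\<in>W. (g \<circ> f) ((f' \<circ> g') y) = y"
    using f g unfolding morphism_def by (auto simp: image_subset_iff)
  ultimately show ?thesis unfolding surf_iso_def by blast
qed

lemma surf_iso_involution:
  assumes "morphism U V f" "morphism V U f" "\<And>x. x \<in> U \<Longrightarrow> f (f x) = x" "\<And>x. x \<in> V \<Longrightarrow> f (f x) = x"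
  shows "surf_iso U V f"
  using assms unfolding surf_iso_def by blast

section \<open>Exchange and inversion of coordinates\<close>

fun swap_pt :: "pt \<Rightarrow> pt" where
  "swap_pt (Tor y x) = Tor x y"
| "swap_pt (Dir Y0 c n) = Dir X0 c n"
| "swap_pt (Dir YI c n) = Dir XI c n"
| "swap_pt (Dir X0 c n) = Dir Y0 c n"
| "swap_pt (Dir XI c n) = Dir YI c n"

fun swap_lines :: "(side \<Rightarrow> complex set) \<Rightarrow> side \<Rightarrow> complex set" where
  "swap_lines C Y0 = C X0" | "swap_lines C YI = C XI" | "swap_lines C X0 = C Y0" | "swap_lines C XI = C YI"

lemma swap_lines_swap_lines [simp]: "swap_lines (swap_lines C) = C"
proof
  show "swap_lines (swap_lines C) k = C k" for k by (cases k) auto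
qed

lemma morphism_swap_pt: "morphism (Surf C) (Surf (swap_lines C)) swap_pt"
proof -
  have "swap_pt x \<in> Surf (swap_lines C)" if "x \<in> Surf C" for x
    using that by (induction x rule: swap_pt.induct) auto
  moreover have "map_regular_at (Surf C) swap_pt x" for x
  proof (cases x)
    case (Tor y z)
    then show ?thesis
      by (intro map_regular_atI[of x "\<lambda>w. snd w" "\<lambda>w. fst w" "\<lambda>_. 1"]) (auto intro: regular_at_intros)
  next
    case (Dir k c n)
    then show ?thesis
      by (intro map_regular_atI[of x "\<lambda>w. fst w" "\<lambda>w. snd w" "\<lambda>_. 1"]; cases k) (auto intro: regular_at_intros)
  qed
  ultimately show ?thesis unfolding morphism_def by auto
qed

lemma surf_iso_swap_pt: "surf_iso (Surf C) (Surf (swap_lines C)) swap_pt"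
proof (rule surf_iso_involution)
  show "swap_pt (swap_pt x) = x" for x by (induction x rule: swap_pt.induct) auto
  then show "swap_pt (swap_pt x) = x" for x .
qed (use morphism_swap_pt[of C] morphism_swap_pt[of "swap_lines C"] in auto)

text \<open>Over \<open>X0\<close> and \<open>XI\<close> the direction is multiplied by the
  derivative \<open>- 1 / c\<^sup>2\<close> of inversion. Over \<open>Y0\<close> and
  \<open>YI\<close> it is unchanged, since inversion interchanges the local equations
  \<open>y\<close> and \<open>1 / y\<close>.\<close>

fun inv_fst :: "pt \<Rightarrow> pt" where
  "inv_fst (Tor y x) = Tor (1 / y) x"
| "inv_fst (Dir Y0 c n) = Dir YI c n"
| "inv_fst (Dir YI c n) = Dir Y0 c n"
| "inv_fst (Dir X0 c n) = Dir X0 (1 / c) (- n / c\<^sup>2)"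
| "inv_fst (Dir XI c n) = Dir XI (1 / c) (- n / c\<^sup>2)"

fun inv_fst_lines :: "(side \<Rightarrow> complex set) \<Rightarrow> side \<Rightarrow> complex set" where
  "inv_fst_lines C Y0 = C YI" | "inv_fst_lines C YI = C Y0"
| "inv_fst_lines C X0 = (\<lambda>c. 1 / c) ` C X0" | "inv_fst_lines C XI = (\<lambda>c. 1 / c) ` C XI"

lemma inv_fst_lines_inv_fst_lines [simp]: "inv_fst_lines (inv_fst_lines C) = C"
proof
  show "inv_fst_lines (inv_fst_lines C) k = C k" for k by (cases k) (auto simp: image_image)
qed

text \<open>The difference from the limit \<open>1 / c\<close> is divisible by \<open>s\<close>; the
  quotient is the direction coordinate of the image, also at \<open>s = 0\<close>.\<close>

lemma inverse_first_order:
  fixes c :: complex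
  assumes "c \<noteq> 0" "c + s * n \<noteq> 0"
  shows "1 / (c + s * n) = 1 / c + s * (- n / (c * (c + s * n)))"
  using assms by (simp add: divide_simps)

lemma morphism_inv_fst:
  assumes "\<And>k. 0 \<notin> C k"
  shows "morphism (Surf C) (Surf (inv_fst_lines C)) inv_fst"
proof -
  have "inv_fst x \<in> Surf (inv_fst_lines C)" if "x \<in> Surf C" for x
    using that by (induction x rule: inv_fst.induct) auto
  moreover have "map_regular_at (Surf C) inv_fst x" if "x \<in> Surf C" for x
  proof (cases x)
    case (Tor y z)
    with that show ?thesis
      by (intro map_regular_atI[of x "\<lambda>w. 1 / fst w" "\<lambda>w. snd w" "\<lambda>_. 1"]) (auto intro!: regular_at_intros)
  next
    case (Dir k c n)
    with that assms[of k] have c: "c \<noteq> 0" by auto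
    show ?thesis
    proof (cases "k = Y0 \<or> k = YI")
      case True
      with Dir show ?thesis
        by (intro map_regular_atI[of x "\<lambda>w. fst w" "\<lambda>w. snd w" "\<lambda>_. 1"]) (auto intro: regular_at_intros)
    next
      case False
      with Dir c show ?thesis
        by (intro map_regular_atI[of x "\<lambda>w. fst w" "\<lambda>w. - snd w / (c * (c + fst w * snd w))" "\<lambda>w. c + fst w * snd w"]; cases k)
          (auto intro!: regular_at_intros simp: inverse_first_order power2_eq_square)
    qed
  qed
  ultimately show ?thesis unfolding morphism_def by auto
qed

lemma surf_iso_inv_fst:
  assumes "\<And>k. 0 \<notin> C k"
  shows "surf_iso (Surf C) (Surf (inv_fst_lines C)) inv_fst"
proof (rule surf_iso_involution)
  have a: "0 \<notin> inv_fst_lines C k" for k using assms by (cases k) auto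
  have *: "inv_fst (inv_fst x) = x" if "x \<in> Surf D" "\<And>k. 0 \<notin> D k" for x D
    using that by (induction x rule: inv_fst.induct) (auto simp: field_simps power2_eq_square)
  show "inv_fst (inv_fst x) = x" if "x \<in> Surf C" for x using that * assms by blast
  show "inv_fst (inv_fst x) = x" if "x \<in> Surf (inv_fst_lines C)" for x using that * a by blast
  show "morphism (Surf C) (Surf (inv_fst_lines C)) inv_fst" using morphism_inv_fst assms by blast
  show "morphism (Surf (inv_fst_lines C)) (Surf C) inv_fst" using morphism_inv_fst[of "inv_fst_lines C"] a by auto
qed

section \<open>Elementary maps\<close>

text \<open>The extension of \<open>(y, x) \<mapsto> (l (x - p)/(y (x - r)), x)\<close>; the values at \<open>x = p\<close>, \<open>x = r\<close> and on the
  exceptional curves are the limits of this formula in the preferred charts.\<close>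

fun elem :: "complex \<Rightarrow> complex \<Rightarrow> complex \<Rightarrow> pt \<Rightarrow> pt" where
  "elem p r l (Tor y x) =
     (if x = p then Dir Y0 p (y * (p - r) / l)
      else if x = r then Dir YI r (l * (r - p) / y)
      else Tor (l * (x - p) / (y * (x - r))) x)"
| "elem p r l (Dir Y0 c n) =
     (if c \<noteq> p then Dir YI c (n * l * (c - p) / (c - r))
      else if n = 0 then Dir Y0 p 0 else Tor (l * n / (p - r)) p)"
| "elem p r l (Dir YI c n) =
     (if c \<noteq> r then Dir Y0 c (n * (c - r) / (l * (c - p)))
      else if n = 0 then Dir YI r 0 else Tor (l * (r - p) / n) r)"
| "elem p r l (Dir X0 c n) = Dir X0 (l * p / (r * c)) (- (l * (c * (r - p) + p * n * r) / (c * r)\<^sup>2))"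
| "elem p r l (Dir XI c n) = Dir XI (l / c) (l * (c * (r - p) - n) / c\<^sup>2)"

text \<open>On a general fibre the map inverts \<open>y\<close> up to a factor, so centres on
  \<open>y = 0\<close> and \<open>y = \<infinity>\<close> change sides. The fibres at
  \<open>p\<close> and \<open>r\<close> become the curves over \<open>p\<close> on \<open>Y0\<close>
  and over \<open>r\<close> on \<open>YI\<close>, so these two centres stay. On \<open>X0\<close>
  and \<open>XI\<close> the limits of the formula at \<open>x = 0\<close> and
  \<open>x = \<infinity>\<close> occur.\<close>

fun elem_lines :: "complex \<Rightarrow> complex \<Rightarrow> complex \<Rightarrow> (side \<Rightarrow> complex set) \<Rightarrow> side \<Rightarrow> complex set" where
  "elem_lines p r l C Y0 = insert p (C YI - {r})"
| "elem_lines p r l C YI = insert r (C Y0 - {p})"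
| "elem_lines p r l C X0 = (\<lambda>c. l * p / (r * c)) ` C X0"
| "elem_lines p r l C XI = (\<lambda>c. l / c) ` C XI"

text \<open>Each of the fibres \<open>x = p\<close> and \<open>x = r\<close> passes through exactly
  one centre, so its strict transform is a (-1)-curve and can trade places with the exceptional
  curve over that centre.\<close>

definition elem_ok :: "complex \<Rightarrow> complex \<Rightarrow> complex \<Rightarrow> (side \<Rightarrow> complex set) \<Rightarrow> bool" where
  "elem_ok p r l C \<longleftrightarrow> p \<in> C Y0 \<and> r \<in> C YI \<and> r \<notin> C Y0 \<and> p \<notin> C YI \<and> l \<noteq> 0 \<and> (\<forall>k. 0 \<notin> C k)"

lemma elem_okD:
  assumes "elem_ok p r l C"
  shows "p \<noteq> 0" "r \<noteq> 0" "l \<noteq> 0" "p \<noteq> r" "0 \<notin> C k" "p \<in> C Y0" "r \<in> C YI" "r \<notin> C Y0" "p \<notin> C YI"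
  using assms unfolding elem_ok_def by metis+

lemma elem_ok_elem_lines:
  assumes "elem_ok p r l C"
  shows "elem_ok p r l (elem_lines p r l C)"
proof -
  note D = elem_okD[OF assms]
  have "0 \<notin> elem_lines p r l C k" for k
  proof (cases k)
    case X0 then show ?thesis using D(1-3) D(5)[of X0] by auto
  next
    case XI then show ?thesis using D(1-3) D(5)[of XI] by auto
  qed (use D(1-3) D(5)[of Y0] D(5)[of YI] in auto)
  then show ?thesis using D unfolding elem_ok_def by auto
qed

lemma elem_lines_elem_lines:
  assumes "elem_ok p r l C"
  shows "elem_lines p r l (elem_lines p r l C) = C"
proof
  note D = elem_okD[OF assms]
  have "(\<lambda>x. l * p / (r * (l * p / (r * x)))) ` C X0 = (\<lambda>x. x) ` C X0"
    by (rule image_cong) (use D(1-3) in auto)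
  moreover have "(\<lambda>x. l / (l / x)) ` C XI = (\<lambda>x. x) ` C XI"
    by (rule image_cong) (use D(1-3) in auto)
  ultimately show "elem_lines p r l (elem_lines p r l C) k = C k" for k
    using D by (cases k) (auto simp: image_image)
qed

lemma elem_Surf:
  assumes "elem_ok p r l C" "x \<in> Surf C"
  shows "elem p r l x \<in> Surf (elem_lines p r l C)"
proof -
  note D = elem_okD[OF assms(1)]
  show ?thesis using assms(2) D(1-4,6-9) D(5)[of Y0] D(5)[of YI]
    by (induction x rule: elem.induct) auto
qed

lemma elem_elem:
  assumes "elem_ok p r l C" "x \<in> Surf C"
  shows "elem p r l (elem p r l x) = x"
proof -
  note D = elem_okD[OF assms(1)]
  have 4: "- (l * ((l * p / (r * c)) * (r - p) + p * (- (l * (c * (r - p) + p * n * r) / (c * r)\<^sup>2)) * r)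
      / ((l * p / (r * c)) * r)\<^sup>2) = n" if "c \<noteq> 0" for c n
  proof -
    have "(l * p / (r * c)) * (r - p) + p * (- (l * (c * (r - p) + p * n * r) / (c * r)\<^sup>2)) * r
        = - (l * p * p * n) / c\<^sup>2"
      using that D(2) by (simp add: divide_simps power2_eq_square) (simp add: algebra_simps)
    then show ?thesis using that D(1-3) by (simp add: power2_eq_square)
  qed
  have 5: "l * ((l / c) * (r - p) - l * (c * (r - p) - n) / c\<^sup>2) / (l / c)\<^sup>2 = n" if "c \<noteq> 0" for c n
  proof -
    have "(l / c) * (r - p) - l * (c * (r - p) - n) / c\<^sup>2 = l * n / c\<^sup>2"
      using that by (simp add: divide_simps power2_eq_square) (simp add: algebra_simps)
    then show ?thesis using that D(3) by (simp add: power2_eq_square)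
  qed
  show ?thesis
  proof (cases x)
    case (Tor y z)
    then show ?thesis using assms(2) D(3,4) by auto
  next
    case (Dir k c n)
    then have c: "c \<in> C k" "c \<noteq> 0" using assms(2) D(5)[of k] by auto
    show ?thesis
    proof (cases k)
      case Y0
      then show ?thesis using Dir c D by auto
    next
      case YI
      then show ?thesis using Dir c D by auto
    next
      case X0
      then show ?thesis using Dir c D(1-3) 4[OF c(2), of n] by simp
    next
      case XI
      then show ?thesis using Dir c D(3) 5[OF c(2), of n] by simp
    qed
  qed
qed

text \<open>The map is written in the preferred chart at the image point. Over \<open>(0, p)\<close>
  the substitution \<open>x - p = s n\<close>, \<open>y = s\<close> cancels the indeterminacy of
  \<open>(x - p) / y\<close>; similarly over \<open>(\<infinity>, r)\<close>.\<close>

lemma map_regular_at_elem: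
  assumes ok: "elem_ok p r l C" and x: "x \<in> Surf C"
  shows "map_regular_at (Surf C) (elem p r l) x"
proof -
  note D = elem_okD[OF ok]
  show ?thesis
  proof (cases x)
    case (Tor y z)
    with x have yz: "y \<noteq> 0" "z \<noteq> 0" by auto
    consider "z = p" | "z = r" | "z \<noteq> p" "z \<noteq> r" by blast
    then show ?thesis
    proof cases
      case 1
      \<comment> \<open>The image lies on the curve over \<open>(0, p)\<close>. Its chart
        coordinates are the new first coordinate and \<open>x - p\<close> divided by it, and this
        quotient simplifies to \<open>y (x - r) / l\<close>.\<close>
      show ?thesis
        by (rule map_regular_atI[of x "\<lambda>w. l * (snd w - p) / (fst w * (snd w - r))" "\<lambda>w. fst w * (snd w - r) / l"
              "\<lambda>w. snd w - r"])
          (use Tor 1 yz D(1-4) in \<open>auto intro!: regular_at_intros\<close>)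
    next
      case 2
      show ?thesis
        by (rule map_regular_atI[of x "\<lambda>w. fst w * (snd w - r) / (l * (snd w - p))" "\<lambda>w. l * (snd w - p) / fst w"
              "\<lambda>w. snd w - p"])
          (use Tor 2 yz D(1-4) in \<open>auto intro!: regular_at_intros\<close>)
    next
      case 3
      show ?thesis
        by (rule map_regular_atI[of x "\<lambda>w. l * (snd w - p) / (fst w * (snd w - r))" "\<lambda>w. snd w"
              "\<lambda>w. (snd w - p) * (snd w - r)"])
          (use Tor 3 yz D(1-4) in \<open>auto intro!: regular_at_intros\<close>)
    qed
  next
    case (Dir k c n)
    with x have c: "c \<in> C k" "c \<noteq> 0" using D(5)[of k] by auto
    show ?thesis
    proof (cases k)
      case Y0
      with c D have cr: "c \<noteq> r" by auto
      consider "c \<noteq> p" | "c = p" "n = 0" | "c = p" "n \<noteq> 0" by blast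
      then show ?thesis
      proof cases
        case 1
        show ?thesis
          by (rule map_regular_atI[of x "\<lambda>w. fst w * (c + fst w * snd w - r) / (l * (c + fst w * snd w - p))"
                "\<lambda>w. snd w * l * (c + fst w * snd w - p) / (c + fst w * snd w - r)"
                "\<lambda>w. (c + fst w * snd w - p) * (c + fst w * snd w - r)"])
            (use Dir Y0 1 cr D(1-4) in \<open>auto intro!: regular_at_intros\<close>)
      next
        case 2
        \<comment> \<open>This is the intersection of the exceptional curve with the strict
          transform of the fibre. The two curves are exchanged, so the point is fixed and the image
          is again read in the chart over \<open>(0, p)\<close>.\<close>
        show ?thesis
          by (rule map_regular_atI[of x "\<lambda>w. l * snd w / (c + fst w * snd w - r)" "\<lambda>w. fst w * (c + fst w * snd w - r) / l"
                "\<lambda>w. (c + fst w * snd w - r)"])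
            (use Dir Y0 2 cr D(1-4) in \<open>auto intro!: regular_at_intros\<close>)
      next
        case 3
        show ?thesis
          by (rule map_regular_atI[of x "\<lambda>w. l * snd w / (c + fst w * snd w - r)" "\<lambda>w. c + fst w * snd w"
                "\<lambda>w. snd w * (c + fst w * snd w - r)"])
            (use Dir Y0 3 cr D(1-4) in \<open>auto intro!: regular_at_intros\<close>)
      qed
    next
      case YI
      with c D have cp: "c \<noteq> p" by auto
      consider "c \<noteq> r" | "c = r" "n = 0" | "c = r" "n \<noteq> 0" by blast
      then show ?thesis
      proof cases
        case 1
        show ?thesis
          by (rule map_regular_atI[of x "\<lambda>w. fst w * l * (c + fst w * snd w - p) / (c + fst w * snd w - r)"
                "\<lambda>w. snd w * (c + fst w * snd w - r) / (l * (c + fst w * snd w - p))"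
                "\<lambda>w. (c + fst w * snd w - p) * (c + fst w * snd w - r)"])
            (use Dir YI 1 cp D(1-4) in \<open>auto intro!: regular_at_intros\<close>)
      next
        case 2
        show ?thesis
          by (rule map_regular_atI[of x "\<lambda>w. snd w / (l * (c + fst w * snd w - p))" "\<lambda>w. l * (c + fst w * snd w - p) * fst w"
                "\<lambda>w. (c + fst w * snd w - p)"])
            (use Dir YI 2 cp D(1-4) in \<open>auto intro!: regular_at_intros\<close>)
      next
        case 3
        show ?thesis
          by (rule map_regular_atI[of x "\<lambda>w. l * (c + fst w * snd w - p) / snd w" "\<lambda>w. c + fst w * snd w"
                "\<lambda>w. snd w * (c + fst w * snd w - p)"])
            (use Dir YI 3 cp D(1-4) in \<open>auto intro!: regular_at_intros\<close>)
      qed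
    next
      case X0
      \<comment> \<open>The deviation from the limit \<open>l * p / (r * c)\<close> is divided by
        \<open>s\<close> to obtain the direction coordinate. The factors \<open>fst w - r\<close>
        and \<open>fst w - p\<close> used below keep nearby points off the exceptional branches of
        \<open>elem\<close>.\<close>
      have eq: "l * (s - p) / ((c + s * m) * (s - r)) =
          l * p / (r * c) + s * (l * (c * (r - p) + p * m * (r - s)) / (c * r * (c + s * m) * (s - r)))"
        if "c + s * m \<noteq> 0" "s - r \<noteq> 0" for s m
        using that c D(1-3) by (simp add: divide_simps) (simp add: algebra_simps)
      show ?thesis
        by (rule map_regular_atI[of x "\<lambda>w. fst w"
              "\<lambda>w. l * (c * (r - p) + p * snd w * (r - fst w)) / (c * r * (c + fst w * snd w) * (fst w - r))"
              "\<lambda>w. (c + fst w * snd w) * (fst w - r) * (fst w - p)"])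
          (use Dir X0 c D(1-4) eq in \<open>auto intro!: regular_at_intros simp: power2_eq_square divide_simps\<close>)
    next
      case XI
      have eq: "l * (1 / s - p) / ((c + s * m) * (1 / s - r)) =
          l / c + s * (l * (c * (r - p) - m + r * s * m) / (c * (c + s * m) * (1 - r * s)))"
        if "c + s * m \<noteq> 0" "1 - r * s \<noteq> 0" "s \<noteq> 0" for s m
        using that c D(1-3) by (simp add: divide_simps) (simp add: algebra_simps)
      show ?thesis
        by (rule map_regular_atI[of x "\<lambda>w. fst w"
              "\<lambda>w. l * (c * (r - p) - snd w + r * fst w * snd w) / (c * (c + fst w * snd w) * (1 - r * fst w))"
              "\<lambda>w. (c + fst w * snd w) * (1 - r * fst w) * (1 - p * fst w)"])
          (use Dir XI c D(1-4) eq in \<open>auto intro!: regular_at_intros simp: power2_eq_square divide_simps\<close>)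
    qed
  qed
qed

lemma surf_iso_elem:
  assumes "elem_ok p r l C"
  shows "surf_iso (Surf C) (Surf (elem_lines p r l C)) (elem p r l)"
proof -
  note ok' = elem_ok_elem_lines[OF assms]
  have "morphism (Surf C) (Surf (elem_lines p r l C)) (elem p r l)"
    using elem_Surf[OF assms] map_regular_at_elem[OF assms] unfolding morphism_def by blast
  moreover have "morphism (Surf (elem_lines p r l C)) (Surf C) (elem p r l)"
    using elem_Surf[OF ok'] map_regular_at_elem[OF ok'] elem_lines_elem_lines[OF assms] unfolding morphism_def by auto
  ultimately show ?thesis
    using elem_elem[OF assms] elem_elem[OF ok'] by (rule surf_iso_involution)
qed

section \<open>The blown-up surfaces\<close>

lemma loc_0 [simp]: "loc a 0 = a"
  by (cases a) auto

lemma loc_eq_iff [simp]: "loc a s = loc a t \<longleftrightarrow> s = t"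
  by (cases a) auto

lemma loc_eq_self_iff [simp]: "loc a s = a \<longleftrightarrow> s = 0"
  by (cases a) auto

lemma loc_Infty_neq_0 [simp]: "loc Infty n \<noteq> Aff 0"
  by auto

lemma range_loc_Infty: "d \<noteq> Aff 0 \<Longrightarrow> \<exists>n. d = loc Infty n"
proof (cases d)
  case (Aff y)
  moreover assume "d \<noteq> Aff 0"
  ultimately show ?thesis by (intro exI[of _ "1 / y"]) auto
qed (auto intro: exI[of _ 0])

text \<open>A point of the projective line is cut out in every chart by one affine-linear equation,
  the equation \<open>1 = 0\<close> if the chart misses it. This supplies the equations of the four
  lines.\<close>

lemma loc_eq_linear: "\<exists>u v. \<forall>s. loc a' s = a \<longleftrightarrow> u + v * s = 0"
proof (cases a'; cases a)
  fix x y assume "a' = Aff x" "a = Aff y"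
  then have "\<forall>s. loc a' s = a \<longleftrightarrow> (x - y) + 1 * s = 0" by (auto simp: algebra_simps)
  then show ?thesis by blast
next
  fix x assume "a' = Aff x" "a = Infty"
  then have "\<forall>s. loc a' s = a \<longleftrightarrow> 1 + 0 * s = 0" by auto
  then show ?thesis by blast
next
  fix y assume "a' = Infty" "a = Aff y"
  then have "\<forall>s. loc a' s = a \<longleftrightarrow> 1 + (- y) * s = 0" by (auto simp: field_simps)
  then show ?thesis by blast
next
  assume "a' = Infty" "a = Infty"
  then have "\<forall>s. loc a' s = a \<longleftrightarrow> 0 + 1 * s = 0" by auto
  then show ?thesis by blast
qed

lemma zclosedI:
  assumes "Z \<subseteq> blowup S"
    and "\<And>a b. \<exists>f \<in> poly2. \<forall>w. chart0 (a, b) w \<in> blowup S \<longrightarrow> (chart0 (a, b) w \<in> Z \<longleftrightarrow> f w = 0)"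
    and "\<And>a b. (a, b) \<in> S \<Longrightarrow> \<exists>f \<in> poly2. \<forall>w. chart1 (a, b) w \<in> blowup S \<longrightarrow> (chart1 (a, b) w \<in> Z \<longleftrightarrow> f w = 0)"
    and "\<And>a b. (a, b) \<in> S \<Longrightarrow> \<exists>f \<in> poly2. \<forall>w. chart2 (a, b) w \<in> blowup S \<longrightarrow> (chart2 (a, b) w \<in> Z \<longleftrightarrow> f w = 0)"
  shows "zclosed S Z"
  unfolding zclosed_def
proof (intro conjI ballI)
  fix ch assume "ch \<in> charts S"
  then have "\<exists>f \<in> poly2. \<forall>w. ch w \<in> blowup S \<longrightarrow> (ch w \<in> Z \<longleftrightarrow> f w = 0)"
    unfolding charts_def using assms(2-4) by auto
  then obtain f where "f \<in> poly2" "\<forall>w. ch w \<in> blowup S \<longrightarrow> (ch w \<in> Z \<longleftrightarrow> f w = 0)" by blast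
  then show "\<exists>F\<subseteq>poly2. \<forall>w. ch w \<in> blowup S \<longrightarrow> (ch w \<in> Z) = (\<forall>f\<in>F. f w = 0)"
    by (intro exI[of _ "{f}"]) auto
qed fact

lemma Off_in_blowup [simp]: "Off p \<in> blowup S \<longleftrightarrow> p \<notin> S"
  and Exc_in_blowup [simp]: "Exc p d \<in> blowup S \<longleftrightarrow> p \<in> S"
  unfolding blowup_def by blast+

lemma zclosureI:
  assumes "\<And>Z. zclosed S Z \<Longrightarrow> A \<subseteq> Z \<Longrightarrow> x \<in> Z"
  shows "x \<in> zclosure S A"
  using assms unfolding zclosure_def by blast

text \<open>One chart around the point decides membership, since every closed set is cut out by
  polynomials in that chart as well.\<close>

lemma zclosure_mem_chart:
  assumes ch: "ch \<in> charts S" and w0: "ch w0 \<in> blowup S"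
    and fin: "\<And>f. f \<in> poly2 \<Longrightarrow> (\<And>w. ch w \<in> A \<Longrightarrow> f w = 0) \<Longrightarrow> f w0 = 0"
  shows "ch w0 \<in> zclosure S A"
proof (rule zclosureI)
  fix Z assume Z: "zclosed S Z" "A \<subseteq> Z"
  then obtain F where F: "F \<subseteq> poly2" "\<And>w. ch w \<in> blowup S \<Longrightarrow> (ch w \<in> Z \<longleftrightarrow> (\<forall>f \<in> F. f w = 0))"
    using ch unfolding zclosed_def by meson
  have "f w0 = 0" if "f \<in> F" for f
  proof (rule fin)
    show "f w = 0" if "ch w \<in> A" for w
      using that F(2)[of w] Z \<open>f \<in> F\<close> unfolding zclosed_def by blast
  qed (use F that in blast)
  with F(2) w0 show "ch w0 \<in> Z" by blast
qed

lemma poly2_zero_on_line: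
  assumes f: "f \<in> poly2" and fin: "finite T" and z: "\<And>t. t \<notin> T \<Longrightarrow> f (t * u, t * v) = 0"
  shows "f (0, 0) = 0"
proof -
  obtain p where p: "\<And>t. f (t * u, t * v) = poly p t"
    using poly2_on_line[OF f, of 0 u 0 v] by auto
  have "infinite (- T)" using fin by (simp add: finite_compl infinite_UNIV_char_0)
  moreover have "- T \<subseteq> {t. poly p t = 0}" using z p by auto
  ultimately have "p = 0" using poly_roots_finite infinite_super by blast
  then show ?thesis using p[of 0] by simp
qed

text \<open>The line meets an exceptional curve only in its own direction, which has ratio
  \<open>0\<close>. The right-hand side is closed, and its exceptional points are limits along the
  line, where only finitely many points are deleted.\<close>

lemma strict_transform_vertical:
  assumes S: "finite S"
  shows "strict_transform S ({a} \<times> UNIV) =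
    Off ` ({a} \<times> UNIV - S) \<union> {Exc p (Aff 0) | p. p \<in> S \<and> fst p = a}" (is "_ = ?R")
proof
  have "zclosed S ?R"
  proof (rule zclosedI)
    show "?R \<subseteq> blowup S" by (auto simp: blowup_def)
  next
    fix a' b'
    obtain u v where uv: "\<And>s. loc a' s = a \<longleftrightarrow> u + v * s = 0" using loc_eq_linear by blast
    show "\<exists>f \<in> poly2. \<forall>w. chart0 (a', b') w \<in> blowup S \<longrightarrow> (chart0 (a', b') w \<in> ?R \<longleftrightarrow> f w = 0)"
      by (rule bexI[of _ "\<lambda>w. u + v * fst w"])
        (auto simp: uv[symmetric] intro!: poly_funs_intros poly2_fst)
  next
    fix a' b' assume ab: "(a', b') \<in> S"
    obtain u v where uv: "\<And>s. loc a' s = a \<longleftrightarrow> u + v * s = 0" using loc_eq_linear by blast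
    show "\<exists>f \<in> poly2. \<forall>w. chart1 (a', b') w \<in> blowup S \<longrightarrow> (chart1 (a', b') w \<in> ?R \<longleftrightarrow> f w = 0)"
    proof (cases "a' = a")
      case True
      \<comment> \<open>The first local coordinate is \<open>m t\<close>; dividing out the
        exceptional equation \<open>t\<close> leaves \<open>m = 0\<close>.\<close>
      then show ?thesis using ab by (intro bexI[of _ "\<lambda>w. fst w"]) (auto intro: poly2_fst)
    next
      case False
      with uv[of 0] have "u \<noteq> 0" by auto
      with False show ?thesis
        by (intro bexI[of _ "\<lambda>w. u + v * (fst w * snd w)"])
          (auto simp: uv[symmetric] intro!: poly_funs_intros poly2_fst poly2_snd)
    qed
    show "\<exists>f \<in> poly2. \<forall>w. chart2 (a', b') w \<in> blowup S \<longrightarrow> (chart2 (a', b') w \<in> ?R \<longleftrightarrow> f w = 0)"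
    proof (cases "a' = a")
      case True
      \<comment> \<open>This chart omits the direction of a vertical line, so the strict transform
        is empty here.\<close>
      then show ?thesis by (intro bexI[of _ "\<lambda>w. 1"]) (auto intro: poly_funs.const)
    next
      case False
      with uv[of 0] have "u \<noteq> 0" by auto
      with False show ?thesis
        by (intro bexI[of _ "\<lambda>w. u + v * fst w"])
          (auto simp: uv[symmetric] intro!: poly_funs_intros poly2_fst)
    qed
  qed
  then show "strict_transform S ({a} \<times> UNIV) \<subseteq> ?R"
    unfolding strict_transform_def zclosure_def by blast
  have "Exc (a, b) (Aff 0) \<in> strict_transform S ({a} \<times> UNIV)" if ab: "(a, b) \<in> S" for b
  proof -
    have "chart1 (a, b) (0, 0) \<in> strict_transform S ({a} \<times> UNIV)"
      unfolding strict_transform_def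
    proof (rule zclosure_mem_chart)
      show "chart1 (a, b) \<in> charts S" using ab by (auto simp: charts_def)
      fix f assume f: "f \<in> poly2" "\<And>w. chart1 (a, b) w \<in> Off ` ({a} \<times> UNIV - S) \<Longrightarrow> f w = 0"
      have "inj (\<lambda>t. (a, loc b t))" by (auto intro: injI)
      then have "finite ((\<lambda>t. (a, loc b t)) -` S)" using S by (rule finite_vimageI[rotated])
      then show "f (0, 0) = 0"
        by (intro poly2_zero_on_line[of f "insert 0 ((\<lambda>t. (a, loc b t)) -` S)" 0 1]) (auto intro!: f)
    qed (use ab in auto)
    then show ?thesis by simp
  qed
  moreover have "Off ` ({a} \<times> UNIV - S) \<subseteq> strict_transform S ({a} \<times> UNIV)"
    unfolding strict_transform_def zclosure_def by blast
  ultimately show "?R \<subseteq> strict_transform S ({a} \<times> UNIV)" by auto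
qed

lemma strict_transform_horizontal:
  assumes S: "finite S"
  shows "strict_transform S (UNIV \<times> {b}) =
    Off ` (UNIV \<times> {b} - S) \<union> {Exc p Infty | p. p \<in> S \<and> snd p = b}" (is "_ = ?R")
proof
  have "zclosed S ?R"
  proof (rule zclosedI)
    show "?R \<subseteq> blowup S" by (auto simp: blowup_def)
  next
    fix a' b'
    obtain u v where uv: "\<And>s. loc b' s = b \<longleftrightarrow> u + v * s = 0" using loc_eq_linear by blast
    show "\<exists>f \<in> poly2. \<forall>w. chart0 (a', b') w \<in> blowup S \<longrightarrow> (chart0 (a', b') w \<in> ?R \<longleftrightarrow> f w = 0)"
      by (rule bexI[of _ "\<lambda>w. u + v * snd w"])
        (auto simp: uv[symmetric] intro!: poly_funs_intros poly2_snd)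
  next
    fix a' b' assume ab: "(a', b') \<in> S"
    obtain u v where uv: "\<And>s. loc b' s = b \<longleftrightarrow> u + v * s = 0" using loc_eq_linear by blast
    show "\<exists>f \<in> poly2. \<forall>w. chart2 (a', b') w \<in> blowup S \<longrightarrow> (chart2 (a', b') w \<in> ?R \<longleftrightarrow> f w = 0)"
    proof (cases "b' = b")
      case True
      then show ?thesis using ab by (intro bexI[of _ "\<lambda>w. snd w"]) (auto intro: poly2_snd)
    next
      case False
      with uv[of 0] have "u \<noteq> 0" by auto
      with False show ?thesis
        by (intro bexI[of _ "\<lambda>w. u + v * (fst w * snd w)"])
          (auto simp: uv[symmetric] intro!: poly_funs_intros poly2_fst poly2_snd)
    qed
    show "\<exists>f \<in> poly2. \<forall>w. chart1 (a', b') w \<in> blowup S \<longrightarrow> (chart1 (a', b') w \<in> ?R \<longleftrightarrow> f w = 0)"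
    proof (cases "b' = b")
      case True
      then show ?thesis by (intro bexI[of _ "\<lambda>w. 1"]) (auto intro: poly_funs.const)
    next
      case False
      with uv[of 0] have "u \<noteq> 0" by auto
      with False show ?thesis
        by (intro bexI[of _ "\<lambda>w. u + v * snd w"])
          (auto simp: uv[symmetric] intro!: poly_funs_intros poly2_snd)
    qed
  qed
  then show "strict_transform S (UNIV \<times> {b}) \<subseteq> ?R"
    unfolding strict_transform_def zclosure_def by blast
  have "Exc (a, b) Infty \<in> strict_transform S (UNIV \<times> {b})" if ab: "(a, b) \<in> S" for a
  proof -
    have "chart2 (a, b) (0, 0) \<in> strict_transform S (UNIV \<times> {b})"
      unfolding strict_transform_def
    proof (rule zclosure_mem_chart)
      show "chart2 (a, b) \<in> charts S" using ab by (auto simp: charts_def)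
      fix f assume f: "f \<in> poly2" "\<And>w. chart2 (a, b) w \<in> Off ` (UNIV \<times> {b} - S) \<Longrightarrow> f w = 0"
      have "inj (\<lambda>t. (loc a t, b))" by (auto intro: injI)
      then have "finite ((\<lambda>t. (loc a t, b)) -` S)" using S by (rule finite_vimageI[rotated])
      then show "f (0, 0) = 0"
        by (intro poly2_zero_on_line[of f "insert 0 ((\<lambda>t. (loc a t, b)) -` S)" 1 0]) (auto intro!: f)
    qed (use ab in auto)
    then show ?thesis by simp
  qed
  moreover have "Off ` (UNIV \<times> {b} - S) \<subseteq> strict_transform S (UNIV \<times> {b})"
    unfolding strict_transform_def zclosure_def by blast
  ultimately show "?R \<subseteq> strict_transform S (UNIV \<times> {b})" by auto
qed

section \<open>Comparison of the glued surface with the blow-up\<close>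

fun ctr :: "side \<Rightarrow> complex \<Rightarrow> P1 \<times> P1" where
  "ctr Y0 c = (Aff 0, Aff c)"
| "ctr YI c = (Infty, Aff c)"
| "ctr X0 c = (Aff c, Aff 0)"
| "ctr XI c = (Aff c, Infty)"

text \<open>\<open>Exc\<close> records the ratio of the first local coordinate to the second. Along
  \<open>Y0\<close> and \<open>YI\<close> this is \<open>s / (s n)\<close>, hence
  \<open>loc Infty n\<close>; along \<open>X0\<close> and \<open>XI\<close> it is
  \<open>(s n) / s\<close>, hence \<open>Aff n\<close>.\<close>

fun to_bl :: "pt \<Rightarrow> bl_point" where
  "to_bl (Tor y x) = Off (Aff y, Aff x)"
| "to_bl (Dir Y0 c n) = Exc (ctr Y0 c) (loc Infty n)"
| "to_bl (Dir YI c n) = Exc (ctr YI c) (loc Infty n)"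
| "to_bl (Dir X0 c n) = Exc (ctr X0 c) (Aff n)"
| "to_bl (Dir XI c n) = Exc (ctr XI c) (Aff n)"

definition ctrs :: "(side \<Rightarrow> complex set) \<Rightarrow> (P1 \<times> P1) set" where
  "ctrs C = (\<Union>k. ctr k ` C k)"

lemma UNIV_side: "UNIV = {Y0, YI, X0, XI}"
  by (auto intro: side.exhaust)

lemma ctrs_eq: "ctrs C = ctr Y0 ` C Y0 \<union> ctr YI ` C YI \<union> ctr X0 ` C X0 \<union> ctr XI ` C XI"
  by (simp add: ctrs_def UNIV_side Un_assoc)

text \<open>Centres with nonzero coordinate avoid the corners, the only points that lie on two of
  the four lines.\<close>

lemma inj_to_bl:
  assumes "\<And>k. 0 \<notin> C k"
  shows "inj_on to_bl (Surf C)"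
proof (rule inj_onI)
  fix x y assume xy: "x \<in> Surf C" "y \<in> Surf C" "to_bl x = to_bl y"
  have nz: "\<And>c k. c \<in> C k \<Longrightarrow> c \<noteq> 0" using assms by metis
  have "ctr k c = ctr k' c' \<Longrightarrow> c \<in> C k \<Longrightarrow> c' \<in> C k' \<Longrightarrow> k = k' \<and> c = c'" for k k' c c'
    by (cases k; cases k'; auto dest: nz)
  moreover have "to_bl (Dir k c n) = Exc (ctr k c) d \<Longrightarrow> to_bl (Dir k c n') = Exc (ctr k c) d \<Longrightarrow> n = n'" for k c n n' d
    by (cases k) (auto simp del: loc.simps(2))
  moreover have "\<exists>d. to_bl (Dir k c n) = Exc (ctr k c) d" for k c n
    by (cases k) auto
  ultimately have "Dir k c n = Dir k' c' n'" if "to_bl (Dir k c n) = to_bl (Dir k' c' n')" "c \<in> C k" "c' \<in> C k'" for k c n k' c' n'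
    using that by (metis bl_point.inject(2))
  moreover have "to_bl (Dir k c n) \<noteq> Off p" "Off p \<noteq> to_bl (Dir k c n)" for k c n p
    by (cases k, auto)+
  ultimately show "x = y" using xy by (cases x; cases y) (auto simp: Surf_simps simp del: to_bl.simps(2-))
qed

lemma to_bl_Surf:
  assumes fin: "\<And>k. finite (C k)" and nz: "\<And>k. 0 \<notin> C k"
  shows "to_bl ` Surf C = blowup (ctrs C) -
    (strict_transform (ctrs C) ({Aff 0} \<times> UNIV) \<union> strict_transform (ctrs C) ({Infty} \<times> UNIV) \<union>
     strict_transform (ctrs C) (UNIV \<times> {Aff 0}) \<union> strict_transform (ctrs C) (UNIV \<times> {Infty}))" (is "_ = ?R")
proof -
  have S: "finite (ctrs C)" unfolding ctrs_eq using fin by auto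
  have nz': "\<And>c k. c \<in> C k \<Longrightarrow> c \<noteq> 0" using nz by metis
  note st = strict_transform_vertical[OF S] strict_transform_horizontal[OF S]
  show ?thesis
  proof
    show "to_bl ` Surf C \<subseteq> ?R"
    proof (rule image_subsetI)
      fix x assume "x \<in> Surf C"
      show "to_bl x \<in> ?R"
      proof (cases x)
        case (Tor y z)
        with \<open>x \<in> Surf C\<close> show ?thesis unfolding st by (auto simp: ctrs_eq)
      next
        case (Dir k c n)
        with \<open>x \<in> Surf C\<close> have "c \<noteq> 0" "ctr k c \<in> ctrs C" using nz' by (auto simp: ctrs_def)
        with Dir show ?thesis unfolding st by (cases k) (auto simp del: loc.simps(2))
      qed
    qed
    show "?R \<subseteq> to_bl ` Surf C"
    proof
      fix z assume z: "z \<in> ?R"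
      show "z \<in> to_bl ` Surf C"
      proof (cases z)
        case (Off p)
        obtain a b where p: "p = (a, b)" by fastforce
        have "a \<noteq> Aff 0" "a \<noteq> Infty" "b \<noteq> Aff 0" "b \<noteq> Infty" using z unfolding st Off p by auto
        then obtain y x where "a = Aff y" "b = Aff x" "y \<noteq> 0" "x \<noteq> 0" by (metis P1.exhaust)
        then show ?thesis using Off p by (intro image_eqI[of _ _ "Tor y x"]) auto
      next
        case (Exc p d)
        then have "p \<in> ctrs C" using z by auto
        then obtain k c where k: "p = ctr k c" "c \<in> C k" by (auto simp: ctrs_def)
        have "\<exists>n. z = to_bl (Dir k c n)"
        proof (cases "k = Y0 \<or> k = YI")
          case True
          then have "d \<noteq> Aff 0" using z k \<open>p \<in> ctrs C\<close> unfolding st Exc by auto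
          then obtain n where "d = loc Infty n" using range_loc_Infty by blast
          then show ?thesis using True k Exc by auto
        next
          case False
          then have "d \<noteq> Infty" using z k \<open>p \<in> ctrs C\<close> unfolding st Exc by (cases k) auto
          then obtain n where "d = Aff n" by (cases d) auto
          then show ?thesis using False k Exc by (cases k) auto
        qed
        then show ?thesis using k by force
      qed
    qed
  qed
qed

fun bl_chart :: "pt \<Rightarrow> complex \<times> complex \<Rightarrow> bl_point" where
  "bl_chart (Tor _ _) = chart0 (Aff 0, Aff 0)"
| "bl_chart (Dir Y0 c _) = chart2 (ctr Y0 c)"
| "bl_chart (Dir YI c _) = chart2 (ctr YI c)"
| "bl_chart (Dir X0 c _) = chart1 (ctr X0 c)"
| "bl_chart (Dir XI c _) = chart1 (ctr XI c)"

text \<open>\<open>chart1\<close> lists the coordinate along the exceptional curve first, \<open>pchart\<close> lists it second.\<close>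

fun flip :: "pt \<Rightarrow> complex \<times> complex \<Rightarrow> complex \<times> complex" where
  "flip (Dir X0 _ _) w = (snd w, fst w)"
| "flip (Dir XI _ _) w = (snd w, fst w)"
| "flip _ w = w"

lemma flip_flip [simp]: "flip x (flip x w) = w"
  by (induction x w rule: flip.induct) auto

lemma bl_chart_eq: "bl_chart x w = to_bl (pchart x (flip x w))"
  by (induction x w rule: flip.induct; cases w) auto

lemma bl_chart_in_charts: "x \<in> Surf C \<Longrightarrow> bl_chart x \<in> charts (ctrs C)"
  by (induction x rule: bl_chart.induct) (auto simp: charts_def ctrs_eq)

text \<open>\<open>regular_map\<close> asks for a single denominator for both coordinates; the
  factor \<open>n3 w * d3 w\<close> also ensures that \<open>e\<close> is nonzero wherever
  \<open>d\<close> is.\<close>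

lemma regular_at_common_denominator:
  assumes "regular_at w0 f" "regular_at w0 g" "regular_at w0 e" "e w0 \<noteq> 0"
  obtains n m d where "n \<in> poly2" "m \<in> poly2" "d \<in> poly2" "d w0 \<noteq> 0"
    "\<And>w. d w \<noteq> 0 \<Longrightarrow> e w \<noteq> 0 \<and> f w = n w / d w \<and> g w = m w / d w"
proof -
  obtain n1 d1 where f: "n1 \<in> poly2" "d1 \<in> poly2" "d1 w0 \<noteq> 0" "\<And>w. d1 w \<noteq> 0 \<Longrightarrow> f w = n1 w / d1 w"
    using regular_atE[OF assms(1)] by blast
  obtain n2 d2 where g: "n2 \<in> poly2" "d2 \<in> poly2" "d2 w0 \<noteq> 0" "\<And>w. d2 w \<noteq> 0 \<Longrightarrow> g w = n2 w / d2 w"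
    using regular_atE[OF assms(2)] by blast
  obtain n3 d3 where e: "n3 \<in> poly2" "d3 \<in> poly2" "d3 w0 \<noteq> 0" "\<And>w. d3 w \<noteq> 0 \<Longrightarrow> e w = n3 w / d3 w"
    using regular_atE[OF assms(3)] by blast
  show ?thesis
    by (rule that[of "\<lambda>w. n1 w * d2 w * (n3 w * d3 w)" "\<lambda>w. n2 w * d1 w * (n3 w * d3 w)"
          "\<lambda>w. d1 w * d2 w * (n3 w * d3 w)"])
      (use f g e assms(4) in \<open>auto intro!: poly_funs_intros\<close>)
qed

lemma regular_at_flip:
  assumes "regular_at (flip x w0) h"
  shows "regular_at w0 (\<lambda>w. h (flip x w))"
proof -
  have *: "flip x w = (fst (flip x w), snd (flip x w))" for w by simp
  have "regular_at w0 (\<lambda>w. fst (flip x w)) \<and> regular_at w0 (\<lambda>w. snd (flip x w))"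
    by (induction x w0 rule: flip.induct) (auto intro: regular_at_intros)
  then show ?thesis using assms by (subst *) (intro regular_at_compose, auto)
qed

lemma bl_chart_flip_pcoord [simp]: "bl_chart x (flip x (pcoord x)) = to_bl x"
  by (simp add: bl_chart_eq)

lemma flip_linear: "flip x (n1 / d, n2 / d) = (fst (flip x (n1, n2)) / d, snd (flip x (n1, n2)) / d)"
  by (induction x "(n1, n2)" rule: flip.induct) auto

lemma to_bl_Tor_in_iff: "to_bl (Tor y z) \<in> to_bl ` Surf C \<longleftrightarrow> Tor y z \<in> Surf C"
proof
  assume "to_bl (Tor y z) \<in> to_bl ` Surf C"
  then obtain x where "x \<in> Surf C" "to_bl (Tor y z) = to_bl x" by blast
  then show "Tor y z \<in> Surf C" by (induction x rule: to_bl.induct) auto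
qed blast

lemma pchart_in_Surf:
  assumes "x \<in> Surf C" "to_bl (pchart x w) \<in> to_bl ` Surf C"
  shows "pchart x w \<in> Surf C"
proof (cases x)
  case (Tor y z)
  then show ?thesis using assms(2) to_bl_Tor_in_iff by simp
next
  case (Dir k c n)
  obtain y z where t: "tor k (fst w) (c + fst w * snd w) = Tor y z" by (cases k) auto
  show ?thesis
    using assms to_bl_Tor_in_iff[of y z C] unfolding Dir by (cases "fst w = 0") (simp_all add: t del: to_bl.simps)
qed

lemma regular_map_of_morphism:
  assumes f: "morphism (Surf C) (Surf D) f" and C: "\<And>k. 0 \<notin> C k" and F: "\<And>x. x \<in> Surf C \<Longrightarrow> F (to_bl x) = to_bl (f x)"
  shows "regular_map (ctrs C) (to_bl ` Surf C) (ctrs D) (to_bl ` Surf D) F"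
  unfolding regular_map_def
proof (intro conjI ballI)
  show "F ` to_bl ` Surf C \<subseteq> to_bl ` Surf D" using f F unfolding morphism_def by auto
  fix z assume "z \<in> to_bl ` Surf C"
  then obtain x where x: "x \<in> Surf C" "z = to_bl x" by blast
  then have fx: "f x \<in> Surf D" using f unfolding morphism_def by blast
  obtain h1 h2 e where h: "regular_at (pcoord x) h1" "regular_at (pcoord x) h2" "regular_at (pcoord x) e" "e (pcoord x) \<noteq> 0"
    and hf: "\<And>w. e w \<noteq> 0 \<Longrightarrow> pchart x w \<in> Surf C \<Longrightarrow> f (pchart x w) = pchart (f x) (h1 w, h2 w)"
    using f x unfolding morphism_def map_regular_at_def by metis
  define w0 where "w0 = flip x (pcoord x)"
  obtain n1 n2 d where n: "n1 \<in> poly2" "n2 \<in> poly2" "d \<in> poly2" "d w0 \<noteq> 0"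
    "\<And>w. d w \<noteq> 0 \<Longrightarrow> e (flip x w) \<noteq> 0 \<and> h1 (flip x w) = n1 w / d w \<and> h2 (flip x w) = n2 w / d w"
    by (rule regular_at_common_denominator[of w0 "\<lambda>w. h1 (flip x w)" "\<lambda>w. h2 (flip x w)" "\<lambda>w. e (flip x w)"])
      (use h in \<open>auto simp: w0_def intro!: regular_at_flip\<close>)
  define m1 where "m1 w = fst (flip (f x) (n1 w, n2 w))" for w
  define m2 where "m2 w = snd (flip (f x) (n1 w, n2 w))" for w
  have m: "m1 \<in> poly2" "m2 \<in> poly2"
    using n by (cases "f x"; cases "case f x of Dir k _ _ \<Rightarrow> k | _ \<Rightarrow> Y0"; simp add: m1_def[abs_def] m2_def[abs_def])+
  have key: "F (bl_chart x w) = bl_chart (f x) (m1 w / d w, m2 w / d w)"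
    if w: "bl_chart x w \<in> to_bl ` Surf C" "d w \<noteq> 0" for w
  proof -
    have "pchart x (flip x w) \<in> Surf C"
      using w x(1) by (intro pchart_in_Surf) (auto simp: bl_chart_eq)
    then have "F (bl_chart x w) = to_bl (pchart (f x) (n1 w / d w, n2 w / d w))"
      using F hf[of "flip x w"] n(5)[OF w(2)] by (simp add: bl_chart_eq)
    also have "\<dots> = bl_chart (f x) (flip (f x) (n1 w / d w, n2 w / d w))" by (simp add: bl_chart_eq)
    finally show ?thesis by (simp add: flip_linear m1_def m2_def)
  qed
  show "\<exists>ch\<in>charts (ctrs C). \<exists>ch'\<in>charts (ctrs D). \<exists>w\<^sub>0. \<exists>n\<^sub>1\<in>poly2. \<exists>n\<^sub>2\<in>poly2. \<exists>d\<in>poly2.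
      ch w\<^sub>0 = z \<and> d w\<^sub>0 \<noteq> 0 \<and>
      (\<forall>w. ch w \<in> to_bl ` Surf C \<and> d w \<noteq> 0 \<longrightarrow> F (ch w) = ch' (n\<^sub>1 w / d w, n\<^sub>2 w / d w))"
    using bl_chart_in_charts[OF x(1)] bl_chart_in_charts[OF fx] m n(3,4) key x(2)
    by (intro bexI[of _ "bl_chart x"] bexI[of _ "bl_chart (f x)"] exI[of _ w0] bexI[of _ m1] bexI[of _ m2] bexI[of _ d])
      (auto simp: w0_def)
qed

lemma regular_iso_of_surf_iso:
  assumes f: "surf_iso (Surf C) (Surf D) f" and C: "\<And>k. 0 \<notin> C k" and D: "\<And>k. 0 \<notin> D k"
    and F: "\<And>x. x \<in> Surf C \<Longrightarrow> F (to_bl x) = to_bl (f x)"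
  shows "regular_iso (ctrs C) (to_bl ` Surf C) (ctrs D) (to_bl ` Surf D) F"
proof -
  obtain g where g: "morphism (Surf C) (Surf D) f" "morphism (Surf D) (Surf C) g"
    "\<And>x. x \<in> Surf C \<Longrightarrow> g (f x) = x" "\<And>y. y \<in> Surf D \<Longrightarrow> f (g y) = y"
    using f unfolding surf_iso_def by blast
  have gD: "g y \<in> Surf C" if "y \<in> Surf D" for y using g(2) that unfolding morphism_def by blast
  have fC: "f y \<in> Surf D" if "y \<in> Surf C" for y using g(1) that unfolding morphism_def by blast
  have inj: "inj_on F (to_bl ` Surf C)"
  proof (rule inj_onI)
    fix z z' assume z: "z \<in> to_bl ` Surf C" "z' \<in> to_bl ` Surf C" "F z = F z'"
    then obtain x x' where x: "x \<in> Surf C" "x' \<in> Surf C" "z = to_bl x" "z' = to_bl x'" by blast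
    have "to_bl (f x) = to_bl (f x')" using z(3) unfolding x(3,4) F[OF x(1)] F[OF x(2)] .
    then have "f x = f x'" by (rule inj_onD[OF inj_to_bl[of D, OF D]]) (use x fC in auto)
    then have "g (f x) = g (f x')" by (rule arg_cong)
    then show "z = z'" unfolding x(3,4) g(3)[OF x(1)] g(3)[OF x(2)] by (rule arg_cong)
  qed
  have im: "F ` to_bl ` Surf C = to_bl ` Surf D"
  proof
    show "F ` to_bl ` Surf C \<subseteq> to_bl ` Surf D" using F fC by auto
    show "to_bl ` Surf D \<subseteq> F ` to_bl ` Surf C"
    proof
      fix z assume "z \<in> to_bl ` Surf D"
      then obtain y where y: "y \<in> Surf D" "z = to_bl y" by blast
      then have "z = F (to_bl (g y))" using F[OF gD[OF y(1)]] g(4)[OF y(1)] by simp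
      then show "z \<in> F ` to_bl ` Surf C" using gD[OF y(1)] by blast
    qed
  qed
  have "inv_into (to_bl ` Surf C) F (to_bl y) = to_bl (g y)" if "y \<in> Surf D" for y
    using F[OF gD[OF that]] gD[OF that] g(4)[OF that] by (intro inv_into_f_eq[OF inj]) auto
  from regular_map_of_morphism[where C = D and D = C, OF g(2) D this] regular_map_of_morphism[where C = C and D = D, OF g(1) C F]
  show ?thesis unfolding regular_iso_def bij_betw_def using inj im by simp
qed

text \<open>Every preferred chart is birational onto the torus coordinates, so generic conditions
  can be pulled back along it.\<close>

lemma generic_pchart:
  assumes "generic P" "0 \<notin> C k" and x: "x = Tor y z \<or> (x = Dir k c n \<and> c \<in> C k)"
  shows "generic (\<lambda>w. \<exists>v. pchart x w = Tor (fst v) (snd v) \<and> P v)"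
  using x
proof
  assume "x = Tor y z"
  then show ?thesis using assms(1) by (elim generic_mono) auto
next
  assume "x = Dir k c n \<and> c \<in> C k"
  then have x: "x = Dir k c n" "c \<noteq> 0" using assms(2) by auto
  have g: "generic (\<lambda>w. fst w \<noteq> 0)" "generic (\<lambda>w. snd w \<noteq> 0)"
    by (rule regular_at_generic[of "(1, 1)"]; auto intro: regular_at_intros)+
  have t: "generic (\<lambda>v. fst v \<noteq> 0 \<and> P (h1 v, h2 v))"
    if "generic (\<lambda>w. \<exists>v. regular_at v h1 \<and> regular_at v h2 \<and> (h1 v, h2 v) = w)" for h1 h2
    by (rule generic_conj[OF g(1) generic_compose[OF assms(1) that]])
  show ?thesis
  proof (cases k)
    case Y0
    \<comment> \<open>The witness for dominance is the inverse of the chart, obtained by solving for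
      the direction; likewise on the other three sides.\<close>
    have "generic (\<lambda>v. fst v \<noteq> 0 \<and> P (fst v, c + fst v * snd v))"
      by (rule t, rule generic_mono[OF g(1)], rule_tac x = "(fst w, (snd w - c) / fst w)" in exI) (auto intro!: regular_at_intros)
    then show ?thesis by (rule generic_mono) (auto simp: x Y0)
  next
    case YI
    have "generic (\<lambda>v. fst v \<noteq> 0 \<and> P (1 / fst v, c + fst v * snd v))"
      by (rule t, rule generic_mono[OF g(1)], rule_tac x = "(1 / fst w, (snd w - c) * fst w)" in exI) (auto intro!: regular_at_intros)
    then show ?thesis by (rule generic_mono) (auto simp: x YI)
  next
    case X0
    have "generic (\<lambda>v. fst v \<noteq> 0 \<and> P (c + fst v * snd v, fst v))"
      by (rule t, rule generic_mono[OF g(2)], rule_tac x = "(snd w, (fst w - c) / snd w)" in exI) (auto intro!: regular_at_intros)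
    then show ?thesis by (rule generic_mono) (auto simp: x X0)
  next
    case XI
    have "generic (\<lambda>v. fst v \<noteq> 0 \<and> P (c + fst v * snd v, 1 / fst v))"
      by (rule t, rule generic_mono[OF g(2)], rule_tac x = "(1 / snd w, (fst w - c) * snd w)" in exI) (auto intro!: regular_at_intros)
    then show ?thesis by (rule generic_mono) (auto simp: x XI)
  qed
qed

lemma generic_flip:
  assumes "generic P"
  shows "generic (\<lambda>w. P (flip x w))"
proof -
  have *: "flip x w = (fst (flip x w), snd (flip x w))" for w by simp
  have "generic (\<lambda>w. \<exists>v. regular_at v (\<lambda>w. fst (flip x w)) \<and> regular_at v (\<lambda>w. snd (flip x w)) \<and> (fst (flip x v), snd (flip x v)) = w)"
  proof (rule generic_mono)
    show "generic (\<lambda>_. True)" unfolding generic_def by (rule bexI[of _ "\<lambda>_. 1"]) (auto intro: poly_funs.const)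
    fix w
    show "\<exists>v. regular_at v (\<lambda>w. fst (flip x w)) \<and> regular_at v (\<lambda>w. snd (flip x w)) \<and> (fst (flip x v), snd (flip x v)) = w"
      by (intro exI[of _ "flip x w"] conjI regular_at_flip) (auto intro: regular_at_intros)
  qed
  from generic_compose[OF assms this] show ?thesis by simp
qed

text \<open>In the chart at a given point, a polynomial vanishing on \<open>A\<close> vanishes
  generically, hence identically.\<close>

lemma to_bl_Surf_subset_zclosure:
  assumes C: "\<And>k. finite (C k)" "\<And>k. 0 \<notin> C k" and P: "generic P"
    and A: "\<And>y x. P (y, x) \<Longrightarrow> Off (Aff y, Aff x) \<in> A"
  shows "to_bl ` Surf C \<subseteq> zclosure (ctrs C) A"
proof (rule image_subsetI)
  fix x assume x: "x \<in> Surf C"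
  have "bl_chart x (flip x (pcoord x)) \<in> zclosure (ctrs C) A"
  proof (rule zclosure_mem_chart[OF bl_chart_in_charts[OF x]])
    have "to_bl x \<in> to_bl ` Surf C" using x by blast
    then show "bl_chart x (flip x (pcoord x)) \<in> blowup (ctrs C)"
      unfolding to_bl_Surf[of C, OF C] by simp
    fix f assume f: "f \<in> poly2" "\<And>w. bl_chart x w \<in> A \<Longrightarrow> f w = 0"
    have "generic (\<lambda>w. \<exists>v. pchart x w = Tor (fst v) (snd v) \<and> P v)"
    proof (cases x)
      case (Tor y z)
      then show ?thesis using generic_pchart[where C = C and x = x and P = P and k = Y0, OF P C(2)] by blast
    next
      case (Dir k c n)
      with x have "c \<in> C k" by simp
      with Dir show ?thesis using generic_pchart[where C = C and x = x and P = P and k = k, OF P C(2)] by blast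
    qed
    from generic_flip[OF this, of x] have "generic (\<lambda>w. f w = 0)"
      by (rule generic_mono) (rule f(2), auto simp: bl_chart_eq A)
    with f(1) show "f (flip x (pcoord x)) = 0" by (rule poly2_generic_zero)
  qed
  then show "to_bl x \<in> zclosure (ctrs C) A" by simp
qed

section \<open>The composite of elementary maps\<close>

text \<open>In the notation of the introduction \<open>u\<^sub>1 = \<xi>\<^sub>5\<close>, \<open>u\<^sub>2 = \<xi>\<^sub>6\<close>, \<open>q v\<^sub>1 = \<xi>\<^sub>7\<close>, \<open>v\<^sub>2 = \<xi>\<^sub>8\<close>,
  \<open>(a\<^sub>1, a\<^sub>2, b\<^sub>1, b\<^sub>2) = (c\<^sub>1, c\<^sub>2, c\<^sub>3, c\<^sub>4)\<close>.\<close>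

locale phi_data =
  fixes q a1 a2 b1 b2 u1 u2 v1 v2 :: complex
  assumes nz: "q \<noteq> 0" "a1 \<noteq> 0" "a2 \<noteq> 0" "b1 \<noteq> 0" "b2 \<noteq> 0" "u1 \<noteq> 0" "u2 \<noteq> 0" "v1 \<noteq> 0" "v2 \<noteq> 0"
    and balance: "u1 * u2 * b1 * b2 = v1 * v2 * a1 * a2"
    and dist: "a1 \<noteq> a2" "b1 \<noteq> b2" "u1 \<noteq> u2" "u1 \<noteq> v2" "u2 \<noteq> v2" "v1 \<noteq> v2" "u2 \<noteq> v1"
      "u1 \<noteq> q * v1" "v2 \<noteq> q * v1" "u1 \<noteq> q * u2"
    and dist_ab: "u1 * b1 \<noteq> v2 * a1" "u1 * b1 \<noteq> v2 * a2" "u1 * b2 \<noteq> v2 * a1" "u1 * b2 \<noteq> v2 * a2"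
begin

text \<open>\<open>A1\<close>, \<open>A2\<close> and \<open>B1\<close>, \<open>B2\<close> are the
  values of \<open>Y\<close> at the centres on \<open>\<xi> = 0\<close> and
  \<open>\<xi> = \<infinity>\<close>, where \<open>Y\<close> tends to \<open>u1 / (v2 * y)\<close>
  and \<open>1 / y\<close>.\<close>

definition "A1 = u1 / (v2 * a1)"
definition "A2 = u1 / (v2 * a2)"
definition "B1 = 1 / b1"
definition "B2 = 1 / b2"

lemma AB_nz: "A1 \<noteq> 0" "A2 \<noteq> 0" "B1 \<noteq> 0" "B2 \<noteq> 0"
  using nz by (auto simp: A1_def A2_def B1_def B2_def)

lemma AB_dist: "A1 \<noteq> A2" "B1 \<noteq> B2" "A1 \<noteq> B1" "A1 \<noteq> B2" "A2 \<noteq> B1" "A2 \<noteq> B2"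
  using nz dist dist_ab by (auto simp: A1_def A2_def B1_def B2_def frac_eq_eq mult_ac)

fun src :: "side \<Rightarrow> complex set" where
  "src Y0 = {u1, u2}" | "src YI = {q * v1, v2}" | "src X0 = {a1, a2}" | "src XI = {b1, b2}"

fun tgt :: "side \<Rightarrow> complex set" where
  "tgt Y0 = {u1 / q, u2}" | "tgt YI = {v1, v2}" | "tgt X0 = {a1, a2}" | "tgt XI = {b1, b2}"

text \<open>The constant \<open>1 / (u2 * v2)\<close> makes the third elementary step exchange
  \<open>1 / u2\<close> and \<open>1 / v2\<close> on the side \<open>XI\<close>, and
  \<open>b1 * b2\<close> makes the last one exchange \<open>b1\<close> and \<open>b2\<close>. The
  inversions correct for the inversion built into \<open>elem\<close>: two such maps rescale their
  variable where its inverse is wanted, one inverts where rescaling is wanted.\<close>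

definition phim :: "pt \<Rightarrow> pt" where
  "phim = elem u2 v1 (b1 * b2) \<circ> (inv_fst \<circ> (swap_pt \<circ> (inv_fst \<circ>
    (elem B2 A2 (1 / (u2 * v2)) \<circ> (elem A1 B1 1 \<circ> (swap_pt \<circ> elem u1 v2 1))))))"

text \<open>\<open>D1\<close> to \<open>D8\<close> follow the centres through the factors. The
  equations \<open>e1\<close> and \<open>e2\<close>, where \<open>balance\<close> enters, put the
  centres on \<open>X0\<close> in their prescribed places.\<close>

lemma surf_iso_phim: "surf_iso (Surf src) (Surf tgt) phim"
proof -
  note N = nz AB_nz and DD = dist AB_dist dist[symmetric] AB_dist[symmetric]
  define D1 where "D1 = elem_lines u1 v2 1 src"
  define D2 where "D2 = swap_lines D1"
  define D3 where "D3 = elem_lines A1 B1 1 D2"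
  define D4 where "D4 = elem_lines B2 A2 (1 / (u2 * v2)) D3"
  define D5 where "D5 = inv_fst_lines D4"
  define D6 where "D6 = swap_lines D5"
  define D7 where "D7 = inv_fst_lines D6"
  define D8 where "D8 = elem_lines u2 v1 (b1 * b2) D7"
  have "0 \<notin> src k" for k using N by (cases k) auto
  then have ok0: "elem_ok u1 v2 1 src"
    using DD by (auto simp: elem_ok_def)
  have D1: "D1 Y0 = {u1, q * v1}" "D1 YI = {v2, u2}" "D1 X0 = {A1, A2}" "D1 XI = {B1, B2}"
    using DD by (auto simp: D1_def A1_def A2_def B1_def B2_def)
  have D2: "D2 X0 = {u1, q * v1}" "D2 XI = {v2, u2}" "D2 Y0 = {A1, A2}" "D2 YI = {B1, B2}"
    by (simp_all add: D2_def D1)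
  have "0 \<notin> D2 k" for k using N by (cases k) (auto simp: D2)
  then have ok2: "elem_ok A1 B1 1 D2"
    using DD by (auto simp: elem_ok_def D2)
  have D3: "D3 X0 = {A1 / (B1 * u1), A1 / (B1 * (q * v1))}" "D3 XI = {1 / v2, 1 / u2}"
      "D3 Y0 = {A1, B2}" "D3 YI = {B1, A2}"
    using DD by (auto simp: D3_def D2)
  have "0 \<notin> D3 k" for k using N by (cases k) (auto simp: D3)
  then have ok3: "elem_ok B2 A2 (1 / (u2 * v2)) D3"
    using DD N by (auto simp: elem_ok_def D3)
  have D4: "D4 X0 = {1 / v1, q / u1}" "D4 XI = {1 / u2, 1 / v2}"
      "D4 Y0 = {B1, B2}" "D4 YI = {A1, A2}"
  proof -
    have e1: "1 / (u2 * v2) * B2 / (A2 * (A1 / (B1 * u1))) = 1 / v1"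
      using nz balance by (simp add: A1_def A2_def B1_def B2_def divide_simps) (simp add: algebra_simps)
    have e2: "1 / (u2 * v2) * B2 / (A2 * (A1 / (B1 * (q * v1)))) = q / u1"
      using nz balance by (simp add: A1_def A2_def B1_def B2_def divide_simps) (simp add: algebra_simps)
    show "D4 X0 = {1 / v1, q / u1}"
      unfolding D4_def elem_lines.simps D3 image_insert image_empty e1 e2 ..
    show "D4 XI = {1 / u2, 1 / v2}" "D4 Y0 = {B1, B2}" "D4 YI = {A1, A2}"
      using DD N by (auto simp: D4_def D3)
  qed
  have "0 \<notin> D4 k" for k using N by (cases k) (auto simp: D4)
  note ok4 = this
  have D5: "D5 X0 = {v1, u1 / q}" "D5 XI = {u2, v2}" "D5 Y0 = {A1, A2}" "D5 YI = {B1, B2}"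
    by (simp_all add: D5_def D4)
  have D6: "D6 Y0 = {v1, u1 / q}" "D6 YI = {u2, v2}" "D6 X0 = {A1, A2}" "D6 XI = {B1, B2}"
    by (simp_all add: D6_def D5)
  have "0 \<notin> D6 k" for k using N by (cases k) (auto simp: D6)
  note ok6 = this
  have D7: "D7 YI = {v1, u1 / q}" "D7 Y0 = {u2, v2}" "D7 X0 = {1 / A1, 1 / A2}" "D7 XI = {b1, b2}"
    by (simp_all add: D7_def D6 B1_def B2_def)
  have "0 \<notin> D7 k" for k using N by (cases k) (auto simp: D7)
  moreover have uq: "u2 \<noteq> u1 / q" "v1 \<noteq> u1 / q" using DD N by (auto simp: field_simps)
  ultimately have ok7: "elem_ok u2 v1 (b1 * b2) D7"
    using DD N by (auto simp: elem_ok_def D7)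
  have D8: "D8 = tgt"
  proof
    have e1: "b1 * b2 * u2 / (v1 * (1 / A1)) = a2" and e2: "b1 * b2 * u2 / (v1 * (1 / A2)) = a1"
      using nz balance by (simp add: A1_def A2_def divide_simps, simp add: algebra_simps)+
    show "D8 k = tgt k" for k
    proof (cases k)
      case X0
      show ?thesis unfolding X0 D8_def elem_lines.simps D7 image_insert image_empty e1 e2 by auto
    qed (use DD N uq in \<open>auto simp: D8_def D7\<close>)
  qed
  have "surf_iso (Surf src) (Surf D1) (elem u1 v2 1)"
    unfolding D1_def by (rule surf_iso_elem[OF ok0])
  note surf_iso_comp[OF this surf_iso_swap_pt, folded D2_def]
  note surf_iso_comp[OF this surf_iso_elem[OF ok2], folded D3_def]
  note surf_iso_comp[OF this surf_iso_elem[OF ok3], folded D4_def]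
  note surf_iso_comp[OF this surf_iso_inv_fst[of D4, OF ok4], folded D5_def]
  note surf_iso_comp[OF this surf_iso_swap_pt, folded D6_def]
  note surf_iso_comp[OF this surf_iso_inv_fst[of D6, OF ok6], folded D7_def]
  note surf_iso_comp[OF this surf_iso_elem[OF ok7], folded D8_def]
  then show ?thesis unfolding phim_def D8 .
qed

definition "mid_y y x = (x - u1) / (y * (x - v2))"
definition "out_x y x = u2 * v2 * (mid_y y x - A1) * (mid_y y x - A2) / ((mid_y y x - B1) * (mid_y y x - B2) * x)"

lemma phim_Tor:
  assumes "x \<noteq> u1" "x \<noteq> v2" "mid_y y x \<notin> {A1, A2, B1, B2}" "out_x y x \<noteq> u2" "out_x y x \<noteq> v1" "x \<noteq> 0" "y \<noteq> 0"
  shows "phim (Tor y x) = Tor (b1 * b2 * mid_y y x * (out_x y x - u2) / (out_x y x - v1)) (out_x y x)"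
proof -
  define Y where "Y = mid_y y x"
  have out_x: "out_x y x = u2 * v2 * (Y - A1) * (Y - A2) / ((Y - B1) * (Y - B2) * x)"
    by (simp add: out_x_def Y_def)
  have *: "1 / (1 / (u2 * v2) * (Y - B2) / (1 * (Y - A1) / (x * (Y - B1)) * (Y - A2))) = out_x y x"
    using assms nz unfolding out_x Y_def by (simp add: divide_simps)
  have Y: "(x - u1) / (y * (x - v2)) = Y" by (simp add: Y_def mid_y_def)
  have "(swap_pt \<circ> elem u1 v2 1) (Tor y x) = Tor x Y"
    using assms Y by simp
  moreover have "(inv_fst \<circ> (swap_pt \<circ> (inv_fst \<circ> (elem B2 A2 (1 / (u2 * v2)) \<circ> elem A1 B1 1)))) (Tor x Y) = Tor (1 / Y) (out_x y x)"
    using assms * by (simp add: Y_def del: mult_1)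
  ultimately show ?thesis using assms unfolding phim_def o_def by (simp add: Y_def)
qed

end

text \<open>The relations between \<open>(y, \<xi>)\<close> and \<open>(y', \<xi>')\<close> in the normalised variables \<open>X = \<kappa>\<^sub>2\<xi>/q\<close>,
  \<open>X' = q\<kappa>\<^sub>1\<xi>'\<close>, with \<open>\<alpha> = q\<xi>\<^sub>6/\<xi>\<^sub>7\<close>, \<open>\<beta> = \<xi>\<^sub>5/\<xi>\<^sub>8\<close>, \<open>w = c\<^sub>3c\<^sub>4\<close>, \<open>r = c\<^sub>3 + c\<^sub>4\<close>, \<open>s = c\<^sub>1 + c\<^sub>2\<close>.\<close>

definition dpoly :: "complex \<Rightarrow> complex \<Rightarrow> complex \<Rightarrow> complex \<Rightarrow> complex \<Rightarrow> complex \<Rightarrow> complex \<Rightarrow> complex" where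
  "dpoly X \<alpha> \<beta> w r s y = y\<^sup>2 - s * y + \<alpha> * \<beta> * w + X\<^sup>2 * (y\<^sup>2 - r * y + w) - 2 * X * y\<^sup>2 + (r + s) * X * y
    - w * (\<alpha> + \<beta>) * X"

definition npoly :: "complex \<Rightarrow> complex \<Rightarrow> complex \<Rightarrow> complex \<Rightarrow> complex \<Rightarrow> complex \<Rightarrow> complex \<Rightarrow> complex" where
  "npoly X \<alpha> \<beta> w r s y = (\<alpha> + \<beta>) * X * y\<^sup>2 - (s + r * \<alpha> * \<beta>) * X * y + 2 * \<alpha> * \<beta> * w * X
    - \<alpha> * X\<^sup>2 * (y\<^sup>2 - r * y + w) - \<beta> * (y\<^sup>2 - s * y + \<alpha> * \<beta> * w)"

definition mpoly :: "complex \<Rightarrow> complex \<Rightarrow> complex \<Rightarrow> complex \<Rightarrow> complex \<Rightarrow> complex \<Rightarrow> complex" where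
  "mpoly X \<beta> w r y y' = (y' - y) * (y * y' - w * \<beta>) + X * (y\<^sup>2 - r * y + w) * y'"

section \<open>Elimination of \<open>Y\<close> from the three relations\<close>

context
  fixes X X' Y \<alpha> \<beta> w r s y y' :: complex
  assumes nz: "X \<noteq> 0" "X \<noteq> 1" "X' \<noteq> 1" "Y \<noteq> 0"
    and R: "X * X' * (w * Y\<^sup>2 - r * Y + 1) = \<alpha> * w * Y\<^sup>2 - s * Y + \<beta>"
    and y: "y * (Y * (X - 1)) = X - \<beta>"
    and y': "y' * (X' - 1) = w * Y * (X' - \<alpha>)"
begin

text \<open>Substituting for \<open>y * (Y * (X - 1))\<close> splits off \<open>X - \<beta>\<close>,
  and \<open>R\<close> turns the cofactor into a multiple of \<open>1 - X'\<close>. At good points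
  every factor on the right is nonzero, so \<open>dpoly\<close> does not vanish there.\<close>

lemma den_factor: "dpoly X \<alpha> \<beta> w r s y * Y\<^sup>2 = (X - \<beta>) * X * (1 - X') * (w * Y\<^sup>2 - r * Y + 1)"
proof -
  have "dpoly X \<alpha> \<beta> w r s y * Y\<^sup>2 = (y * (Y * (X - 1)))\<^sup>2 - (y * (Y * (X - 1))) * Y * (r * X - s) + w * (X - \<alpha>) * (X - \<beta>) * Y\<^sup>2"
    unfolding dpoly_def by (simp add: algebra_simps power2_eq_square)
  also have "\<dots> = (X - \<beta>) * (X * (w * Y\<^sup>2 - r * Y + 1) - (\<alpha> * w * Y\<^sup>2 - s * Y + \<beta>))"
    unfolding y by (simp add: algebra_simps power2_eq_square)
  finally show ?thesis unfolding R[symmetric] by (simp add: algebra_simps)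
qed

text \<open>After multiplication by powers of \<open>Y\<close> and \<open>X - 1\<close>, both sides
  become multiples of \<open>(X - \<beta>)\<^sup>2 * X * (w * Y\<^sup>2 - r * Y + 1)\<close>; the
  relation for \<open>y'\<close> trades \<open>X' - 1\<close> for
  \<open>X' - \<alpha>\<close>.\<close>

lemma num_den:
  "y' * y * dpoly X \<alpha> \<beta> w r s y
   = - (w * npoly X \<alpha> \<beta> w r s y)" (is "_ = - (w * ?N)")
proof -
  have "Y\<^sup>2 * (X - 1) * ?N = - (y * (Y * (X - 1)))\<^sup>2 * (\<alpha> * X - \<beta>) + (y * (Y * (X - 1))) * (X - \<beta>) * (\<alpha> * r * X - s) * Y
      - \<alpha> * w * (X - \<beta>)\<^sup>2 * Y\<^sup>2 * (X - 1)"
    unfolding npoly_def by (simp add: algebra_simps power2_eq_square)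
  also have "\<dots> = (X - \<beta>)\<^sup>2 * ((\<alpha> * w * Y\<^sup>2 - s * Y + \<beta>) - \<alpha> * X * (w * Y\<^sup>2 - r * Y + 1))"
    unfolding y by (simp add: algebra_simps power2_eq_square)
  also have "\<dots> = (X - \<beta>)\<^sup>2 * X * (w * Y\<^sup>2 - r * Y + 1) * (X' - \<alpha>)"
    unfolding R[symmetric] by (simp add: algebra_simps)
  finally have N: "Y\<^sup>2 * (X - 1) * ?N = (X - \<beta>)\<^sup>2 * X * (w * Y\<^sup>2 - r * Y + 1) * (X' - \<alpha>)" .
  have "Y\<^sup>2 * (X - 1) * Y * (y' * y * dpoly X \<alpha> \<beta> w r s y) = y' * (y * (Y * (X - 1))) * (dpoly X \<alpha> \<beta> w r s y * Y\<^sup>2)"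
    by (simp add: algebra_simps power2_eq_square)
  also have "\<dots> = - (X - \<beta>)\<^sup>2 * X * (w * Y\<^sup>2 - r * Y + 1) * (y' * (X' - 1))"
    unfolding y den_factor by (simp add: algebra_simps power2_eq_square)
  also have "\<dots> = - (Y * w) * ((X - \<beta>)\<^sup>2 * X * (w * Y\<^sup>2 - r * Y + 1) * (X' - \<alpha>))"
    unfolding y' by (simp add: algebra_simps power2_eq_square)
  also have "\<dots> = Y\<^sup>2 * (X - 1) * Y * (- (w * ?N))"
    unfolding N[symmetric] by (simp add: algebra_simps power2_eq_square)
  finally have eq: "Y\<^sup>2 * (X - 1) * Y * (y' * y * dpoly X \<alpha> \<beta> w r s y) = Y\<^sup>2 * (X - 1) * Y * (- (w * ?N))" .
  have ne: "Y\<^sup>2 * (X - 1) * Y \<noteq> 0" using nz by simp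
  show ?thesis by (rule mult_left_cancel[OF ne, THEN iffD1, OF eq])
qed

lemma xi_relation:
  "X' * mpoly X \<beta> w r y y' = y * (y'\<^sup>2 - s * y' + \<alpha> * \<beta> * w)" (is "?L = ?R")
proof -
  \<comment> \<open>The grouping isolates both sides of the relations for \<open>y\<close> and
    \<open>y'\<close>; once these are exchanged, what remains is \<open>y * y'\<close> times the
    difference of the two sides of \<open>R\<close>.\<close>
  have "Y * (?L - ?R) = y * y' * Y * (y' * (X' - 1)) + y * y' * X' * (y * (Y * (X - 1)))
      + y * y' * (s - r * X * X') * Y + w * y' * X' * Y * (X - \<beta>) + y * \<beta> * (w * Y * (X' - \<alpha>))"
    unfolding mpoly_def by (simp add: algebra_simps power2_eq_square)
  also have "\<dots> = y * y' * Y * (w * Y * (X' - \<alpha>)) + y * y' * X' * (X - \<beta>)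
      + y * y' * (s - r * X * X') * Y + w * y' * X' * Y * (y * (Y * (X - 1))) + y * \<beta> * (y' * (X' - 1))"
    by (simp only: y y')
  also have "\<dots> = y * y' * (X * X' * (w * Y\<^sup>2 - r * Y + 1) - (\<alpha> * w * Y\<^sup>2 - s * Y + \<beta>))"
    by (simp add: algebra_simps power2_eq_square)
  also have "\<dots> = 0" unfolding R by simp
  finally have "Y = 0 \<or> ?L - ?R = 0" by (simp only: mult_eq_0_iff)
  then have "?L - ?R = 0" using nz(4) by blast
  then show ?thesis by (rule eq_iff_diff_eq_0[THEN iffD2])
qed

end

lemma complex_avoiding:
  assumes "finite S"
  obtains z :: complex where "z \<notin> S"
  using ex_new_if_finite[OF infinite_UNIV_char_0 assms] by blast

context phi_data
begin

definition "out_y y x = b1 * b2 * mid_y y x * (out_x y x - u2) / (out_x y x - v1)"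

text \<open>The intermediate conditions keep every factor of \<open>phim\<close> inside the torus.
  The last two keep \<open>(y - c\<^sub>1)(y - c\<^sub>2)\<close> and its primed analogue nonzero,
  so that the 11 entries required by \<open>has_coords\<close> do not vanish.\<close>

definition good :: "complex \<Rightarrow> complex \<Rightarrow> bool" where
  "good y x \<longleftrightarrow> x \<noteq> 0 \<and> y \<noteq> 0 \<and> x \<noteq> u1 \<and> x \<noteq> v2 \<and> mid_y y x \<notin> {A1, A2, B1, B2} \<and>
    out_x y x \<noteq> u2 \<and> out_x y x \<noteq> v1 \<and> y \<notin> {a1, a2} \<and> out_y y x \<notin> {a1, a2}"

lemma good_phim: "good y x \<Longrightarrow> phim (Tor y x) = Tor (out_y y x) (out_x y x)"
  unfolding good_def out_y_def by (rule phim_Tor) auto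

lemma good_nz:
  assumes "good y x"
  shows "mid_y y x \<noteq> 0" "out_x y x \<noteq> 0" "out_y y x \<noteq> 0"
proof -
  show Y: "mid_y y x \<noteq> 0" using assms by (auto simp: good_def mid_y_def)
  show "out_x y x \<noteq> 0" using assms nz by (auto simp: good_def out_x_def)
  show "out_y y x \<noteq> 0" using assms Y nz by (auto simp: good_def out_y_def)
qed

text \<open>Solving backwards, from \<open>Y\<close> and \<open>Z = \<xi>'\<close> to
  \<open>x\<close> and then to \<open>y\<close>, turns every condition into the exclusion of
  finitely many values of \<open>Y\<close> or \<open>Z\<close>.\<close>

lemma good_ex: "\<exists>y x. good y x"
proof -
  have "finite {0, A1, A2, B1, B2, 1 / a1, 1 / a2, a1 / (b1 * b2), a2 / (b1 * b2)}" by simp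
  then obtain Y where Y: "Y \<notin> {0, A1, A2, B1, B2, 1 / a1, 1 / a2, a1 / (b1 * b2), a2 / (b1 * b2)}"
    by (rule complex_avoiding)
  \<comment> \<open>\<open>K\<close> is the product of \<open>\<xi>\<close> and
    \<open>\<xi>'\<close> for given \<open>Y\<close>; \<open>e a\<close> is the value of
    \<open>x\<close> for which \<open>y = a\<close>, and \<open>f a\<close> the value of
    \<open>Z\<close> for which \<open>y' = a\<close>.\<close>
  define K where "K = u2 * v2 * (Y - A1) * (Y - A2) / ((Y - B1) * (Y - B2))"
  have K: "K \<noteq> 0" using Y nz by (simp add: K_def)
  define e where "e a = (u1 - a * Y * v2) / (1 - a * Y)" for a
  define f where "f a = (b1 * b2 * Y * u2 - a * v1) / (b1 * b2 * Y - a)" for a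
  have "finite {0, u2, v1, K / u1, K / v2, K / e a1, K / e a2, f a1, f a2}" by simp
  then obtain Z where Z: "Z \<notin> {0, u2, v1, K / u1, K / v2, K / e a1, K / e a2, f a1, f a2}"
    by (rule complex_avoiding)
  define x where "x = K / Z"
  have Z0: "Z \<noteq> 0" using Z by simp
  have x0: "x \<noteq> 0" using K Z0 by (simp add: x_def)
  have KZ: "Z = K / x" using K Z0 by (simp add: x_def)
  have x: "x \<noteq> u1" "x \<noteq> v2" "x \<noteq> e a1" "x \<noteq> e a2" using Z KZ by auto
  define y where "y = (x - u1) / (Y * (x - v2))"
  have y0: "y \<noteq> 0" using x Y by (simp add: y_def)
  have mid_y: "mid_y y x = Y" using x Y by (simp add: mid_y_def y_def)
  have out_x: "out_x y x = Z" using x0 unfolding out_x_def mid_y KZ K_def by simp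
  have ya: "y \<noteq> a" if "x \<noteq> e a" "Y \<noteq> 1 / a" "a \<noteq> 0" for a
  proof
    assume "y = a"
    then have "x - u1 = a * (Y * (x - v2))" using x Y unfolding y_def by (simp add: divide_eq_eq)
    then have "x * (1 - a * Y) = u1 - a * Y * v2" by (simp add: algebra_simps)
    moreover have "1 - a * Y \<noteq> 0" using that by (auto simp: field_simps)
    ultimately show False using that(1) by (simp add: e_def eq_divide_eq)
  qed
  have za: "out_y y x \<noteq> a" if "Z \<noteq> f a" "Y \<noteq> a / (b1 * b2)" for a
  proof
    assume "out_y y x = a"
    then have "b1 * b2 * Y * (Z - u2) = a * (Z - v1)" using Z unfolding out_y_def mid_y out_x by (simp add: divide_eq_eq)
    then have "Z * (b1 * b2 * Y - a) = b1 * b2 * Y * u2 - a * v1" by (simp add: algebra_simps)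
    moreover have "b1 * b2 * Y - a \<noteq> 0" using that(2) nz by (auto simp: field_simps)
    ultimately show False using that(1) by (simp add: f_def eq_divide_eq)
  qed
  have "good y x" unfolding good_def mid_y out_x using x0 y0 x Y Z ya za nz by simp
  then show ?thesis by blast
qed

lemma regular_at_mid_y: "fst v \<noteq> 0 \<Longrightarrow> snd v \<noteq> v2 \<Longrightarrow> regular_at v (\<lambda>w. mid_y (fst w) (snd w))"
  unfolding mid_y_def by (intro regular_at_intros) auto

lemma regular_at_out_x:
  "fst v \<noteq> 0 \<Longrightarrow> snd v \<noteq> 0 \<Longrightarrow> snd v \<noteq> v2 \<Longrightarrow> mid_y (fst v) (snd v) \<notin> {B1, B2} \<Longrightarrow> regular_at v (\<lambda>w. out_x (fst w) (snd w))"
  unfolding out_x_def by (intro regular_at_intros regular_at_mid_y) auto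

lemma generic_good: "generic (\<lambda>w. good (fst w) (snd w))"
proof -
  obtain y x where g: "good y x" using good_ex by blast
  have rY: "regular_at (y, x) (\<lambda>w. mid_y (fst w) (snd w))" using g by (intro regular_at_mid_y) (auto simp: good_def)
  have rX: "regular_at (y, x) (\<lambda>w. out_x (fst w) (snd w))" using g by (intro regular_at_out_x) (auto simp: good_def)
  have rZ: "regular_at (y, x) (\<lambda>w. out_y (fst w) (snd w))"
    unfolding out_y_def by (intro regular_at_intros rX rY) (use g in \<open>auto simp: good_def\<close>)
  have ne: "generic (\<lambda>w. h w \<noteq> k)" if "regular_at (y, x) h" "h (y, x) \<noteq> k" for h k
  proof -
    have "generic (\<lambda>w. h w - k \<noteq> 0)" by (rule regular_at_generic[of "(y, x)"]) (use that in \<open>auto intro: regular_at_intros\<close>)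
    then show ?thesis by simp
  qed
  show ?thesis
    unfolding good_def insert_iff empty_iff de_Morgan_disj not_False_eq_True simp_thms
    by (intro generic_conj ne regular_at_fst regular_at_snd rX rY rZ) (use g in \<open>auto simp: good_def\<close>)
qed

abbreviation "\<alpha> \<equiv> u2 / v1"
abbreviation "\<beta> \<equiv> u1 / v2"
abbreviation "w \<equiv> b1 * b2"

lemma alpha_beta_w: "a1 * a2 = \<alpha> * \<beta> * w"
  using balance nz by (simp add: field_simps)

lemma good_relations:
  assumes "good y x"
  shows "x / v2 \<noteq> 0" "x / v2 \<noteq> 1" "out_x y x / v1 \<noteq> 1" "mid_y y x \<noteq> 0"
    "(x / v2) * (out_x y x / v1) * (w * (mid_y y x)\<^sup>2 - (b1 + b2) * mid_y y x + 1) = \<alpha> * w * (mid_y y x)\<^sup>2 - (a1 + a2) * mid_y y x + \<beta>"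
    "y * (mid_y y x * (x / v2 - 1)) = x / v2 - \<beta>"
    "out_y y x * (out_x y x / v1 - 1) = w * mid_y y x * (out_x y x / v1 - \<alpha>)"
    "w * (mid_y y x)\<^sup>2 - (b1 + b2) * mid_y y x + 1 \<noteq> 0"
proof -
  define Y where "Y = mid_y y x"
  define Z where "Z = out_x y x"
  have g: "x \<noteq> 0" "y \<noteq> 0" "x \<noteq> u1" "x \<noteq> v2" "Y \<noteq> B1" "Y \<noteq> B2" "Z \<noteq> v1"
    using assms by (auto simp: good_def Y_def Z_def)
  show "x / v2 \<noteq> 0" "x / v2 \<noteq> 1" "out_x y x / v1 \<noteq> 1" "mid_y y x \<noteq> 0"
    using g nz good_nz[OF assms] by (auto simp: Z_def)
  have QB: "w * Y\<^sup>2 - (b1 + b2) * Y + 1 = w * (Y - B1) * (Y - B2)"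
    using nz by (simp add: B1_def B2_def field_simps power2_eq_square)
  then show "w * (mid_y y x)\<^sup>2 - (b1 + b2) * mid_y y x + 1 \<noteq> 0" using g nz by (simp add: Y_def)
  have QA: "\<alpha> * w * Y\<^sup>2 - (a1 + a2) * Y + \<beta> = \<alpha> * w * (Y - A1) * (Y - A2)"
  proof -
    have "\<alpha> * w * A1 = a2" "\<alpha> * w * A2 = a1"
      using balance nz by (simp_all add: A1_def A2_def field_simps)
    moreover have "a2 * A2 = \<beta>" using nz by (simp add: A2_def)
    moreover have "c * (Y - A1) * (Y - A2) = c * Y\<^sup>2 - (c * A1 + c * A2) * Y + c * A1 * A2" for c
      by (simp add: algebra_simps power2_eq_square)
    ultimately show ?thesis by (simp only: add.commute)
  qed
  have xZ: "x * Z * ((Y - B1) * (Y - B2)) = u2 * v2 * (Y - A1) * (Y - A2)"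
    using g unfolding Z_def out_x_def Y_def[symmetric] by simp
  have "(x / v2) * (Z / v1) * (w * (Y - B1) * (Y - B2)) = w / (v1 * v2) * (x * Z * ((Y - B1) * (Y - B2)))"
    by (simp add: mult_ac)
  also have "\<dots> = \<alpha> * w * (Y - A1) * (Y - A2)" unfolding xZ using nz by simp
  finally show "(x / v2) * (out_x y x / v1) * (w * (mid_y y x)\<^sup>2 - (b1 + b2) * mid_y y x + 1) = \<alpha> * w * (mid_y y x)\<^sup>2 - (a1 + a2) * mid_y y x + \<beta>"
    unfolding Y_def[symmetric] Z_def[symmetric] QA QB .
  have "Y * (y * (x - v2)) = x - u1" using g by (simp add: Y_def mid_y_def)
  then show "y * (mid_y y x * (x / v2 - 1)) = x / v2 - \<beta>"
    using nz unfolding Y_def[symmetric] by (simp add: field_simps)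
  have "out_y y x * (Z - v1) = w * Y * (Z - u2)" using g by (simp add: out_y_def Y_def Z_def)
  then show "out_y y x * (out_x y x / v1 - 1) = w * mid_y y x * (out_x y x / v1 - \<alpha>)"
    using nz unfolding Y_def[symmetric] Z_def[symmetric] by (simp add: field_simps)
qed

lemma good_dpoly_nz:
  assumes "good y x"
  shows "dpoly (x / v2) \<alpha> \<beta> w (b1 + b2) (a1 + a2) y \<noteq> 0"
proof -
  note R = good_relations[OF assms]
  have "x / v2 - \<beta> \<noteq> 0" using assms nz by (auto simp: good_def diff_divide_distrib[symmetric])
  moreover have "1 - out_x y x / v1 \<noteq> 0" using R(3) by auto
  ultimately have "dpoly (x / v2) \<alpha> \<beta> w (b1 + b2) (a1 + a2) y * (mid_y y x)\<^sup>2 \<noteq> 0"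
    unfolding den_factor[OF R(1-7)] using R(1,8) by simp
  then show ?thesis by auto
qed

end

section \<open>Matrices and coordinates\<close>

lemma mat22_nth [simp]:
  "mat22 a b c d $ 1 $ 1 = a" "mat22 a b c d $ 1 $ 2 = b"
  "mat22 a b c d $ 2 $ 1 = c" "mat22 a b c d $ 2 $ 2 = d"
  by (simp_all add: mat22_def)

lemma mat2_eq_iff:
  "(A :: mat2) = B \<longleftrightarrow> A $ 1 $ 1 = B $ 1 $ 1 \<and> A $ 1 $ 2 = B $ 1 $ 2 \<and> A $ 2 $ 1 = B $ 2 $ 1 \<and> A $ 2 $ 2 = B $ 2 $ 2"
  by (auto simp: vec_eq_iff forall_2)

lemma mult_mat2_nth: "((A :: mat2) ** B) $ i $ j = A $ i $ 1 * B $ 1 $ j + A $ i $ 2 * B $ 2 $ j"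
  by (simp add: matrix_matrix_mult_def sum_2)

lemma mat22_mult:
  "mat22 a b c d ** mat22 a' b' c' d' =
    mat22 (a * a' + b * c') (a * b' + b * d') (c * a' + d * c') (c * b' + d * d')"
  by (simp add: mat2_eq_iff mult_mat2_nth)

lemma det_mat22 [simp]: "det (mat22 a b c d) = a * d - b * c"
  by (simp add: det_2)

lemma mat22_one: "(mat 1 :: mat2) = mat22 1 0 0 1"
  by (simp add: mat2_eq_iff mat_def)

lemma qeval_mat22:
  "qeval (mat22 a b c d, mat22 a' b' c' d', mat22 a'' b'' c'' d'') z =
    mat22 (a + a' * z + a'' * z\<^sup>2) (b + b' * z + b'' * z\<^sup>2) (c + c' * z + c'' * z\<^sup>2) (d + d' * z + d'' * z\<^sup>2)"
  by (simp add: mat2_eq_iff)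

text \<open>Only nonzero sample points are used, because \<open>phi_rel\<close> compares matrices
  only at \<open>z \<noteq> 0\<close>.\<close>

lemma quadratic_coeffs:
  fixes p0 :: complex
  assumes "\<And>z. z \<noteq> 0 \<Longrightarrow> p0 + p1 * z + p2 * z\<^sup>2 = r0 + r1 * z + r2 * z\<^sup>2"
  shows "p0 = r0" "p1 = r1" "p2 = r2"
proof -
  have e: "p0 + p1 + p2 = r0 + r1 + r2" "p0 - p1 + p2 = r0 - r1 + r2"
    "p0 + p1 * 2 + p2 * 4 = r0 + r1 * 2 + r2 * 4"
    using assms[of 1] assms[of "-1"] assms[of 2] by simp_all
  show 1: "p1 = r1" using e(1,2) by algebra
  show 2: "p2 = r2" using e 1 by algebra
  show "p0 = r0" using e 1 2 by algebra
qed

lemma mat_spectrum_lower: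
  assumes "a \<noteq> d"
  shows "mat_spectrum (mat22 a 0 c d) = {a, d}"
proof -
  have mv: "mat22 a 0 c d *v v = l *s v \<longleftrightarrow> a * v $ 1 = l * v $ 1 \<and> c * v $ 1 + d * v $ 2 = l * v $ 2" for v l
    by (simp add: vec_eq_iff forall_2 matrix_vector_mult_def sum_2)
  have "l = a \<or> l = d" if "v \<noteq> 0" "mat22 a 0 c d *v v = l *s v" for v l
    using that unfolding mv by (auto simp: vec_eq_iff forall_2)
  moreover have "\<exists>v. v \<noteq> 0 \<and> mat22 a 0 c d *v v = a *s v"
    unfolding mv by (rule exI[of _ "vector [a - d, c]"]) (use assms in \<open>auto simp: vec_eq_iff forall_2 algebra_simps\<close>)
  moreover have "\<exists>v. v \<noteq> 0 \<and> mat22 a 0 c d *v v = d *s v"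
    unfolding mv by (rule exI[of _ "vector [0, 1]"]) (auto simp: vec_eq_iff forall_2)
  ultimately show ?thesis unfolding mat_spectrum_def by blast
qed

lemma mat_spectrum_upper:
  assumes "a \<noteq> d"
  shows "mat_spectrum (mat22 a b 0 d) = {a, d}"
proof -
  have mv: "mat22 a b 0 d *v v = l *s v \<longleftrightarrow> a * v $ 1 + b * v $ 2 = l * v $ 1 \<and> d * v $ 2 = l * v $ 2" for v l
    by (simp add: vec_eq_iff forall_2 matrix_vector_mult_def sum_2)
  have "l = a \<or> l = d" if "v \<noteq> 0" "mat22 a b 0 d *v v = l *s v" for v l
    using that unfolding mv by (auto simp: vec_eq_iff forall_2)
  moreover have "\<exists>v. v \<noteq> 0 \<and> mat22 a b 0 d *v v = d *s v"
    unfolding mv by (rule exI[of _ "vector [b, d - a]"]) (use assms in \<open>auto simp: vec_eq_iff forall_2 algebra_simps\<close>)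
  moreover have "\<exists>v. v \<noteq> 0 \<and> mat22 a b 0 d *v v = a *s v"
    unfolding mv by (rule exI[of _ "vector [1, 0]"]) (auto simp: vec_eq_iff forall_2)
  ultimately show ?thesis unfolding mat_spectrum_def by blast
qed

section \<open>Conjugacy classes and the coefficients of normal forms\<close>

lemma matrix_inv_mult:
  assumes "invertible (A :: mat2)"
  shows "A ** matrix_inv A = mat 1" "matrix_inv A ** A = mat 1"
  using someI_ex[OF assms[unfolded invertible_def]] unfolding matrix_inv_def by blast+

text \<open>Both members are compared through a common representative \<open>R\<close>. The
  conclusion avoids the inverse of \<open>k\<close>, so entries can be compared as polynomials in
  \<open>z\<close>.\<close>

lemma Xquot_conjugate:
  assumes "C \<in> Xquot P" "A \<in> C" "B \<in> C"
  shows "A \<in> Xbar P" "B \<in> Xbar P"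
    "\<exists>k :: mat2. det k \<noteq> 0 \<and> (\<forall>z. qeval A z ** k = k ** qeval B z \<and> trace (qeval A z) = trace (qeval B z))"
proof -
  obtain R where R: "C = conj_rel P `` {R}" using assms(1) unfolding Xquot_def quotient_def by blast
  then show X: "A \<in> Xbar P" "B \<in> Xbar P" using assms unfolding conj_rel_def by auto
  obtain g where g: "invertible g" "\<And>z. qeval A z = g ** qeval R z ** matrix_inv g"
    using assms(2) R unfolding conj_rel_def by auto
  obtain h where h: "invertible h" "\<And>z. qeval B z = h ** qeval R z ** matrix_inv h"
    using assms(3) R unfolding conj_rel_def by auto
  define k where "k = g ** matrix_inv h"
  have gi: "matrix_inv g ** g = mat 1" "g ** matrix_inv g = mat 1" and hi: "matrix_inv h ** h = mat 1" "h ** matrix_inv h = mat 1"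
    using matrix_inv_mult[OF g(1)] matrix_inv_mult[OF h(1)] by blast+
  have "k ** (h ** matrix_inv g) = g ** (matrix_inv h ** h) ** matrix_inv g"
    by (simp add: k_def matrix_mul_assoc)
  then have "k ** (h ** matrix_inv g) = mat 1" by (simp add: gi hi)
  then have "det k * det (h ** matrix_inv g) = 1" by (metis det_mul det_I)
  then have "det k \<noteq> 0" by auto
  moreover have "qeval A z ** k = k ** qeval B z" for z
  proof -
    have "qeval A z ** k = g ** qeval R z ** (matrix_inv g ** g) ** matrix_inv h"
      unfolding k_def g(2) by (simp add: matrix_mul_assoc)
    moreover have "k ** qeval B z = g ** (matrix_inv h ** h) ** qeval R z ** matrix_inv h"
      unfolding k_def h(2) by (simp add: matrix_mul_assoc)
    ultimately show ?thesis by (simp add: gi hi)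
  qed
  moreover have "trace (qeval A z) = trace (qeval B z)" for z
  proof -
    have "trace (qeval A z) = trace (qeval R z)"
      unfolding g(2) by (subst trace_mul_sym) (simp add: matrix_mul_assoc gi)
    moreover have "trace (qeval B z) = trace (qeval R z)"
      unfolding h(2) by (subst trace_mul_sym) (simp add: matrix_mul_assoc hi)
    ultimately show ?thesis by simp
  qed
  ultimately show "\<exists>k :: mat2. det k \<noteq> 0 \<and> (\<forall>z. qeval A z ** k = k ** qeval B z \<and> trace (qeval A z) = trace (qeval B z))"
    by blast
qed

text \<open>\<open>a\<close> comes from the definition of \<open>\<xi>\<close>, \<open>b\<close>
  from the determinant at the root \<open>z = y\<close> of the 12 entry, and \<open>\<gamma>\<close>
  and \<open>\<beta>\<close> from the coefficients of \<open>z\<^sup>3\<close> and \<open>z\<close>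
  in the determinant.\<close>

definition coef_a :: "params \<Rightarrow> complex \<Rightarrow> complex \<Rightarrow> complex" where
  "coef_a P y \<xi> = ((y - c1 P) * (y - c2 P) / \<xi> - kap1 P * y\<^sup>2 - th1 P) / y"

definition coef_b :: "params \<Rightarrow> complex \<Rightarrow> complex \<Rightarrow> complex" where
  "coef_b P y \<xi> = (kap1 P * kap2 P * \<xi> * (y - c3 P) * (y - c4 P) - kap2 P * y\<^sup>2 - th2 P) / y"

definition coef_g :: "params \<Rightarrow> complex \<Rightarrow> complex \<Rightarrow> complex" where
  "coef_g P y \<xi> = kap1 P * coef_b P y \<xi> + kap2 P * coef_a P y \<xi> + kap1 P * kap2 P * (c1 P + c2 P + c3 P + c4 P)"

definition coef_be :: "params \<Rightarrow> complex \<Rightarrow> complex \<Rightarrow> complex" where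
  "coef_be P y \<xi> = - (kap1 P * kap2 P * (c1 P * c2 P * (c3 P + c4 P) + c3 P * c4 P * (c1 P + c2 P))
      + th1 P * coef_b P y \<xi> + th2 P * coef_a P y \<xi>) / y"

text \<open>In a basis adapted to the transformed matrix, its 12 entry is proportional to
  \<open>phi_den * z - phi_num\<close>, and its 11 entry at \<open>z = y'\<close> is \<open>phi_wit\<close>.\<close>

definition dlt :: "complex \<Rightarrow> params \<Rightarrow> complex" where
  "dlt q P = kap2 P - q * kap1 P"

definition phi_den :: "complex \<Rightarrow> params \<Rightarrow> complex \<Rightarrow> complex \<Rightarrow> complex" where
  "phi_den q P y \<xi> = dlt q P * (q * coef_a P y \<xi> - dlt q P * y - coef_b P y \<xi>) - q * coef_g P y \<xi>"

definition phi_num :: "complex \<Rightarrow> params \<Rightarrow> complex \<Rightarrow> complex \<Rightarrow> complex" where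
  "phi_num q P y \<xi> = q * coef_be P y \<xi> - dlt q P * (q * th1 P - th2 P)"

definition phi_wit :: "complex \<Rightarrow> params \<Rightarrow> complex \<Rightarrow> complex \<Rightarrow> complex \<Rightarrow> complex" where
  "phi_wit q P y \<xi> y' = kap2 P * y'\<^sup>2 + coef_b P y \<xi> * y' + th2 P - dlt q P * y' * (y' - y)"

lemma cubic_zero:
  fixes p1 :: complex
  assumes "\<And>z. p1 * z + p2 * z\<^sup>2 + p3 * z ^ 3 = 0"
  shows "p1 = 0" "p2 = 0" "p3 = 0"
proof -
  have e: "p1 + p2 + p3 = 0" "- p1 + p2 - p3 = 0" "p1 * 2 + p2 * 4 + p3 * 8 = 0"
    using assms[of 1] assms[of "-1"] assms[of 2] by simp_all
  show 1: "p2 = 0" using e(1,2) by algebra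
  show 2: "p3 = 0" using e 1 by algebra
  show "p1 = 0" using e 1 2 by simp
qed

lemma normal_form_coeffs:
  assumes P: "P \<in> param_space q" and y: "y \<noteq> 0" "\<xi> \<noteq> 0"
    and det: "\<And>z. (kap1 P * z\<^sup>2 + a * z + th1 P) * (kap2 P * z\<^sup>2 + b * z + th2 P) - (z - y) * (z * (g * z + be))
        = kap1 P * kap2 P * (z - c1 P) * (z - c2 P) * (z - c3 P) * (z - c4 P)"
    and n: "kap1 P * y\<^sup>2 + a * y + th1 P \<noteq> 0"
    and xi: "\<xi> = (y - c1 P) * (y - c2 P) / (kap1 P * y\<^sup>2 + a * y + th1 P)"
  shows "a = coef_a P y \<xi>" "b = coef_b P y \<xi>" "g = coef_g P y \<xi>" "be = coef_be P y \<xi>"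
proof -
  have bal: "kap1 P * kap2 P * c1 P * c2 P * c3 P * c4 P = th1 P * th2 P"
    using P by (simp add: param_space_def)
  have Q: "\<xi> * (kap1 P * y\<^sup>2 + a * y + th1 P) = (y - c1 P) * (y - c2 P)" using xi n by simp
  have N: "kap1 P * y\<^sup>2 + a * y + th1 P = (y - c1 P) * (y - c2 P) / \<xi>"
    using Q y by (simp add: field_simps)
  show a: "a = coef_a P y \<xi>" unfolding coef_a_def N[symmetric] using y by simp
  have "(kap1 P * y\<^sup>2 + a * y + th1 P) * (kap2 P * y\<^sup>2 + b * y + th2 P)
      = kap1 P * kap2 P * ((y - c1 P) * (y - c2 P)) * (y - c3 P) * (y - c4 P)"
    using det[of y] by simp
  also have "\<dots> = (kap1 P * y\<^sup>2 + a * y + th1 P) * (kap1 P * kap2 P * \<xi> * (y - c3 P) * (y - c4 P))"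
    unfolding Q[symmetric] by (simp only: mult_ac)
  finally have "kap2 P * y\<^sup>2 + b * y + th2 P = kap1 P * kap2 P * \<xi> * (y - c3 P) * (y - c4 P)"
    by (rule mult_left_cancel[OF n, THEN iffD1])
  then show b: "b = coef_b P y \<xi>" unfolding coef_b_def using y by (simp add: field_simps)
  let ?e2 = "c1 P * c2 P + c3 P * c4 P + (c1 P + c2 P) * (c3 P + c4 P)"
  let ?p1 = "th1 P * b + th2 P * a + y * be + kap1 P * kap2 P * (c1 P * c2 P * (c3 P + c4 P) + c3 P * c4 P * (c1 P + c2 P))"
  let ?p3 = "kap1 P * b + kap2 P * a - g + kap1 P * kap2 P * (c1 P + c2 P + c3 P + c4 P)"
  have *: "?p1 * z + (kap1 P * th2 P + kap2 P * th1 P + a * b - be + g * y - kap1 P * kap2 P * ?e2) * z\<^sup>2 + ?p3 * z ^ 3 = 0" for z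
    using det[of z] bal by algebra
  have "?p1 = 0" "?p3 = 0" using cubic_zero[OF *] by blast+
  then show "g = coef_g P y \<xi>" "be = coef_be P y \<xi>"
    unfolding coef_g_def coef_be_def a[symmetric] b[symmetric] using y
    by (auto simp: field_simps eq_neg_iff_add_eq_0)
qed

lemma shift_simps [simp]:
  "kap1 (shift q P) = q * kap1 P" "kap2 (shift q P) = kap2 P" "th1 (shift q P) = q * th1 P" "th2 (shift q P) = th2 P"
  "c1 (shift q P) = c1 P" "c2 (shift q P) = c2 P" "c3 (shift q P) = c3 P" "c4 (shift q P) = c4 P"
  by (simp_all add: shift_def)

lemma has_coordsE:
  assumes "has_coords P C y \<xi>"
  obtains N a b g be where "C \<in> Xquot P" "N \<in> C"
    "\<And>z. qeval N z = mat22 (kap1 P * z\<^sup>2 + a * z + th1 P) (z - y) (z * (g * z + be)) (kap2 P * z\<^sup>2 + b * z + th2 P)"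
    "kap1 P * y\<^sup>2 + a * y + th1 P \<noteq> 0"
    "\<xi> = (y - c1 P) * (y - c2 P) / (kap1 P * y\<^sup>2 + a * y + th1 P)"
  using assms unfolding has_coords_def by blast

lemma Xbar_det:
  "A \<in> Xbar P \<Longrightarrow> det (qeval A z) = kap1 P * kap2 P * (z - c1 P) * (z - c2 P) * (z - c3 P) * (z - c4 P)"
  by (auto simp: Xbar_def)

lemma adapted_entries:
  assumes "adapted P (A0, A1, A2)"
  shows "A0 $ 1 $ 1 = th1 P" "A0 $ 2 $ 1 = 0" "A2 $ 1 $ 2 = 0" "A2 $ 2 $ 2 = kap2 P"
  using assms by (auto simp: vec_eq_iff forall_2 matrix_vector_mult_def sum_2 axis_def)

text \<open>An adapted matrix is conjugate to its normal form by a diagonal matrix, because both have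
  \<open>F\<^sub>1\<close> and \<open>E\<^sub>2\<close> as coordinate lines.\<close>

lemma adapted_normal_form:
  assumes P: "P \<in> param_space q" and C: "C \<in> Xquot P" "A \<in> C" "N \<in> C" and A: "adapted P A"
    and N: "\<And>z. qeval N z = mat22 (kap1 P * z\<^sup>2 + a * z + th1 P) (z - y) (z * (g * z + be)) (kap2 P * z\<^sup>2 + b * z + th2 P)"
  shows "\<exists>d. d \<noteq> 0 \<and> (\<forall>z. qeval A z =
    mat22 (kap1 P * z\<^sup>2 + a * z + th1 P) (d * (z - y)) (z * (g * z + be) / d) (kap2 P * z\<^sup>2 + b * z + th2 P))"
proof -
  have neq: "kap1 P \<noteq> kap2 P" "th1 P \<noteq> th2 P" using P by (auto simp: param_space_def)
  obtain A0 A1 A2 where A3: "A = (A0, A1, A2)" by (cases A)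
  note ent = adapted_entries[OF A[unfolded A3]]
  obtain h :: mat2 where h: "det h \<noteq> 0" and hz: "\<And>z. qeval A z ** h = h ** qeval N z"
    and tr: "\<And>z. trace (qeval A z) = trace (qeval N z)"
    using Xquot_conjugate(3)[OF C] by blast
  have Az: "qeval A z $ i $ j = A0 $ i $ j + A1 $ i $ j * z + A2 $ i $ j * z\<^sup>2" for z i j
    by (simp add: A3)
  have comp: "qeval A z $ i $ 1 * h $ 1 $ j + qeval A z $ i $ 2 * h $ 2 $ j
      = h $ i $ 1 * qeval N z $ 1 $ j + h $ i $ 2 * qeval N z $ 2 $ j" for z i j
    using arg_cong[OF hz[of z], of "\<lambda>M. M $ i $ j"] by (simp only: mult_mat2_nth)
  have tr': "qeval A z $ 1 $ 1 + qeval A z $ 2 $ 2 = qeval N z $ 1 $ 1 + qeval N z $ 2 $ 2" for z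
    using tr[of z] by (simp only: trace_def sum_2)
  have A022: "A0 $ 2 $ 2 = th2 P" using tr'[of 0] by (simp add: Az N ent)
  have h21: "h $ 2 $ 1 = 0" using comp[of 0 2 1] neq by (simp add: Az N ent A022)
  have "A2 $ 1 $ 1 + kap2 P = kap1 P + kap2 P"
    by (rule quadratic_coeffs(3)[of "th1 P + th2 P" "A1 $ 1 $ 1 + A1 $ 2 $ 2" _ "th1 P + th2 P" "a + b"])
      (use tr' in \<open>simp add: Az N ent A022 algebra_simps\<close>)
  then have A211: "A2 $ 1 $ 1 = kap1 P" by simp
  have "kap1 P * h $ 1 $ 2 = kap2 P * h $ 1 $ 2"
    by (rule quadratic_coeffs(3)[of "th1 P * h $ 1 $ 2 + A0 $ 1 $ 2 * h $ 2 $ 2" "A1 $ 1 $ 1 * h $ 1 $ 2 + A1 $ 1 $ 2 * h $ 2 $ 2" _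
          "- h $ 1 $ 1 * y + h $ 1 $ 2 * th2 P" "h $ 1 $ 1 + h $ 1 $ 2 * b"])
      (use comp[of _ 1 2] in \<open>simp add: Az N ent A211 algebra_simps\<close>)
  then have h12: "h $ 1 $ 2 = 0" using neq by simp
  have h0: "h $ 1 $ 1 \<noteq> 0" "h $ 2 $ 2 \<noteq> 0" using h by (auto simp: det_2 h12)
  define d where "d = h $ 1 $ 1 / h $ 2 $ 2"
  have "d \<noteq> 0" using h0 by (simp add: d_def)
  moreover have "qeval A z = mat22 (kap1 P * z\<^sup>2 + a * z + th1 P) (d * (z - y)) (z * (g * z + be) / d) (kap2 P * z\<^sup>2 + b * z + th2 P)" for z
  proof -
    have "qeval A z $ 1 $ 1 * h $ 1 $ 1 = (kap1 P * z\<^sup>2 + a * z + th1 P) * h $ 1 $ 1"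
      using comp[of z 1 1] unfolding N mat22_nth h12 h21 by (simp add: mult.commute)
    moreover have "qeval A z $ 1 $ 2 * h $ 2 $ 2 = d * (z - y) * h $ 2 $ 2"
      using comp[of z 1 2] h0 unfolding N mat22_nth h12 h21 d_def by simp
    moreover have "qeval A z $ 2 $ 1 * h $ 1 $ 1 = z * (g * z + be) / d * h $ 1 $ 1"
      using comp[of z 2 1] h0 unfolding N mat22_nth h12 h21 d_def by simp
    moreover have "qeval A z $ 2 $ 2 * h $ 2 $ 2 = (kap2 P * z\<^sup>2 + b * z + th2 P) * h $ 2 $ 2"
      using comp[of z 2 2] unfolding N mat22_nth h12 h21 by (simp add: mult.commute)
    ultimately show ?thesis
      unfolding mat2_eq_iff mat22_nth using h0 by (simp only: mult_right_cancel simp_thms)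
  qed
  ultimately show ?thesis by blast
qed

text \<open>An arbitrary adapted representative differs from the normal form by a diagonal scaling
  \<open>d\<close>, which cancels. The unknown conjugator \<open>k\<close> to the second normal form
  is then eliminated from the second column of \<open>B k = k N'\<close>.\<close>

lemma phi_coordsD:
  assumes P: "P \<in> param_space q" and q: "q \<noteq> 0" and phi: "((y, \<xi>), (y', \<xi>')) \<in> phi_coords q P"
    and nz: "y \<noteq> 0" "\<xi> \<noteq> 0" "y' \<noteq> 0"
  shows "phi_den q P y \<xi> \<noteq> 0" "y' * phi_den q P y \<xi> = phi_num q P y \<xi>"
    "phi_wit q P y \<xi> y' \<noteq> 0" "\<xi>' * phi_wit q P y \<xi> y' = (y' - c1 P) * (y' - c2 P)"
proof -
  obtain C C' where rel: "phi_rel q P C C'" and hc: "has_coords P C y \<xi>" and hc': "has_coords (shift q P) C' y' \<xi>'"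
    using phi unfolding phi_coords_def by blast
  obtain N a b g be where N: "C \<in> Xquot P" "N \<in> C"
    "\<And>z. qeval N z = mat22 (kap1 P * z\<^sup>2 + a * z + th1 P) (z - y) (z * (g * z + be)) (kap2 P * z\<^sup>2 + b * z + th2 P)"
    "kap1 P * y\<^sup>2 + a * y + th1 P \<noteq> 0"
    "\<xi> = (y - c1 P) * (y - c2 P) / (kap1 P * y\<^sup>2 + a * y + th1 P)"
    using has_coordsE[OF hc] by metis
  obtain N' a' b' g' be' where N': "C' \<in> Xquot (shift q P)" "N' \<in> C'"
    "\<And>z. qeval N' z = mat22 (q * kap1 P * z\<^sup>2 + a' * z + q * th1 P) (z - y') (z * (g' * z + be')) (kap2 P * z\<^sup>2 + b' * z + th2 P)"
    "q * kap1 P * y'\<^sup>2 + a' * y' + q * th1 P \<noteq> 0"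
    "\<xi>' = (y' - c1 P) * (y' - c2 P) / (q * kap1 P * y'\<^sup>2 + a' * y' + q * th1 P)"
    using has_coordsE[OF hc'] unfolding shift_simps by metis
  obtain A B where AB: "A \<in> C" "B \<in> C'" "adapted P A"
    "\<And>z. z \<noteq> 0 \<Longrightarrow> qeval B z = mat22 (q * z) 0 0 1 ** qeval A z ** mat22 (inverse z) 0 0 1"
    using rel unfolding phi_rel_def by blast
  obtain d where d: "d \<noteq> 0" and A: "\<And>z. qeval A z =
    mat22 (kap1 P * z\<^sup>2 + a * z + th1 P) (d * (z - y)) (z * (g * z + be) / d) (kap2 P * z\<^sup>2 + b * z + th2 P)"
    using adapted_normal_form[OF P N(1) AB(1) N(2) AB(3) N(3)] by blast
  have B: "qeval B z = mat22 (q * (kap1 P * z\<^sup>2 + a * z + th1 P)) (q * z * d * (z - y)) ((g * z + be) / d) (kap2 P * z\<^sup>2 + b * z + th2 P)"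
    if "z \<noteq> 0" for z
    using that unfolding AB(4)[OF that] A mat22_mult by (simp add: mat2_eq_iff mult_ac)
  have X: "N \<in> Xbar P" using Xquot_conjugate(2)[OF N(1) AB(1) N(2)] .
  note co = normal_form_coeffs[OF P nz(1,2) _ N(4,5), of b g be]
  have "a = coef_a P y \<xi> \<and> b = coef_b P y \<xi> \<and> g = coef_g P y \<xi> \<and> be = coef_be P y \<xi>"
    using Xbar_det[OF X] co unfolding N(3) det_mat22 by blast
  then have co: "coef_a P y \<xi> = a" "coef_b P y \<xi> = b" "coef_g P y \<xi> = g" "coef_be P y \<xi> = be" by simp_all
  let ?D = "dlt q P"
  have D: "?D \<noteq> 0" using P by (auto simp: dlt_def param_space_def)
  obtain k :: mat2 where k: "det k \<noteq> 0" and kz: "\<And>z. qeval B z ** k = k ** qeval N' z"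
    and tr: "\<And>z. trace (qeval B z) = trace (qeval N' z)"
    using Xquot_conjugate(3)[OF N'(1) AB(2) N'(2)] by blast
  define u1 u2 v1 v2 where "u1 = k $ 1 $ 1" "u2 = k $ 2 $ 1" "v1 = k $ 1 $ 2" "v2 = k $ 2 $ 2"
  have dk: "u1 * v2 - v1 * u2 \<noteq> 0" using k by (simp add: det_2 u1_u2_v1_v2_def)
  have E1: "q * (kap1 P * z\<^sup>2 + a * z + th1 P) * v1 + q * z * d * (z - y) * v2 = u1 * (z - y') + v1 * (kap2 P * z\<^sup>2 + b' * z + th2 P)"
    and E2: "(g * z + be) / d * v1 + (kap2 P * z\<^sup>2 + b * z + th2 P) * v2 = u2 * (z - y') + v2 * (kap2 P * z\<^sup>2 + b' * z + th2 P)"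
    if "z \<noteq> 0" for z
    using arg_cong[OF kz[of z], of "\<lambda>M. M $ 1 $ 2"] arg_cong[OF kz[of z], of "\<lambda>M. M $ 2 $ 2"]
    unfolding mult_mat2_nth B[OF that] N'(3) mat22_nth u1_u2_v1_v2_def by simp_all
  \<comment> \<open>The \<open>z\<^sup>2\<close> coefficient says that the second column of
    \<open>k\<close> spans the \<open>kap2\<close>-eigenline of the leading coefficient of
    \<open>B\<close>.\<close>
  have "q * kap1 P * v1 + q * d * v2 = kap2 P * v1"
    by (rule quadratic_coeffs(3)[of "q * th1 P * v1" "q * a * v1 - q * d * y * v2" _ "- u1 * y' + v1 * th2 P" "u1 + v1 * b'"])
      (use E1 in \<open>simp add: algebra_simps power2_eq_square\<close>)
  then have vd: "q * d * v2 = ?D * v1" by (simp add: dlt_def algebra_simps)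
  then have v: "v1 \<noteq> 0" "v2 \<noteq> 0" using dk q d D by auto
  have E1': "(q * (kap1 P * z\<^sup>2 + a * z + th1 P) + ?D * z * (z - y)) * v1 = u1 * (z - y') + v1 * (kap2 P * z\<^sup>2 + b' * z + th2 P)"
    if "z \<noteq> 0" for z
  proof -
    have "(q * (kap1 P * z\<^sup>2 + a * z + th1 P) + ?D * z * (z - y)) * v1
        = q * (kap1 P * z\<^sup>2 + a * z + th1 P) * v1 + z * (z - y) * (?D * v1)" by (simp add: algebra_simps)
    also have "\<dots> = q * (kap1 P * z\<^sup>2 + a * z + th1 P) * v1 + q * z * d * (z - y) * v2"
      unfolding vd[symmetric] by (simp add: mult_ac)
    finally show ?thesis using E1[OF that] by simp
  qed
  have E2': "(q * (g * z + be) + ?D * (kap2 P * z\<^sup>2 + b * z + th2 P)) * v2 = ?D * u2 * (z - y') + ?D * v2 * (kap2 P * z\<^sup>2 + b' * z + th2 P)"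
    if "z \<noteq> 0" for z
  proof -
    have "?D * ((g * z + be) / d * v1) = (g * z + be) / d * (?D * v1)" by (simp only: mult_ac)
    also have "\<dots> = q * (g * z + be) * v2" unfolding vd[symmetric] using d by simp
    finally have "?D * ((g * z + be) / d * v1) = q * (g * z + be) * v2" .
    then show ?thesis using arg_cong[OF E2[OF that], of "\<lambda>t. ?D * t"] by (simp add: algebra_simps)
  qed
  \<comment> \<open>Eliminating the common 22 entry of \<open>N'\<close> from \<open>E1'\<close> and
    \<open>E2'\<close> leaves a linear function of \<open>z\<close> with root \<open>y'\<close>; its
    scale is \<open>det k\<close>, up to nonzero factors.\<close>
  have lin: "- v1 * v2 * phi_num q P y \<xi> + v1 * v2 * phi_den q P y \<xi> * z + 0 * z\<^sup>2
      = - ?D * (u1 * v2 - v1 * u2) * y' + ?D * (u1 * v2 - v1 * u2) * z + 0 * z\<^sup>2" if "z \<noteq> 0" for z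
    using E1'[OF that] E2'[OF that] unfolding phi_num_def phi_den_def co dlt_def by algebra
  have "- v1 * v2 * phi_num q P y \<xi> = - ?D * (u1 * v2 - v1 * u2) * y'"
    "v1 * v2 * phi_den q P y \<xi> = ?D * (u1 * v2 - v1 * u2)"
    using quadratic_coeffs(1,2)[OF lin] by blast+
  then have num: "v1 * v2 * phi_num q P y \<xi> = ?D * (u1 * v2 - v1 * u2) * y'"
    and den: "v1 * v2 * phi_den q P y \<xi> = ?D * (u1 * v2 - v1 * u2)"
    by simp_all
  show "phi_den q P y \<xi> \<noteq> 0" using den D dk by auto
  have "v1 * v2 * (y' * phi_den q P y \<xi>) = v1 * v2 * phi_num q P y \<xi>"
    unfolding num den[symmetric] by (simp only: mult_ac)
  moreover have "v1 * v2 \<noteq> 0" using v by simp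
  ultimately show "y' * phi_den q P y \<xi> = phi_num q P y \<xi>" by (simp only: mult_left_cancel simp_thms)
  \<comment> \<open>At \<open>z = y'\<close> the first column of \<open>k\<close> drops out. This
    gives the 22 entry of \<open>N'\<close> there, and the trace then gives the 11 entry.\<close>
  have "(q * (kap1 P * y'\<^sup>2 + a * y' + th1 P) + ?D * y' * (y' - y)) * v1 = (kap2 P * y'\<^sup>2 + b' * y' + th2 P) * v1"
    using E1'[OF nz(3)] by simp
  then have "q * (kap1 P * y'\<^sup>2 + a * y' + th1 P) + ?D * y' * (y' - y) = kap2 P * y'\<^sup>2 + b' * y' + th2 P"
    by (rule mult_right_cancel[OF v(1), THEN iffD1])
  moreover have "q * (kap1 P * y'\<^sup>2 + a * y' + th1 P) + (kap2 P * y'\<^sup>2 + b * y' + th2 P)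
      = (q * kap1 P * y'\<^sup>2 + a' * y' + q * th1 P) + (kap2 P * y'\<^sup>2 + b' * y' + th2 P)"
    using tr[of y'] unfolding trace_def sum_2 B[OF nz(3)] N'(3) mat22_nth .
  ultimately have wit: "phi_wit q P y \<xi> y' = q * kap1 P * y'\<^sup>2 + a' * y' + q * th1 P"
    unfolding phi_wit_def co by algebra
  show "phi_wit q P y \<xi> y' \<noteq> 0" "\<xi>' * phi_wit q P y \<xi> y' = (y' - c1 P) * (y' - c2 P)"
    unfolding wit using N'(4,5) by simp_all
qed

text \<open>The coefficients of the difference other than that of \<open>z\<^sup>2\<close> vanish by
  the choice of \<open>g\<close> and \<open>be\<close> and by the parameter relation. Evaluation at
  \<open>z = y\<close> kills the remaining one because \<open>y \<noteq> 0\<close>.\<close>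

lemma normal_form_det:
  assumes P: "P \<in> param_space q" and y: "y \<noteq> 0" "\<xi> \<noteq> 0"
    and co: "a = coef_a P y \<xi>" "b = coef_b P y \<xi>" "g = coef_g P y \<xi>" "be = coef_be P y \<xi>"
  shows "(kap1 P * z\<^sup>2 + a * z + th1 P) * (kap2 P * z\<^sup>2 + b * z + th2 P) - (z - y) * (z * (g * z + be))
    = kap1 P * kap2 P * (z - c1 P) * (z - c2 P) * (z - c3 P) * (z - c4 P)"
proof -
  have bal: "kap1 P * kap2 P * c1 P * c2 P * c3 P * c4 P = th1 P * th2 P"
    using P by (simp add: param_space_def)
  have "a * y = (y - c1 P) * (y - c2 P) / \<xi> - kap1 P * y\<^sup>2 - th1 P"
    using y by (simp add: co(1) coef_a_def)
  then have 1: "\<xi> * (kap1 P * y\<^sup>2 + a * y + th1 P) = (y - c1 P) * (y - c2 P)" using y by simp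
  have 2: "kap2 P * y\<^sup>2 + b * y + th2 P = kap1 P * kap2 P * \<xi> * (y - c3 P) * (y - c4 P)"
    using y by (simp add: co(2) coef_b_def)
  have 3: "g = kap1 P * b + kap2 P * a + kap1 P * kap2 P * (c1 P + c2 P + c3 P + c4 P)"
    by (simp add: co(3) coef_g_def co(1,2)[symmetric])
  have 4: "be * y = - (kap1 P * kap2 P * (c1 P * c2 P * (c3 P + c4 P) + c3 P * c4 P * (c1 P + c2 P))
      + th1 P * b + th2 P * a)"
    using y by (simp add: co(4) coef_be_def co(1,2)[symmetric])
  let ?m = "kap1 P * th2 P + kap2 P * th1 P + a * b - be + g * y
      - kap1 P * kap2 P * (c1 P * c2 P + c3 P * c4 P + (c1 P + c2 P) * (c3 P + c4 P))"
  have "(kap1 P * y\<^sup>2 + a * y + th1 P) * (kap2 P * y\<^sup>2 + b * y + th2 P)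
      = kap1 P * kap2 P * (\<xi> * (kap1 P * y\<^sup>2 + a * y + th1 P)) * (y - c3 P) * (y - c4 P)"
    unfolding 2 by (simp only: mult_ac)
  then have 5: "(kap1 P * y\<^sup>2 + a * y + th1 P) * (kap2 P * y\<^sup>2 + b * y + th2 P)
      = kap1 P * kap2 P * ((y - c1 P) * (y - c2 P)) * (y - c3 P) * (y - c4 P)"
    unfolding 1 .
  have "?m * y\<^sup>2 = 0" using 5 3 4 bal by algebra
  then have "?m = 0" using y by simp
  then show ?thesis using 3 4 bal by algebra
qed

definition nform :: "params \<Rightarrow> complex \<Rightarrow> complex \<Rightarrow> complex \<Rightarrow> complex \<Rightarrow> complex \<Rightarrow> quad_mat" where
  "nform P y a b g be =
    (mat22 (th1 P) (- y) 0 (th2 P), mat22 a 1 be b, mat22 (kap1 P) 0 g (kap2 P))"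

lemma qeval_nform:
  "qeval (nform P y a b g be) z =
    mat22 (kap1 P * z\<^sup>2 + a * z + th1 P) (z - y) (z * (g * z + be)) (kap2 P * z\<^sup>2 + b * z + th2 P)"
  unfolding nform_def qeval_mat22 by (simp add: mat2_eq_iff algebra_simps power2_eq_square)

lemma nform_in_Xbar:
  assumes "kap1 P \<noteq> kap2 P" "th1 P \<noteq> th2 P"
    and "\<And>z. det (qeval (nform P y a b g be) z) = kap1 P * kap2 P * (z - c1 P) * (z - c2 P) * (z - c3 P) * (z - c4 P)"
  shows "nform P y a b g be \<in> Xbar P"
  using assms unfolding nform_def Xbar_def by (simp del: qeval.simps add: mat_spectrum_lower mat_spectrum_upper)

lemma matrix_inv_unique:
  fixes A :: mat2
  assumes "A ** B = mat 1" "B ** A = mat 1"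
  shows "invertible A" "matrix_inv A = B"
proof -
  show A: "invertible A" using assms unfolding invertible_def by blast
  have "matrix_inv A = matrix_inv A ** (A ** B)" by (simp add: assms)
  also have "\<dots> = B" by (simp add: matrix_mul_assoc matrix_inv_mult[OF A])
  finally show "matrix_inv A = B" .
qed

lemma conj_relI:
  assumes "A \<in> Xbar P" "B \<in> Xbar P" "g ** k = mat 1" "k ** g = mat 1"
    and "\<And>z. k ** qeval B z = qeval A z ** k"
  shows "(A, B) \<in> conj_rel P"
proof -
  note g = matrix_inv_unique[OF assms(3,4)]
  have "qeval B z = g ** qeval A z ** matrix_inv g" for z
  proof -
    have "g ** qeval A z ** k = (g ** k) ** qeval B z"
      unfolding matrix_mul_assoc[symmetric] assms(5)[symmetric] ..
    then show ?thesis by (simp add: g assms(3))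
  qed
  with assms(1,2) g(1) show ?thesis unfolding conj_rel_def by blast
qed

lemma Xquot_class:
  assumes "A \<in> Xbar P"
  shows "conj_rel P `` {A} \<in> Xquot P" "A \<in> conj_rel P `` {A}"
  unfolding Xquot_def using assms by (auto intro!: quotientI conj_relI[of A P A "mat 1" "mat 1"])

text \<open>The normal form itself serves as adapted representative, and its transform
  \<open>B\<close> is brought to normal form by an explicit matrix \<open>k\<close> of
  eigenvectors.\<close>

lemma phi_coordsI:
  assumes P: "P \<in> param_space q" and q: "q \<noteq> 0" and y: "y \<noteq> 0" "\<xi> \<noteq> 0" "(y - c1 P) * (y - c2 P) \<noteq> 0"
    and den: "phi_den q P y \<xi> \<noteq> 0" and num: "y' * phi_den q P y \<xi> = phi_num q P y \<xi>" and y': "y' \<noteq> 0"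
    and wit: "phi_wit q P y \<xi> y' \<noteq> 0" and xi': "\<xi>' * phi_wit q P y \<xi> y' = (y' - c1 P) * (y' - c2 P)"
  shows "((y, \<xi>), (y', \<xi>')) \<in> phi_coords q P"
proof -
  have neq: "kap1 P \<noteq> kap2 P" "th1 P \<noteq> th2 P" "q * kap1 P \<noteq> kap2 P" "q * th1 P \<noteq> th2 P"
    using P by (auto simp: param_space_def)
  define a where "a = coef_a P y \<xi>"
  define b where "b = coef_b P y \<xi>"
  define g where "g = coef_g P y \<xi>"
  define be where "be = coef_be P y \<xi>"
  define D where "D = dlt q P"
  define N where "N = nform P y a b g be"
  define B where "B = (mat22 (q * th1 P) 0 be (th2 P), mat22 (q * a) (- q * y) g b, mat22 (q * kap1 P) q 0 (kap2 P))"
  have ay: "kap1 P * y\<^sup>2 + a * y + th1 P = (y - c1 P) * (y - c2 P) / \<xi>"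
    using y by (simp add: a_def coef_a_def)
  note detN = normal_form_det[OF P y(1,2) a_def b_def g_def be_def]
  have Nz: "qeval N z = mat22 (kap1 P * z\<^sup>2 + a * z + th1 P) (z - y) (z * (g * z + be)) (kap2 P * z\<^sup>2 + b * z + th2 P)" for z
    unfolding N_def by (rule qeval_nform)
  have Bz: "qeval B z = mat22 (q * (kap1 P * z\<^sup>2 + a * z + th1 P)) (q * z * (z - y)) (g * z + be) (kap2 P * z\<^sup>2 + b * z + th2 P)" for z
    unfolding B_def qeval_mat22 by (simp add: mat2_eq_iff algebra_simps power2_eq_square)
  have NX: "N \<in> Xbar P"
    unfolding N_def using neq(1,2) by (rule nform_in_Xbar) (simp add: qeval_nform detN del: qeval.simps)
  have detB: "det (qeval B z) = q * kap1 P * kap2 P * (z - c1 P) * (z - c2 P) * (z - c3 P) * (z - c4 P)" for z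
  proof -
    have "det (qeval B z) = q * ((kap1 P * z\<^sup>2 + a * z + th1 P) * (kap2 P * z\<^sup>2 + b * z + th2 P) - (z - y) * (z * (g * z + be)))"
      unfolding Bz det_mat22 by (simp add: algebra_simps)
    then show ?thesis unfolding detN by (simp only: mult_ac)
  qed
  have BX: "B \<in> Xbar (shift q P)"
    using detB neq(3,4) unfolding Xbar_def B_def
    by (simp del: qeval.simps add: mat_spectrum_lower mat_spectrum_upper)
  \<comment> \<open>\<open>(u1, u2)\<close> is the \<open>q \<theta>\<^sub>1\<close>-eigenvector of
    the constant coefficient of \<open>B\<close>, and \<open>(q, D)\<close> below the
    \<open>\<kappa>\<^sub>2\<close>-eigenvector of its leading coefficient. The scale of the former
    is fixed by requiring the new 12 entry to be \<open>z - y'\<close>.\<close>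
  define u1 where "u1 = - q * (q * th1 P - th2 P) / y'"
  define u2 where "u2 = - q * be / y'"
  have u: "u1 * y' = - q * (q * th1 P - th2 P)" "u2 * y' = - q * be"
    using y' by (simp_all add: u1_def u2_def)
  have Dd: "D = kap2 P - q * kap1 P" by (simp add: D_def dlt_def)
  have dn: "phi_den q P y \<xi> = D * (q * a - D * y - b) - q * g"
    "phi_num q P y \<xi> = q * be - D * (q * th1 P - th2 P)"
    by (simp_all add: phi_den_def phi_num_def a_def b_def g_def be_def D_def)
  \<comment> \<open>This is \<open>det k\<close>; it turns out to be \<open>q\<close> times
    \<open>phi_den\<close>, so the hypothesis on \<open>phi_den\<close> makes \<open>k\<close>
    invertible.\<close>
  define d where "d = D * u1 - q * u2"
  have "d * y' = q * phi_den q P y \<xi> * y'"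
    using num u unfolding d_def dn by algebra
  then have d: "d = q * (D * (q * a - D * y - b) - q * g)" using y' dn by simp
  have d0: "d \<noteq> 0" using den q unfolding d dn by simp
  \<comment> \<open>In \<open>B k = k N'\<close>, \<open>b'\<close> is read off the \<open>z\<close>
    coefficient of the 12 entry and \<open>be'\<close> off that of the 11 entry, while
    \<open>a'\<close> comes from the trace.\<close>
  define b' where "b' = q * a - y * D - u1 / q"
  define a' where "a' = q * a + b - b'"
  define be' where "be' = (q * a * u1 - q * y * u2 - u1 * a') / q"
  have b': "q * b' = q * (q * a - y * D) - u1" using q by (simp add: b'_def algebra_simps)
  have be': "q * be' = q * a * u1 - q * y * u2 - u1 * a'" using q by (simp add: be'_def)
  define N' where "N' = nform (shift q P) y' a' b' u2 be'"
  have N'z: "qeval N' z = mat22 (q * kap1 P * z\<^sup>2 + a' * z + q * th1 P) (z - y') (z * (u2 * z + be')) (kap2 P * z\<^sup>2 + b' * z + th2 P)" for z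
    unfolding N'_def qeval_nform by simp
  define k where "k = mat22 u1 q u2 D"
  define h where "h = mat22 (D / d) (- q / d) (- u2 / d) (u1 / d)"
  have hk: "h ** k = mat 1" "k ** h = mat 1"
    unfolding h_def k_def mat22_mult mat22_one using d0
    by (simp_all add: mat2_eq_iff field_simps, simp_all add: d_def algebra_simps)
  have kN: "k ** qeval N' z = qeval B z ** k" for z
  proof -
    have "q * (u1 * (q * kap1 P * z\<^sup>2 + a' * z + q * th1 P) + q * (z * (u2 * z + be'))
        - (q * (kap1 P * z\<^sup>2 + a * z + th1 P) * u1 + q * z * (z - y) * u2)) = 0"
      using be' by algebra
    then have e11: "u1 * (q * kap1 P * z\<^sup>2 + a' * z + q * th1 P) + q * (z * (u2 * z + be'))
        = q * (kap1 P * z\<^sup>2 + a * z + th1 P) * u1 + q * z * (z - y) * u2" using q by simp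
    have e12: "u1 * (z - y') + q * (kap2 P * z\<^sup>2 + b' * z + th2 P)
        = q * (kap1 P * z\<^sup>2 + a * z + th1 P) * q + q * z * (z - y) * D"
      using b' u Dd by algebra
    have be2: "be * u1 = (q * th1 P - th2 P) * u2"
      by (simp add: u1_def u2_def)
    have "q * (u2 * a' + D * be') = q * (g * u1 + b * u2)"
      using be' b' d d_def q unfolding a'_def by algebra
    then have "u2 * a' + D * be' = g * u1 + b * u2" using q by simp
    then have e21: "u2 * (q * kap1 P * z\<^sup>2 + a' * z + q * th1 P) + D * (z * (u2 * z + be'))
        = (g * z + be) * u1 + (kap2 P * z\<^sup>2 + b * z + th2 P) * u2"
      using be2 Dd by algebra
    have "q * (u2 + D * b') = q * (g * q + b * D)"
      using b' d d_def by algebra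
    then have "u2 + D * b' = g * q + b * D" using q by simp
    then have e22: "u2 * (z - y') + D * (kap2 P * z\<^sup>2 + b' * z + th2 P)
        = (g * z + be) * q + (kap2 P * z\<^sup>2 + b * z + th2 P) * D"
      using u by algebra
    show ?thesis unfolding k_def N'z Bz mat22_mult e11 e12 e21 e22 ..
  qed
  have detN': "det (qeval N' z) = det (qeval B z)" for z
  proof -
    have "det k \<noteq> 0" using d0 by (simp add: k_def d_def algebra_simps)
    then show ?thesis using arg_cong[OF kN[of z], of det] by (simp add: det_mul)
  qed
  have N'X: "N' \<in> Xbar (shift q P)"
    unfolding N'_def
    by (rule nform_in_Xbar) (use neq in \<open>simp_all add: detN'[unfolded N'_def] detB del: qeval.simps\<close>)
  define C where "C = conj_rel P `` {N}"
  define C' where "C' = conj_rel (shift q P) `` {B}"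
  note C = Xquot_class[OF NX, folded C_def] and C' = Xquot_class[OF BX, folded C'_def]
  have N'C: "N' \<in> C'" using conj_relI[OF BX N'X hk kN] unfolding C'_def by simp
  have "adapted P N"
    unfolding N_def nform_def by (simp add: vec_eq_iff forall_2 matrix_vector_mult_def sum_2 axis_def)
  moreover have "qeval B z = mat22 (q * z) 0 0 1 ** qeval N z ** mat22 (inverse z) 0 0 1" if "z \<noteq> 0" for z
    using that unfolding Nz Bz mat22_mult by (simp add: mat2_eq_iff mult_ac)
  ultimately have "phi_rel q P C C'" unfolding phi_rel_def using C C' by blast
  moreover have "has_coords P C y \<xi>"
    unfolding has_coords_def using C
    by (intro conjI bexI[of _ N] exI[of _ a] exI[of _ b] exI[of _ g] exI[of _ be]) (use Nz ay y in \<open>auto simp del: qeval.simps\<close>)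
  moreover have "has_coords (shift q P) C' y' \<xi>'"
  proof -
    have "phi_wit q P y \<xi> y' * q = (q * kap1 P * y'\<^sup>2 + a' * y' + q * th1 P) * q"
      unfolding phi_wit_def a_def[symmetric] b_def[symmetric] D_def[symmetric] a'_def
      using b' u Dd by algebra
    then have "phi_wit q P y \<xi> y' = q * kap1 P * y'\<^sup>2 + a' * y' + q * th1 P" using q by simp
    with wit xi' have "q * kap1 P * y'\<^sup>2 + a' * y' + q * th1 P \<noteq> 0"
      "\<xi>' = (y' - c1 P) * (y' - c2 P) / (q * kap1 P * y'\<^sup>2 + a' * y' + q * th1 P)"
      by (simp_all add: eq_divide_eq)
    then show ?thesis
      unfolding has_coords_def using C'(1) N'C N'z unfolding shift_simps by blast
  qed
  ultimately show ?thesis unfolding phi_coords_def by blast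
qed

context
  fixes q :: complex and P :: params and y \<xi> X \<alpha> \<beta> w r s :: complex
  assumes nz: "q \<noteq> 0" "kap2 P \<noteq> 0" "y \<noteq> 0" "X \<noteq> 0"
    and xi: "\<xi> = X * q / kap2 P"
    and th: "q * th1 P = w * \<alpha> * kap2 P" "th2 P = w * \<beta> * q * kap1 P"
    and cs: "c1 P * c2 P = \<alpha> * \<beta> * w" "c3 P * c4 P = w" "c3 P + c4 P = r" "c1 P + c2 P = s"
begin

lemma Q12: "(z - c1 P) * (z - c2 P) = z\<^sup>2 - s * z + \<alpha> * \<beta> * w"
  using cs by algebra

lemma Q34: "(z - c3 P) * (z - c4 P) = z\<^sup>2 - r * z + w"
  using cs by algebra

lemma coef_a_eq:
  "X * q * (coef_a P y \<xi> * y) = kap2 P * (y\<^sup>2 - s * y + \<alpha> * \<beta> * w) - X * q * kap1 P * y\<^sup>2 - X * w * \<alpha> * kap2 P"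
proof -
  have "X * q * (coef_a P y \<xi> * y) = kap2 P * (y\<^sup>2 - s * y + \<alpha> * \<beta> * w) - X * q * kap1 P * y\<^sup>2 - X * (q * th1 P)"
    unfolding coef_a_def Q12 xi using nz by (simp add: field_simps)
  then show ?thesis unfolding th by (simp add: mult_ac)
qed

lemma coef_b_eq:
  "coef_b P y \<xi> * y = kap1 P * q * X * (y\<^sup>2 - r * y + w) - kap2 P * y\<^sup>2 - w * \<beta> * q * kap1 P"
proof -
  have "coef_b P y \<xi> * y = kap1 P * (kap2 P * \<xi>) * ((y - c3 P) * (y - c4 P)) - kap2 P * y\<^sup>2 - th2 P"
    unfolding coef_b_def using nz by (simp add: field_simps)
  then show ?thesis unfolding Q34 th xi using nz by simp
qed

text \<open>Clearing the denominators \<open>X\<close> and \<open>y\<close> on the matrix side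
  produces exactly the polynomials controlled by \<open>den_factor\<close> and
  \<open>num_den\<close>.\<close>

lemma phi_den_eq: "X * y * phi_den q P y \<xi> = - q * kap1 P * kap2 P * dpoly X \<alpha> \<beta> w r s y"
proof -
  have e: "c1 P + c2 P + c3 P + c4 P = r + s" using cs by algebra
  show ?thesis
    using coef_a_eq coef_b_eq unfolding phi_den_def coef_g_def dlt_def dpoly_def e by algebra
qed

lemma phi_num_eq: "X * y\<^sup>2 * phi_num q P y \<xi> = q * kap1 P * kap2 P * w * npoly X \<alpha> \<beta> w r s y"
proof -
  have "coef_be P y \<xi> * y = - (kap1 P * kap2 P * (\<alpha> * \<beta> * w * r + w * s) + th1 P * coef_b P y \<xi> + th2 P * coef_a P y \<xi>)"
    unfolding coef_be_def cs using nz by simp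
  then show ?thesis
    using coef_a_eq coef_b_eq th unfolding phi_num_def dlt_def npoly_def by algebra
qed

lemma phi_wit_eq: "y * phi_wit q P y \<xi> y' = q * kap1 P * mpoly X \<beta> w r y y'"
  using coef_b_eq th unfolding phi_wit_def dlt_def mpoly_def by algebra

end

section \<open>Generic parameters\<close>

text \<open>If \<open>f (Tor y x)\<close> lay on an exceptional curve, the local equation
  \<open>h1\<close> would vanish at the point. Generic agreement forces \<open>h1\<close> to be one
  of \<open>\<phi>1\<close>, \<open>\<phi>2\<close> or the inverse of one of them, which excludes a
  zero.\<close>

lemma morphism_generic_value:
  assumes f: "morphism (Surf C) (Surf D) f" and x: "Tor y x \<in> Surf C"
    and r: "regular_at (y, x) \<phi>1" "regular_at (y, x) \<phi>2" and nz: "\<phi>1 (y, x) \<noteq> 0" "\<phi>2 (y, x) \<noteq> 0"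
    and eq: "generic (\<lambda>w. f (Tor (fst w) (snd w)) = Tor (\<phi>1 w) (\<phi>2 w))"
  shows "f (Tor y x) = Tor (\<phi>1 (y, x)) (\<phi>2 (y, x))"
proof -
  have "map_regular_at (Surf C) f (Tor y x)" using f x unfolding morphism_def by blast
  then obtain h1 h2 e where h: "regular_at (y, x) h1" "regular_at (y, x) h2" "regular_at (y, x) e" "e (y, x) \<noteq> 0"
    and hf: "\<And>w. e w \<noteq> 0 \<Longrightarrow> pchart (Tor y x) w \<in> Surf C \<Longrightarrow> f (pchart (Tor y x) w) = pchart (f (Tor y x)) (h1 w, h2 w)"
    unfolding map_regular_at_def pcoord.simps by blast
  have yx: "y \<noteq> 0" "x \<noteq> 0" using x by auto
  have w0: "(h1 (y, x), h2 (y, x)) = pcoord (f (Tor y x))"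
    by (rule pchart_eq) (use hf[of "(y, x)"] h x in simp)
  have "generic (\<lambda>w. fst w \<noteq> 0)" by (rule regular_at_generic[of "(y, x)"]) (use yx in \<open>auto intro: regular_at_intros\<close>)
  moreover have "generic (\<lambda>w. snd w \<noteq> 0)" by (rule regular_at_generic[of "(y, x)"]) (use yx in \<open>auto intro: regular_at_intros\<close>)
  moreover have "generic (\<lambda>w. e w \<noteq> 0)" by (rule regular_at_generic[of "(y, x)"]) (use h in auto)
  ultimately have "generic (\<lambda>w. fst w \<noteq> 0 \<and> snd w \<noteq> 0 \<and> e w \<noteq> 0 \<and> f (Tor (fst w) (snd w)) = Tor (\<phi>1 w) (\<phi>2 w))"
    using eq by (intro generic_conj)
  then have g: "generic (\<lambda>w. pchart (f (Tor y x)) (h1 w, h2 w) = Tor (\<phi>1 w) (\<phi>2 w))"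
    by (rule generic_mono) (use hf in force)
  show ?thesis
  proof (cases "f (Tor y x)")
    case (Tor a b)
    have "h1 (y, x) = \<phi>1 (y, x)" by (rule generic_regular_at_eq[OF h(1) r(1)], rule generic_mono[OF g]) (simp add: Tor)
    moreover have "h2 (y, x) = \<phi>2 (y, x)" by (rule generic_regular_at_eq[OF h(2) r(2)], rule generic_mono[OF g]) (simp add: Tor)
    ultimately show ?thesis using w0 Tor by simp
  next
    case (Dir k c n)
    then have h0: "h1 (y, x) = 0" using w0 by simp
    have False
    proof (cases k)
      case Y0
      have "h1 (y, x) = \<phi>1 (y, x)"
        by (rule generic_regular_at_eq[OF h(1) r(1)], rule generic_mono[OF g]) (simp add: Dir Y0 split: if_splits)
      then show False using h0 nz by simp
    next
      case YI
      have "h1 (y, x) * \<phi>1 (y, x) = 1"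
        by (rule generic_regular_at_eq[OF regular_at_mult[OF h(1) r(1)] regular_at_const], rule generic_mono[OF g])
          (auto simp add: Dir YI field_simps split: if_splits)
      then show False using h0 by simp
    next
      case X0
      have "h1 (y, x) = \<phi>2 (y, x)"
        by (rule generic_regular_at_eq[OF h(1) r(2)], rule generic_mono[OF g]) (simp add: Dir X0 split: if_splits)
      then show False using h0 nz by simp
    next
      case XI
      have "h1 (y, x) * \<phi>2 (y, x) = 1"
        by (rule generic_regular_at_eq[OF regular_at_mult[OF h(1) r(2)] regular_at_const], rule generic_mono[OF g])
          (auto simp add: Dir XI field_simps split: if_splits)
      then show False using h0 by simp
    qed
    then show ?thesis ..
  qed
qed

text \<open>These are \<open>dist\<close> and \<open>dist_ab\<close> with denominators cleared, as
  far as \<open>param_space\<close> does not contain them. The last four forbid a curve of bidegree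
  (1,1) through \<open>(0, \<xi>\<^sub>5)\<close>, \<open>(\<infinity>, \<xi>\<^sub>8)\<close> and
  one centre each on \<open>\<xi> = 0\<close> and \<open>\<xi> = \<infinity>\<close>.\<close>

locale generic_params =
  fixes q :: complex and P :: params
  assumes q: "q \<noteq> 0" and P: "P \<in> param_space q"
    and c_dist: "c1 P \<noteq> c2 P" "c3 P \<noteq> c4 P"
    and kt_dist: "kap2 P \<noteq> q\<^sup>2 * kap1 P"
      "c1 P * c2 P * kap2 P \<noteq> q * th1 P" "c1 P * c2 P * kap2 P \<noteq> q * th2 P"
      "c1 P * c2 P * kap1 P \<noteq> th1 P" "q * c1 P * c2 P * kap1 P \<noteq> th2 P"
      "c2 P * c3 P * kap2 P \<noteq> q * th1 P" "c1 P * c3 P * kap2 P \<noteq> q * th1 P"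
      "c2 P * c4 P * kap2 P \<noteq> q * th1 P" "c1 P * c4 P * kap2 P \<noteq> q * th1 P"
begin

lemma P_nz: "kap1 P \<noteq> 0" "kap2 P \<noteq> 0" "th1 P \<noteq> 0" "th2 P \<noteq> 0" "c1 P \<noteq> 0" "c2 P \<noteq> 0" "c3 P \<noteq> 0" "c4 P \<noteq> 0"
  and P_balance: "kap1 P * kap2 P * c1 P * c2 P * c3 P * c4 P = th1 P * th2 P"
  and P_dist: "th1 P \<noteq> th2 P" "q * kap1 P \<noteq> kap2 P" "q * th1 P \<noteq> th2 P"
  using P by (auto simp: param_space_def)

sublocale phi_data q "c1 P" "c2 P" "c3 P" "c4 P" "c1 P * c2 P / th1 P" "c1 P * c2 P / th2 P"
  "1 / (q * kap1 P)" "q / kap2 P"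
proof
  have "c1 P * c2 P * (kap1 P * kap2 P * c1 P * c2 P * c3 P * c4 P) = c1 P * c2 P * (th1 P * th2 P)"
    by (simp only: P_balance)
  then show "c1 P * c2 P / th1 P * (c1 P * c2 P / th2 P) * c3 P * c4 P = 1 / (q * kap1 P) * (q / kap2 P) * c1 P * c2 P"
    using P_nz q by (simp add: field_simps)
qed (use P_nz q P_dist c_dist kt_dist in \<open>simp_all add: field_simps power2_eq_square\<close>)

lemma finite_src: "finite (src k)" and src_nz: "0 \<notin> src k"
  and finite_tgt: "finite (tgt k)" and tgt_nz: "0 \<notin> tgt k"
  by (cases k; use nz in auto)+

lemma centres_src: "centres q P = ctrs src"
  using q P_nz by (auto simp: centres_def ctrs_eq)

lemma centres_tgt: "centres q (shift q P) = ctrs tgt"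
  using q P_nz by (auto simp: centres_def ctrs_eq mult.commute)

lemma Ysurf_src: "Ysurf q P = to_bl ` Surf src"
  unfolding Ysurf_def centres_src by (rule to_bl_Surf[symmetric]) (rule finite_src src_nz)+

lemma Ysurf_tgt: "Ysurf q (shift q P) = to_bl ` Surf tgt"
  unfolding Ysurf_def centres_tgt by (rule to_bl_Surf[symmetric]) (rule finite_tgt tgt_nz)+

lemma good_phi:
  assumes g: "good y \<xi>"
  shows "phi_den q P y \<xi> \<noteq> 0" "out_y y \<xi> * phi_den q P y \<xi> = phi_num q P y \<xi>"
    "out_x y \<xi> * phi_wit q P y \<xi> (out_y y \<xi>) = (out_y y \<xi> - c1 P) * (out_y y \<xi> - c2 P)"
    "phi_wit q P y \<xi> (out_y y \<xi>) \<noteq> 0"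
proof -
  define X where "X = \<xi> / (q / kap2 P)"
  define r where "r = c3 P + c4 P"
  define s where "s = c1 P + c2 P"
  note R = good_relations[OF g, folded X_def r_def s_def]
  have y: "y \<noteq> 0" using g by (simp add: good_def)
  have xi: "\<xi> = X * q / kap2 P" using q P_nz by (simp add: X_def)
  have th: "q * th1 P = w * \<alpha> * kap2 P" "th2 P = w * \<beta> * q * kap1 P"
    using q P_nz P_balance by (simp_all add: field_simps)
  have w: "c3 P * c4 P = w" ..
  note T = q P_nz(2) y R(1) xi th alpha_beta_w w r_def[symmetric] s_def[symmetric]
  have D: "X * y * phi_den q P y \<xi> = - q * kap1 P * kap2 P * dpoly X \<alpha> \<beta> w r s y"
    by (rule phi_den_eq) (rule T)+
  have N: "X * y\<^sup>2 * phi_num q P y \<xi> = q * kap1 P * kap2 P * w * npoly X \<alpha> \<beta> w r s y"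
    by (rule phi_num_eq) (rule T)+
  have W: "y * phi_wit q P y \<xi> y' = q * kap1 P * mpoly X \<beta> w r y y'" for y'
    by (rule phi_wit_eq) (rule T)+
  have "dpoly X \<alpha> \<beta> w r s y \<noteq> 0" using good_dpoly_nz[OF g] by (simp add: X_def r_def s_def)
  then have "X * y * phi_den q P y \<xi> \<noteq> 0" unfolding D using q P_nz by simp
  then show "phi_den q P y \<xi> \<noteq> 0" by simp
  have "X * y\<^sup>2 * (out_y y \<xi> * phi_den q P y \<xi>) = out_y y \<xi> * y * (X * y * phi_den q P y \<xi>)"
    by (simp add: power2_eq_square mult_ac)
  also have "\<dots> = - q * kap1 P * kap2 P * (out_y y \<xi> * y * dpoly X \<alpha> \<beta> w r s y)" unfolding D by (simp add: mult_ac)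
  also have "\<dots> = X * y\<^sup>2 * phi_num q P y \<xi>" unfolding num_den[OF R(1-7)] N by (simp add: mult_ac)
  finally have e: "X * y\<^sup>2 * (out_y y \<xi> * phi_den q P y \<xi>) = X * y\<^sup>2 * phi_num q P y \<xi>" .
  have "X * y\<^sup>2 \<noteq> 0" using R(1) y by simp
  from mult_left_cancel[OF this, THEN iffD1, OF e]
  show "out_y y \<xi> * phi_den q P y \<xi> = phi_num q P y \<xi>" .
  have Q: "(out_y y \<xi> - c1 P) * (out_y y \<xi> - c2 P) = (out_y y \<xi>)\<^sup>2 - s * out_y y \<xi> + \<alpha> * \<beta> * w"
    unfolding alpha_beta_w[symmetric] s_def by (simp add: algebra_simps power2_eq_square)
  have "y * (out_x y \<xi> * phi_wit q P y \<xi> (out_y y \<xi>)) = (out_x y \<xi> * (q * kap1 P)) * mpoly X \<beta> w r y (out_y y \<xi>)"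
    using W[of "out_y y \<xi>"] by (simp add: mult_ac)
  also have "\<dots> = y * ((out_y y \<xi> - c1 P) * (out_y y \<xi> - c2 P))"
    using xi_relation[OF R(1-7)] unfolding Q by simp
  finally have e: "y * (out_x y \<xi> * phi_wit q P y \<xi> (out_y y \<xi>)) = y * ((out_y y \<xi> - c1 P) * (out_y y \<xi> - c2 P))" .
  from mult_left_cancel[OF y, THEN iffD1, OF e]
  show wit: "out_x y \<xi> * phi_wit q P y \<xi> (out_y y \<xi>) = (out_y y \<xi> - c1 P) * (out_y y \<xi> - c2 P)" .
  have "(out_y y \<xi> - c1 P) * (out_y y \<xi> - c2 P) \<noteq> 0" using g by (simp add: good_def)
  with wit show "phi_wit q P y \<xi> (out_y y \<xi>) \<noteq> 0" by auto
qed

lemma good_graph: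
  assumes g: "good y \<xi>"
  shows "(Off (Aff y, Aff \<xi>), Off (Aff (out_y y \<xi>), Aff (out_x y \<xi>))) \<in> phi_graph q P"
proof -
  note n = good_nz[OF g] and p = good_phi[OF g]
  have y: "y \<noteq> 0" "\<xi> \<noteq> 0" "(y - c1 P) * (y - c2 P) \<noteq> 0" using g by (auto simp: good_def)
  have "((y, \<xi>), (out_y y \<xi>, out_x y \<xi>)) \<in> phi_coords q P"
    by (rule phi_coordsI[OF P q y p(1,2) n(3) p(4,3)])
  moreover have "Off (Aff y, Aff \<xi>) \<in> Ysurf q P"
    unfolding Ysurf_src using to_bl_Tor_in_iff[of y \<xi>] y by simp
  moreover have "Off (Aff (out_y y \<xi>), Aff (out_x y \<xi>)) \<in> Ysurf q (shift q P)"
    unfolding Ysurf_tgt using to_bl_Tor_in_iff[of "out_y y \<xi>" "out_x y \<xi>"] n by simp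
  ultimately show ?thesis unfolding phi_graph_def by blast
qed

text \<open>At a point of the graph some factor of \<open>phim\<close> may leave the torus, so its
  closed formula can fail. The matrix formulas \<open>f\<close> and \<open>g\<close> are still
  regular there, and they agree with \<open>phim\<close> at good points.\<close>

lemma phim_phi_coords:
  assumes phi: "((y, \<xi>), (y', \<xi>')) \<in> phi_coords q P" and nz: "y \<noteq> 0" "\<xi> \<noteq> 0" "y' \<noteq> 0" "\<xi>' \<noteq> 0"
  shows "phim (Tor y \<xi>) = Tor y' \<xi>'"
proof -
  note D = phi_coordsD[OF P q phi nz(1-3)]
  define f where "f v = phi_num q P (fst v) (snd v) / phi_den q P (fst v) (snd v)" for v
  define g where "g v = (f v - c1 P) * (f v - c2 P) / phi_wit q P (fst v) (snd v) (f v)" for v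
  have y': "f (y, \<xi>) = y'" using D(1,2) by (simp add: f_def divide_eq_eq)
  have xi': "g (y, \<xi>) = \<xi>'" using D(3,4) by (simp add: g_def y' divide_eq_eq)
  have a: "regular_at (y, \<xi>) (\<lambda>v. coef_a P (fst v) (snd v))" and b: "regular_at (y, \<xi>) (\<lambda>v. coef_b P (fst v) (snd v))"
    unfolding coef_a_def coef_b_def by (intro regular_at_intros; use nz in simp)+
  have gg: "regular_at (y, \<xi>) (\<lambda>v. coef_g P (fst v) (snd v))" and be: "regular_at (y, \<xi>) (\<lambda>v. coef_be P (fst v) (snd v))"
    unfolding coef_g_def coef_be_def by (intro regular_at_intros a b; use nz in simp)+
  have "regular_at (y, \<xi>) (\<lambda>v. phi_den q P (fst v) (snd v))" "regular_at (y, \<xi>) (\<lambda>v. phi_num q P (fst v) (snd v))"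
    unfolding phi_den_def phi_num_def by (intro regular_at_intros a b gg be)+
  then have rf: "regular_at (y, \<xi>) f" unfolding f_def[abs_def] by (intro regular_at_divide) (use D in auto)
  have "regular_at (y, \<xi>) (\<lambda>v. phi_wit q P (fst v) (snd v) (f v))"
    unfolding phi_wit_def by (intro regular_at_intros b rf)
  then have rg: "regular_at (y, \<xi>) g"
    unfolding g_def[abs_def] by (intro regular_at_divide regular_at_mult regular_at_diff rf regular_at_const) (use D y' in auto)
  have "generic (\<lambda>v. phim (Tor (fst v) (snd v)) = Tor (f v) (g v))"
  proof (rule generic_mono[OF generic_good])
    fix v assume v: "good (fst v) (snd v)"
    have f: "f v = out_y (fst v) (snd v)" using good_phi(1,2)[OF v] by (simp add: f_def divide_eq_eq)
    have "g v = out_x (fst v) (snd v)" using good_phi(3,4)[OF v] by (simp add: g_def f divide_eq_eq)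
    with f show "phim (Tor (fst v) (snd v)) = Tor (f v) (g v)" using good_phim[OF v] by simp
  qed
  from morphism_generic_value[OF _ _ rf rg _ _ this, of src tgt] show ?thesis
    using surf_iso_phim nz unfolding surf_iso_def y' xi' by simp
qed

lemma phi_extends:
  "\<exists>f. regular_iso (centres q P) (Ysurf q P) (centres q (shift q P)) (Ysurf q (shift q P)) f \<and> extends_phi q P f"
proof -
  define F where "F z = to_bl (phim (inv_into (Surf src) to_bl z))" for z
  have F: "F (to_bl x) = to_bl (phim x)" if "x \<in> Surf src" for x
    using that by (simp add: F_def inv_into_f_f[OF inj_to_bl[of src, OF src_nz]])
  have "regular_iso (centres q P) (Ysurf q P) (centres q (shift q P)) (Ysurf q (shift q P)) F"
    unfolding centres_src centres_tgt Ysurf_src Ysurf_tgt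
    by (rule regular_iso_of_surf_iso[OF surf_iso_phim]) (rule src_nz tgt_nz F, assumption?)+
  moreover have "F x = x'" if graph: "(x, x') \<in> phi_graph q P" for x x'
  proof -
    obtain y \<xi> y' \<xi>' where x: "x = Off (Aff y, Aff \<xi>)" "x' = Off (Aff y', Aff \<xi>')"
      and phi: "((y, \<xi>), (y', \<xi>')) \<in> phi_coords q P" and Y: "x \<in> Ysurf q P" "x' \<in> Ysurf q (shift q P)"
      using graph unfolding phi_graph_def by blast
    have e: "x = to_bl (Tor y \<xi>)" "x' = to_bl (Tor y' \<xi>')" using x by simp_all
    have T: "Tor y \<xi> \<in> Surf src" "Tor y' \<xi>' \<in> Surf tgt"
      using Y unfolding e Ysurf_src Ysurf_tgt to_bl_Tor_in_iff .
    then have "phim (Tor y \<xi>) = Tor y' \<xi>'" by (intro phim_phi_coords[OF phi]) auto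
    then show ?thesis using F[OF T(1)] e by simp
  qed
  moreover have "Ysurf q P \<subseteq> zclosure (centres q P) (Domain (phi_graph q P))"
    unfolding Ysurf_src centres_src
    by (rule to_bl_Surf_subset_zclosure[OF finite_src src_nz generic_good]) (use good_graph in force)
  ultimately show ?thesis unfolding extends_phi_def by blast
qed

end

section \<open>A nonempty open set of parameters\<close>

definition generic_poly :: "complex \<Rightarrow> params \<Rightarrow> complex" where
  "generic_poly q P =
    (c1 P - c2 P) * (c3 P - c4 P) * (kap2 P - q * q * kap1 P) *
    (c1 P * c2 P * kap2 P - q * th1 P) * (c1 P * c2 P * kap2 P - q * th2 P) *
    (c1 P * c2 P * kap1 P - th1 P) * (q * c1 P * c2 P * kap1 P - th2 P) *
    (c2 P * c3 P * kap2 P - q * th1 P) * (c1 P * c3 P * kap2 P - q * th1 P) *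
    (c2 P * c4 P * kap2 P - q * th1 P) * (c1 P * c4 P * kap2 P - q * th1 P)"

lemma generic_poly_in: "generic_poly q \<in> poly_funs {kap1, kap2, th1, th2, c1, c2, c3, c4}"
  unfolding generic_poly_def[abs_def]
  by (intro poly_funs.mult poly_funs_diff poly_funs.const; rule poly_funs.coord; simp)

lemma generic_poly_nonzero:
  assumes q: "q \<noteq> 0"
  shows "\<exists>P \<in> param_space q. generic_poly q P \<noteq> 0"
proof -
  \<comment> \<open>With \<open>kap1 = 1\<close> and \<open>(c1, c2, c3, c4) = (1, 2, 1, 2)\<close>
    the parameter relation reads \<open>th1 * th2 = 4 * K\<close>. Conditions not involving
    \<open>K\<close> restrict \<open>T\<close> to avoid \<open>0\<close>, \<open>2\<close> and
    \<open>2 * q\<close>; each of the others then excludes one value of \<open>K\<close>.\<close>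
  have "finite {0, 2, 2 * q}" by simp
  then obtain T where T: "T \<notin> {0, 2, 2 * q}" by (rule complex_avoiding)
  have "finite {0, 1, q, q * q, T * T / 4, q * (T * T) / 4, q * T, q * T / 2, q * T / 4}" by simp
  then obtain K where K: "K \<notin> {0, 1, q, q * q, T * T / 4, q * (T * T) / 4, q * T, q * T / 2, q * T / 4}"
    by (rule complex_avoiding)
  define P where "P = \<lparr>kap1 = 1, kap2 = K, th1 = T, th2 = 4 * K / T, c1 = 1, c2 = 2, c3 = 1, c4 = 2\<rparr>"
  have "P \<in> param_space q"
    using T K q by (auto simp: P_def param_space_def field_simps)
  moreover have "generic_poly q P \<noteq> 0"
    unfolding generic_poly_def mult_eq_0_iff de_Morgan_disj
    by (intro conjI; use T K q in \<open>simp add: P_def field_simps eq_commute[of "T * q"]\<close>)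
  ultimately show ?thesis by blast
qed

theorem proposition4p4:
  fixes q :: complex
  assumes "q \<noteq> 0"
  shows "for_generic_params q (\<lambda>P.
    \<exists>f. regular_iso (centres q P) (Ysurf q P) (centres q (shift q P)) (Ysurf q (shift q P)) f \<and>
        extends_phi q P f)"
  unfolding for_generic_params_def
proof (rule bexI[OF conjI generic_poly_in])
  show "\<exists>P \<in> param_space q. generic_poly q P \<noteq> 0" using generic_poly_nonzero[OF assms] .
  show "\<forall>P \<in> param_space q. generic_poly q P \<noteq> 0 \<longrightarrow>
    (\<exists>f. regular_iso (centres q P) (Ysurf q P) (centres q (shift q P)) (Ysurf q (shift q P)) f \<and> extends_phi q P f)"
  proof (intro ballI impI)
    fix P assume "P \<in> param_space q" "generic_poly q P \<noteq> 0"
    then interpret generic_params q P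
      by unfold_locales (use assms in \<open>auto simp: generic_poly_def power2_eq_square\<close>)
    show "\<exists>f. regular_iso (centres q P) (Ysurf q P) (centres q (shift q P)) (Ysurf q (shift q P)) f \<and> extends_phi q P f"
      by (rule phi_extends)
  qed
qed

end
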